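(* Let $X=(X_t,t\ge0)$ be a real-valued continuous-time process whose marginals have a common density $f$, and such that for $s\ne t$ the joint density $f_{X_s,X_t}$ of $(X_s,X_t)$ exists and satisfies $f_{X_s,X_t}=f_{X_0,X_{|t-s|}}$. Assume that there is a constant $c>0$ such that for any $u\ge0$ $$\alpha_u=\sup_{t\ge0}\alpha\big(\sigma(X_s,s\le t),\sigma(X_s,s\ge u+t)\big)\le e^{-cu}.$$ Let $K$ be a kernel, let $h_T>0$ with $h_T\to0$ as $T\to\infty$, fix $x\in\mathbb{R}$, and let $$f_T(x)=\frac{1}{Th_T}\int_0^TK\Big(\frac{x-X_t}{h_T}\Big)dt.$$ Suppose that $g_u=f_{X_0,X_u}-f\otimes f$ exists for $u\neq 0$, that the function $u\mapsto\sup_{y,z}|g_u(y,z)|$ is integrable on $]0,\infty[$, and that $g_u(\cdot,\cdot)$ is continuous at $(x,x)$ for each $u>0$. Then for every family of positive reals $(a_T)$ with, as $T\to\infty$, $$a_T\to0,\qquad\frac{a_{[T]}}{a_T}\to1,\qquad\frac{a_TTh_T^2}{(\log T)^4}\to\infty,$$ $\sqrt T\big(f_T(x)-\mathbb{E}f_T(x)\big)$ satisfies the moderate deviations principle with speed $a_T$ and good rate function $$I(t)=\frac{t^2}{4\int_0^\infty g_u(x,x)\,du}.$$ Furthermore, if $f$ is differentiable with $f'$ $l$-Lipschitz for some positive constant $l$, and if $a_TTh_T^4\to0$, then $\sqrt T(f_T(x)-f(x))$ satisfies the moderate deviations principle with speed $a_T$ and the same good rate function $I$.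
   Context: For $\sigma$-algebras $\mathcal{A},\mathcal{B}$, $\alpha(\mathcal{A},\mathcal{B})=\sup_{A\in\mathcal{A},B\in\mathcal{B}}|\mathbb{P}(A\cap B)-\mathbb{P}(A)\mathbb{P}(B)|$. $[T]$ is the integer part of $T$, and $(f\otimes f)(y,z)=f(y)f(z)$. A kernel is a function $K:\mathbb{R}\to\mathbb{R}$ which is a bounded continuous symmetric probability density with respect to Lebesgue measure such that $\lim_{|u|\to\infty}uK(u)=0$ and $\int_{\mathbb{R}}u^2K(u)\,du<\infty$. A family $(Z_T)$ of real random variables satisfies the moderate deviations principle with speed $a_T\to0$ and rate function $I$ if for each Borel set $A\subset\mathbb{R}$, $$-\inf_{t\in A^o}I(t)\le\liminf_{T\to\infty} a_T\log\mathbb{P}(\sqrt{a_T}\,Z_T\in A)\le\limsup_{T\to\infty} a_T\log\mathbb{P}(\sqrt{a_T}\,Z_T\in A)\le-\inf_{t\in\bar A}I(t),$$ where $\bar A$ and $A^o$ denote the closure and interior of $A$. *)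

theory Defs
  imports "HOL-Probability.Probability"
begin

definition alpha_coeff :: "'a measure \<Rightarrow> 'a set set \<Rightarrow> 'a set set \<Rightarrow> real" where
  "alpha_coeff M \<A> \<B> =
     (SUP (A, B) \<in> \<A> \<times> \<B>. \<bar>measure M (A \<inter> B) - measure M A * measure M B\<bar>)"

definition sigma_process :: "'a measure \<Rightarrow> (real \<Rightarrow> 'a \<Rightarrow> real) \<Rightarrow> real set \<Rightarrow> 'a set set" where
  "sigma_process M X S =
     sigma_sets (space M) {X s -` B \<inter> space M | s B. s \<in> S \<and> B \<in> sets borel}"

definition alpha_mixing :: "'a measure \<Rightarrow> (real \<Rightarrow> 'a \<Rightarrow> real) \<Rightarrow> real \<Rightarrow> real" where
  "alpha_mixing M X u =
     (SUP t \<in> {0..}. alpha_coeff M (sigma_process M X {0..t}) (sigma_process M X {u + t..}))"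

text \<open>Joint measurability is what makes time integrals along the paths random variables.\<close>

definition measurable_process :: "'a measure \<Rightarrow> (real \<Rightarrow> 'a \<Rightarrow> real) \<Rightarrow> bool" where
  "measurable_process M X \<longleftrightarrow>
     (\<lambda>(t, \<omega>). X t \<omega>) \<in> borel_measurable (restrict_space borel {0..} \<Otimes>\<^sub>M M)"

definition is_kernel :: "(real \<Rightarrow> real) \<Rightarrow> bool" where
  "is_kernel K \<longleftrightarrow>
     bounded (range K) \<and> continuous_on UNIV K \<and> (\<forall>u. K (- u) = K u) \<and>
     (\<forall>u. 0 \<le> K u) \<and> integrable lborel K \<and> (LINT u|lborel. K u) = 1 \<and>
     ((\<lambda>u. u * K u) \<longlongrightarrow> 0) at_infinity \<and>
     integrable lborel (\<lambda>u. u\<^sup>2 * K u)"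

definition kernel_estimator ::
  "(real \<Rightarrow> real) \<Rightarrow> (real \<Rightarrow> real) \<Rightarrow> (real \<Rightarrow> 'a \<Rightarrow> real) \<Rightarrow> real \<Rightarrow> real \<Rightarrow> 'a \<Rightarrow> real" where
  "kernel_estimator K h X x T \<omega> =
     1 / (T * h T) * (LINT t:{0..T}|lborel. K ((x - X t \<omega>) / h T))"

definition log_prob :: "real \<Rightarrow> ereal" where
  "log_prob p = (if p = 0 then -\<infinity> else ereal (ln p))"

text \<open>Families are indexed by positive reals; values at \<open>T \<le> 0\<close> are irrelevant.\<close>

definition moderate_deviations ::
  "'a measure \<Rightarrow> (real \<Rightarrow> 'a \<Rightarrow> real) \<Rightarrow> (real \<Rightarrow> real) \<Rightarrow> (real \<Rightarrow> ereal) \<Rightarrow> bool" where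
  "moderate_deviations M Z a I \<longleftrightarrow>
     (\<forall>T>0. Z T \<in> borel_measurable M) \<and> (a \<longlongrightarrow> 0) at_top \<and>
     (\<forall>A \<in> sets borel.
        - (INF t \<in> interior A. I t)
          \<le> Liminf at_top (\<lambda>T. ereal (a T) *
               log_prob (measure M {\<omega> \<in> space M. sqrt (a T) * Z T \<omega> \<in> A})) \<and>
        Liminf at_top (\<lambda>T. ereal (a T) *
             log_prob (measure M {\<omega> \<in> space M. sqrt (a T) * Z T \<omega> \<in> A}))
          \<le> Limsup at_top (\<lambda>T. ereal (a T) *
               log_prob (measure M {\<omega> \<in> space M. sqrt (a T) * Z T \<omega> \<in> A})) \<and>
        Limsup at_top (\<lambda>T. ereal (a T) *
             log_prob (measure M {\<omega> \<in> space M. sqrt (a T) * Z T \<omega> \<in> A}))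
          \<le> - (INF t \<in> closure A. I t))"

text \<open>Compactness of the sublevel sets includes lower semicontinuity.\<close>

definition good_rate_function :: "(real \<Rightarrow> ereal) \<Rightarrow> bool" where
  "good_rate_function I \<longleftrightarrow> (\<forall>t. 0 \<le> I t) \<and> (\<forall>r::real. compact {t. I t \<le> ereal r})"

text \<open>The division is that of \<^typ>\<open>ereal\<close>, so if \<open>v = 0\<close> the value is \<open>0\<close> at \<open>t = 0\<close> and
  \<open>\<infinity>\<close> elsewhere, which is the rate function of the degenerate limit.\<close>

definition quadratic_rate :: "real \<Rightarrow> real \<Rightarrow> ereal" where
  "quadratic_rate v t = ereal (t\<^sup>2) / ereal (4 * v)"

end

theory Submission
  imports Defs
begin

text \<open>Write the centred integral of the kernel over a set \<open>A\<close> of times as \<open>S A\<close>. With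
  \<open>t = l / sqrt (a T * T)\<close> the theorem reduces to \<open>a T * ln (E (exp (t * S {0..T}))) \<longrightarrow> l\<^sup>2 * v\<close>, because
  a quadratic limiting log-Laplace transform gives the moderate deviations principle by exponential
  Markov bounds and tilting. The sup norm of the integrand is of order \<open>1 / h T\<close>, so
  strong mixing cannot be used on equally spaced blocks; instead \<open>{0..T}\<close> is split as a Cantor
  set with gaps proportional to the blocks, down to leaves of length \<open>(ln T)\<^sup>2\<close>, on which a
  second order Taylor expansion and the covariance asymptotics apply. The removed fraction tends
  to \<open>0\<close>, and the sum over the removed part is controlled by a Bernstein-type bound obtained by
  repeating the construction on what is left, the parts being combined by convexity
  of the exponential function.\<close>

section \<open>Quadratic log-Laplace asymptotics imply moderate deviations\<close>

text \<open>The obstacle in numbers: let \<open>t\<close> be of order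
  \<open>1 / sqrt (a T * T)\<close> and let the sup norm \<open>m\<close> be of order
  \<open>1 / h T\<close>. Decoupling two sets of total length L across a gap q costs
  \<open>exp (\<bar>t\<bar> * m * L - c * q)\<close>. With equal gaps L runs up to T, and a gap of
  order \<open>\<bar>t\<bar> * m * T\<close> is far longer than the blocks, of length at most
  \<open>1 / (\<bar>t\<bar> * m)\<close>, on which an expansion holds. With gaps adapted to L the
  fraction lost per level is \<open>\<bar>t\<bar> * m / c\<close>, which vanishes. The rate
  condition with the fourth power of \<open>ln T\<close> says exactly that
  \<open>\<bar>t\<bar> * m * (ln T)\<^sup>2\<close> tends to 0. This makes the leaves admissible for
  the Taylor expansion; in the crude bound it pays one logarithm for the number of levels and one
  for the leaf length. Errors add up along the recursion because the sums are centred: all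
  transforms are at least 1, so an additive error between transforms passes to their logarithms. The
  limit \<open>l\<^sup>2 * v\<close> comes from the variance \<open>2 * v\<close> per unit of time,
  and its Legendre transform is \<open>t\<^sup>2 / (4 * v)\<close>.\<close>

lemma exp_diff_ln_div:
  fixes a b y :: real
  assumes "a > 0" "b > 0"
  shows "exp ((y - a * ln b) / a) = exp (y / a) / b"
proof -
  have "(y - a * ln b) / a = y / a - ln b" using assms by (simp add: field_simps)
  then show ?thesis using assms by (simp add: exp_diff)
qed

lemma log_prob_upper:
  assumes "0 < a" "0 \<le> p" "p \<le> exp (y / a)"
  shows "ereal a * log_prob p \<le> ereal y"
proof (cases "p = 0")
  case False
  then have "ln p \<le> y / a" using assms by (metis less_le ln_exp ln_le_cancel_iff exp_gt_zero)
  then have "a * ln p \<le> y" using assms(1) by (simp add: field_simps)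
  then show ?thesis using False by (simp add: log_prob_def)
qed (use assms in \<open>simp add: log_prob_def\<close>)

lemma log_prob_lower:
  assumes "0 < a" "exp (y / a) \<le> p"
  shows "ereal y \<le> ereal a * log_prob p"
proof -
  have p: "p > 0" using assms(2) by (smt (verit) exp_gt_zero)
  then have "y / a \<le> ln p" using assms(2) by (simp add: ln_ge_iff)
  then have "y \<le> a * ln p" using assms(1) by (simp add: field_simps)
  then show ?thesis using p by (simp add: log_prob_def)
qed

lemma quadratic_rate_pos: "v > 0 \<Longrightarrow> quadratic_rate v t = ereal (t\<^sup>2 / (4 * v))"
  by (simp add: quadratic_rate_def)

lemma quadratic_rate_0: "quadratic_rate 0 t = (if t = 0 then 0 else \<infinity>)"
  by (simp add: quadratic_rate_def zero_ereal_def[symmetric] divide_ereal_def)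

lemma good_rate_function_quadratic:
  assumes "v \<ge> 0"
  shows "good_rate_function (quadratic_rate v)"
proof (cases "v = 0")
  case True
  have "{t. quadratic_rate 0 t \<le> ereal r} \<subseteq> {0}" for r
    by (auto simp: quadratic_rate_0 split: if_splits)
  then have "compact {t. quadratic_rate 0 t \<le> ereal r}" for r
    by (meson finite.emptyI finite_imp_compact finite_insert finite_subset)
  then show ?thesis using True by (auto simp: good_rate_function_def quadratic_rate_0)
next
  case False
  then have v: "v > 0" using assms by simp
  have "{t. quadratic_rate v t \<le> ereal r} = {t. t\<^sup>2 / (4 * v) \<le> r}" for r
    by (simp add: quadratic_rate_pos v)
  moreover have "closed {t. t\<^sup>2 / (4 * v) \<le> r}" for r
    using v by (intro closed_Collect_le continuous_intros) auto
  moreover have "bounded {t. t\<^sup>2 / (4 * v) \<le> r}" for r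
  proof (rule boundedI[where B = "sqrt (4 * v * \<bar>r\<bar>)"])
    fix t assume "t \<in> {t. t\<^sup>2 / (4 * v) \<le> r}"
    then have "t\<^sup>2 \<le> 4 * v * \<bar>r\<bar>" using v
      by (smt (verit) divide_le_eq mem_Collect_eq mult.commute mult_less_0_iff mult_minus_right)
    then show "norm t \<le> sqrt (4 * v * \<bar>r\<bar>)"
      using real_le_rsqrt[of "\<bar>t\<bar>" "4 * v * \<bar>r\<bar>"] by simp
  qed
  ultimately show ?thesis using v
    by (auto simp: good_rate_function_def quadratic_rate_pos compact_eq_bounded_closed)
qed

text \<open>The hypotheses of the Gaertner-Ellis theorem for a quadratic limit. \<open>W\<close> is
  the family already multiplied by \<open>sqrt (a T)\<close>. The degenerate case
  \<open>v = 0\<close> is included, so the rate function may be infinite away from 0.\<close>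

locale gaussian_cgf_limit = prob_space M for M :: "'a measure" +
  fixes W :: "real \<Rightarrow> 'a \<Rightarrow> real" and a :: "real \<Rightarrow> real" and v :: real
  assumes W_meas: "\<And>T. T > 0 \<Longrightarrow> W T \<in> borel_measurable M"
    and a_pos: "\<And>T. T > 0 \<Longrightarrow> a T > 0"
    and a_lim: "(a \<longlongrightarrow> 0) at_top"
    and exp_int: "\<And>T l. T > 0 \<Longrightarrow> integrable M (\<lambda>\<omega>. exp (l * W T \<omega> / a T))"
    and cgf_lim: "\<And>l. ((\<lambda>T. a T * ln (LINT \<omega>|M. exp (l * W T \<omega> / a T))) \<longlongrightarrow> l\<^sup>2 * v) at_top"
    and v_nonneg: "v \<ge> 0"
begin

definition cgf :: "real \<Rightarrow> real \<Rightarrow> real" where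
  "cgf T l = a T * ln (LINT \<omega>|M. exp (l * W T \<omega> / a T))"

lemma mgf_eq:
  assumes "T > 0"
  shows "(LINT \<omega>|M. exp (l * W T \<omega> / a T)) = exp (cgf T l / a T)"
proof -
  have "(LINT \<omega>|M. exp (l * W T \<omega> / a T)) > 0"
    using exp_int[OF assms, of l] integral_less_AE_space[of "\<lambda>_. 0" "\<lambda>\<omega>. exp (l * W T \<omega> / a T)"]
    by (simp add: emeasure_space_1)
  then show ?thesis using a_pos[OF assms] by (simp add: cgf_def)
qed

lemma mgf_shift_eq:
  assumes "T > 0"
  shows "(LINT \<omega>|M. exp ((l * W T \<omega> + s) / a T)) = exp ((cgf T l + s) / a T)"
  by (simp add: add_divide_distrib exp_add mgf_eq[OF assms] integral_mult_left_zero)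

lemma exp_shift_int:
  assumes "T > 0"
  shows "integrable M (\<lambda>\<omega>. exp ((l * W T \<omega> + s) / a T))"
  using exp_int[OF assms, of l] by (simp add: add_divide_distrib exp_add)

text \<open>The event is written with the factor \<open>l\<close> so that both tails are covered: a
  negative \<open>l\<close> gives the lower tail.\<close>

lemma exponential_markov:
  assumes "T > 0"
  shows "prob {\<omega> \<in> space M. l * d \<le> l * W T \<omega>} \<le> exp ((cgf T l - l * d) / a T)"
proof -
  note [measurable] = W_meas[OF assms]
  have "prob {\<omega> \<in> space M. l * d \<le> l * W T \<omega>}
      = (LINT \<omega>|M. indicator {\<omega> \<in> space M. l * d \<le> l * W T \<omega>} \<omega>)" by simp
  also have "\<dots> \<le> (LINT \<omega>|M. exp ((l * W T \<omega> + (- (l * d))) / a T))"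
    using a_pos[OF assms]
    by (intro integral_mono exp_shift_int assms integrable_real_indicator)
       (auto simp: indicator_def emeasure_eq_measure)
  finally show ?thesis unfolding mgf_shift_eq[OF assms] by simp
qed

text \<open>Chernoff bound for a set that avoids the interval from \<open>-d\<close> to
  \<open>d\<close>. The limit is even in \<open>l\<close>, so the parameters \<open>l\<close> and
  \<open>-l\<close> give both tails the same exponent.\<close>

lemma eventually_log_prob_upper:
  assumes l: "l \<ge> 0" and d: "\<And>y. y \<in> A \<Longrightarrow> d \<le> \<bar>y\<bar>" and A: "A \<in> sets borel"
    and r: "l\<^sup>2 * v - l * d < s"
  shows "eventually (\<lambda>T. ereal (a T) * log_prob (prob {\<omega> \<in> space M. W T \<omega> \<in> A}) \<le> ereal s) at_top"
proof -
  \<comment> \<open>The slack \<open>s - s'\<close> absorbs the factor 2 of the union bound, which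
    costs only \<open>a T * ln 2\<close>.\<close>
  define s' where "s' = (l\<^sup>2 * v - l * d + s) / 2"
  have s': "l\<^sup>2 * v - l * d < s'" "s' < s" using r by (simp_all add: s'_def field_simps)
  have 1: "eventually (\<lambda>T. cgf T l - l * d < s') at_top"
    by (rule order_tendstoD[OF tendsto_diff[OF cgf_lim[of l] tendsto_const[of "l * d"]], folded cgf_def])
       (use s' in \<open>auto simp: algebra_simps\<close>)
  have 2: "eventually (\<lambda>T. cgf T (-l) - l * d < s') at_top"
    by (rule order_tendstoD[OF tendsto_diff[OF cgf_lim[of "-l"] tendsto_const[of "l * d"]], folded cgf_def])
       (use s' in \<open>auto simp: algebra_simps\<close>)
  have 3: "eventually (\<lambda>T. a T * ln 2 < s - s') at_top"
    by (rule order_tendstoD[OF tendsto_mult_left_zero[OF a_lim]]) (use s' in auto)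
  show ?thesis using 1 2 3 eventually_gt_at_top[of 0]
  proof eventually_elim
    case (elim T)
    note [measurable] = W_meas[OF elim(4)] A
    have a: "a T > 0" using a_pos elim by simp
    have "{\<omega> \<in> space M. W T \<omega> \<in> A} \<subseteq>
      {\<omega> \<in> space M. l * d \<le> l * W T \<omega>} \<union> {\<omega> \<in> space M. (-l) * (-d) \<le> (-l) * W T \<omega>}"
    proof safe
      fix \<omega> assume "W T \<omega> \<in> A" "\<not> (- l) * (- d) \<le> (- l) * W T \<omega>"
      then show "l * d \<le> l * W T \<omega>" using d[of "W T \<omega>"] l
        by (smt (verit) minus_mult_minus mult_left_mono mult_minus_left mult_minus_right)
    qed
    then have "prob {\<omega> \<in> space M. W T \<omega> \<in> A} \<le>
        prob {\<omega> \<in> space M. l * d \<le> l * W T \<omega>} + prob {\<omega> \<in> space M. (-l) * (-d) \<le> (-l) * W T \<omega>}"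
      by (intro order_trans[OF finite_measure_mono measure_Un_le]) auto
    also have "\<dots> \<le> exp (s' / a T) + exp (s' / a T)"
      using elim a
      by (intro add_mono order_trans[OF exponential_markov]) (auto simp: divide_right_mono)
    also have "\<dots> = exp ((s' - a T * ln (1 / 2)) / a T)" using a by (subst exp_diff_ln_div) auto
    also have "\<dots> \<le> exp (s / a T)" using elim a by (simp add: divide_right_mono ln_div)
    finally show ?case using a by (intro log_prob_upper) auto
  qed
qed

lemma Limsup_log_prob_upper:
  assumes A: "A \<in> sets borel" and r: "\<And>t. t \<in> closure A \<Longrightarrow> ereal r < quadratic_rate v t"
  shows "Limsup at_top (\<lambda>T. ereal (a T) * log_prob (prob {\<omega> \<in> space M. W T \<omega> \<in> A})) \<le> ereal (- r)"
proof -
  \<comment> \<open>For positive \<open>v\<close> and \<open>r\<close>, \<open>d\<close> solves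
    \<open>d\<^sup>2 / (4 * v) = r\<close> and \<open>l = d / (2 * v)\<close> minimises
    \<open>l\<^sup>2 * v - l * d\<close>. For \<open>v = 0\<close> the exponent is linear in
    \<open>l\<close>, and \<open>l = r / e\<close> brings it to \<open>- r\<close>.\<close>
  have "\<exists>l d. l \<ge> 0 \<and> (\<forall>y\<in>A. d \<le> \<bar>y\<bar>) \<and> l\<^sup>2 * v - l * d \<le> - r"
  proof (cases "r \<le> 0")
    case True
    then show ?thesis by (intro exI[of _ 0]) auto
  next
    case False
    then have r0: "r > 0" by simp
    show ?thesis
    proof (cases "v = 0")
      case True
      have "0 \<notin> closure A" using r[of 0] True r0 by (auto simp: quadratic_rate_0)
      then obtain e where e: "e > 0" "\<forall>y\<in>A. e \<le> \<bar>y\<bar>"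
        by (auto simp: closure_approachable not_less)
      then show ?thesis using e r0 True by (intro exI[of _ "r / e"] exI[of _ e]) auto
    next
      case False
      then have v: "v > 0" using v_nonneg by simp
      define d where "d = sqrt (4 * v * r)"
      have d2: "d\<^sup>2 = 4 * v * r" using v r0 by (simp add: d_def)
      have d0: "d \<ge> 0" by (simp add: d_def v r0 less_imp_le)
      have "d \<le> \<bar>y\<bar>" if "y \<in> A" for y
      proof -
        have "ereal r < ereal (y\<^sup>2 / (4 * v))"
          using r[of y] that closure_subset v by (auto simp: quadratic_rate_pos)
        then have "4 * v * r < y\<^sup>2" using v by (simp add: field_simps)
        then show ?thesis using d2 by (metis abs_le_square_iff abs_of_nonneg d0 less_imp_le)
      qed
      moreover have "(d / (2 * v))\<^sup>2 * v - d / (2 * v) * d = - r"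
        using v d2 by (simp add: field_simps power2_eq_square)
      ultimately show ?thesis using v d0 by (intro exI[of _ "d / (2 * v)"] exI[of _ d]) auto
    qed
  qed
  then obtain l d where ld: "l \<ge> 0" "\<And>y. y \<in> A \<Longrightarrow> d \<le> \<bar>y\<bar>" "l\<^sup>2 * v - l * d \<le> - r" by blast
  have *: "Limsup at_top (\<lambda>T. ereal (a T) * log_prob (prob {\<omega> \<in> space M. W T \<omega> \<in> A})) \<le> ereal (- r + e)"
    if "e > 0" for e
    by (rule Limsup_bounded, rule eventually_log_prob_upper[OF ld(1,2) A]) (use ld(3) that in auto)
  show ?thesis
    by (rule ereal_le_epsilon2) (use * in auto)
qed

text \<open>The law tilted by \<open>l\<close> concentrates at \<open>2 * v * l\<close>, the
  derivative of \<open>l\<^sup>2 * v\<close>. The tilted measure itself is never formed: the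
  transform at \<open>l\<close> is split over the interval and the two half-lines outside it, and
  the half-lines are controlled by the transforms at \<open>l + \<eta>\<close> and
  \<open>l - \<eta>\<close>. What remains must come from the interval, where the exponential is at
  most \<open>exp (u / a T)\<close>.\<close>

lemma eventually_log_prob_lower:
  assumes \<delta>: "\<delta> > 0" and A: "A \<in> sets borel" and sub: "{2 * v * l - \<delta> <..< 2 * v * l + \<delta>} \<subseteq> A"
  shows "eventually (\<lambda>T. ereal (- l\<^sup>2 * v - (\<bar>l\<bar> + 2) * \<delta>)
     \<le> ereal (a T) * log_prob (prob {\<omega> \<in> space M. W T \<omega> \<in> A})) at_top"
proof -
  define t where "t = 2 * v * l"
  \<comment> \<open>On either half-line the exponent changes in the limit by
    \<open>\<eta> * (\<eta> * v - \<delta>)\<close>, which is negative once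
    \<open>\<eta> * v < \<delta>\<close>. The summand 1 keeps the quotient meaningful for
    \<open>v = 0\<close>.\<close>
  define \<eta> where "\<eta> = \<delta> / (v + 1)"
  have \<eta>: "\<eta> > 0" using \<delta> v_nonneg by (simp add: \<eta>_def)
  have "\<eta> * v < \<delta>" using \<delta> v_nonneg by (simp add: \<eta>_def field_simps)
  then have "\<eta> * (\<eta> * v - \<delta>) < 0" using \<eta> by (simp add: mult_pos_neg)
  then obtain k where k: "k > 0" "\<eta> * (\<eta> * v - \<delta>) < - k"
    by (metis add_0 dense_ge_bounded less_minus_iff minus_zero dense neg_0_less_iff_less)
  have 1: "eventually (\<lambda>T. cgf T (l + \<eta>) - \<eta> * (t + \<delta>) - cgf T l < - k) at_top"
    unfolding cgf_def
    by (rule order_tendstoD[OF tendsto_diff[OF tendsto_diff[OF cgf_lim tendsto_const] cgf_lim]])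
       (use k in \<open>auto simp: t_def power2_eq_square algebra_simps\<close>)
  have 2: "eventually (\<lambda>T. cgf T (l - \<eta>) + \<eta> * (t - \<delta>) - cgf T l < - k) at_top"
    unfolding cgf_def
    by (rule order_tendstoD[OF tendsto_diff[OF tendsto_add[OF cgf_lim tendsto_const] cgf_lim]])
       (use k in \<open>auto simp: t_def power2_eq_square algebra_simps\<close>)
  \<comment> \<open>Because of the margin \<open>k\<close> each half-line carries at most a quarter
    of the transform at \<open>l\<close>, so at least half of it remains on
    \<open>D\<close>.\<close>
  have 3: "eventually (\<lambda>T. a T * ln 4 < k) at_top"
    by (rule order_tendstoD[OF tendsto_mult_left_zero[OF a_lim]]) (use k in auto)
  have 4: "eventually (\<lambda>T. a T * ln 2 < \<delta>) at_top"
    by (rule order_tendstoD[OF tendsto_mult_left_zero[OF a_lim]]) (use \<delta> in auto)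
  have 5: "eventually (\<lambda>T. l\<^sup>2 * v - \<delta> < cgf T l) at_top"
    unfolding cgf_def by (rule order_tendstoD[OF cgf_lim]) (use \<delta> in auto)
  show ?thesis using 1 2 3 4 5 eventually_gt_at_top[of 0]
  proof eventually_elim
    case (elim T)
    note [measurable] = W_meas[OF elim(6)] A
    have a: "a T > 0" using a_pos elim by simp
    define D where "D = {\<omega> \<in> space M. W T \<omega> \<in> {t - \<delta> <..< t + \<delta>}}"
    have [measurable]: "D \<in> sets M" by (simp add: D_def)
    define u where "u = l * t + \<bar>l\<bar> * \<delta>"
    have pointwise: "exp (l * W T \<omega> / a T) \<le> indicator D \<omega> * exp (u / a T)
        + exp (((l + \<eta>) * W T \<omega> + (- \<eta> * (t + \<delta>))) / a T)
        + exp (((l - \<eta>) * W T \<omega> + \<eta> * (t - \<delta>)) / a T)" if "\<omega> \<in> space M" for \<omega>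
    proof -
      have "\<omega> \<in> D \<or> t + \<delta> \<le> W T \<omega> \<or> W T \<omega> \<le> t - \<delta>"
        using that by (auto simp: D_def)
      then consider "\<omega> \<in> D" | "t + \<delta> \<le> W T \<omega>" | "W T \<omega> \<le> t - \<delta>" by blast
      then show ?thesis
      proof cases
        case 1
        then have "\<bar>W T \<omega> - t\<bar> \<le> \<delta>" by (auto simp: D_def)
        then have "l * (W T \<omega> - t) \<le> \<bar>l\<bar> * \<delta>"
          by (metis abs_ge_self abs_ge_zero abs_mult mult_left_mono order_trans)
        then have "l * W T \<omega> \<le> u" by (simp add: u_def algebra_simps)
        then have "exp (l * W T \<omega> / a T) \<le> exp (u / a T)" using a by (simp add: divide_right_mono)
        then show ?thesis using 1 by (simp add: add_increasing2)
      next
        case 2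
        then have "0 \<le> \<eta> * (W T \<omega> - (t + \<delta>))" using \<eta> by simp
        then have "exp (l * W T \<omega> / a T) \<le> exp (((l + \<eta>) * W T \<omega> + (- \<eta> * (t + \<delta>))) / a T)"
          using a by (simp add: divide_right_mono algebra_simps)
        then show ?thesis by (smt (verit) exp_ge_zero indicator_pos_le mult_nonneg_nonneg)
      next
        case 3
        then have "0 \<le> \<eta> * (t - \<delta> - W T \<omega>)" using \<eta> by simp
        then have "exp (l * W T \<omega> / a T) \<le> exp (((l - \<eta>) * W T \<omega> + \<eta> * (t - \<delta>)) / a T)"
          using a by (simp add: divide_right_mono algebra_simps)
        then show ?thesis by (smt (verit) exp_ge_zero indicator_pos_le mult_nonneg_nonneg)
      qed
    qed
    have quarter: "exp (y / a T) \<le> exp (cgf T l / a T) / 4" if "y < cgf T l - k" for y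
    proof -
      have "exp (y / a T) \<le> exp ((cgf T l - a T * ln 4) / a T)"
        using that elim(3) a by (intro iffD2[OF exp_le_cancel_iff] divide_right_mono) auto
      also have "\<dots> = exp (cgf T l / a T) / 4" using a by (simp add: exp_diff_ln_div)
      finally show ?thesis .
    qed
    have intD: "integrable M (\<lambda>\<omega>. indicator D \<omega> * exp (u / a T))"
      by (intro integrable_mult_left integrable_real_indicator) (auto simp: emeasure_eq_measure)
    have "exp (cgf T l / a T) \<le> (LINT \<omega>|M. indicator D \<omega> * exp (u / a T)
        + exp (((l + \<eta>) * W T \<omega> + (- \<eta> * (t + \<delta>))) / a T)
        + exp (((l - \<eta>) * W T \<omega> + \<eta> * (t - \<delta>)) / a T))"
      unfolding mgf_eq[OF elim(6), symmetric]
      using pointwise by (intro integral_mono exp_int elim Bochner_Integration.integrable_add exp_shift_int intD) auto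
    also have "\<dots> = prob D * exp (u / a T) + exp ((cgf T (l + \<eta>) + (- \<eta> * (t + \<delta>))) / a T)
        + exp ((cgf T (l - \<eta>) + \<eta> * (t - \<delta>)) / a T)"
      unfolding Bochner_Integration.integral_add[OF Bochner_Integration.integrable_add[OF intD
            exp_shift_int[OF elim(6)]] exp_shift_int[OF elim(6)]]
          Bochner_Integration.integral_add[OF intD exp_shift_int[OF elim(6)]] mgf_shift_eq[OF elim(6)]
      by simp
    also have "exp ((cgf T (l + \<eta>) + (- \<eta> * (t + \<delta>))) / a T) \<le> exp (cgf T l / a T) / 4"
      by (rule quarter) (use elim(1) in auto)
    also have "exp ((cgf T (l - \<eta>) + \<eta> * (t - \<delta>)) / a T) \<le> exp (cgf T l / a T) / 4"
      by (rule quarter) (use elim(2) in auto)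
    finally have "exp (cgf T l / a T) / 2 \<le> prob D * exp (u / a T)" by simp
    then have "exp (cgf T l / a T) / 2 * exp (- u / a T) \<le> prob D * exp (u / a T) * exp (- u / a T)"
      by (intro mult_right_mono) auto
    then have pD: "exp (cgf T l / a T) / 2 * exp (- u / a T) \<le> prob D"
      by (simp add: mult.assoc exp_add[symmetric] diff_divide_distrib)
    have eq: "- l\<^sup>2 * v = l\<^sup>2 * v - l * t" by (simp add: t_def power2_eq_square)
    have "exp ((- l\<^sup>2 * v - (\<bar>l\<bar> + 2) * \<delta>) / a T) \<le> exp ((cgf T l - u - a T * ln 2) / a T)"
      unfolding eq using elim a by (auto simp: u_def divide_right_mono algebra_simps)
    also have "\<dots> = exp (cgf T l / a T) / 2 * exp (- u / a T)"
    proof -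
      have "exp (- u / a T) = 1 / exp (u / a T)" by (metis exp_minus_inverse exp_minus inverse_eq_divide minus_divide_left)
      then show ?thesis
        unfolding exp_diff_ln_div[OF a zero_less_numeral] diff_divide_distrib exp_diff using a by simp
    qed
    also note pD
    also have "prob D \<le> prob {\<omega> \<in> space M. W T \<omega> \<in> A}"
      using sub by (intro finite_measure_mono) (auto simp: D_def t_def)
    finally show ?case by (rule log_prob_lower[OF a])
  qed
qed

lemma Liminf_log_prob_lower:
  assumes A: "A \<in> sets borel" and t: "t \<in> interior A"
  shows "- quadratic_rate v t \<le> Liminf at_top (\<lambda>T. ereal (a T) * log_prob (prob {\<omega> \<in> space M. W T \<omega> \<in> A}))"
proof (cases "v = 0 \<and> t \<noteq> 0")
  case True
  then show ?thesis by (simp add: quadratic_rate_0)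
next
  case False
  \<comment> \<open>If \<open>v = 0\<close> then \<open>t = 0\<close> here, and division by zero
    gives the correct tilt \<open>l = 0\<close>.\<close>
  define l where "l = t / (2 * v)"
  have tl: "t = 2 * v * l" using False by (auto simp: l_def)
  have I: "quadratic_rate v t = ereal (l\<^sup>2 * v)"
  proof (cases "v = 0")
    case True
    then show ?thesis using False by (simp add: quadratic_rate_0)
  next
    case False
    then have "v > 0" using v_nonneg by simp
    then show ?thesis using False by (simp add: quadratic_rate_pos l_def power2_eq_square)
  qed
  obtain e where e: "e > 0" "ball t e \<subseteq> A" using t mem_interior by blast
  let ?L = "Liminf at_top (\<lambda>T. ereal (a T) * log_prob (prob {\<omega> \<in> space M. W T \<omega> \<in> A}))"
  have *: "ereal (- l\<^sup>2 * v) \<le> ?L + ereal \<epsilon>" if "\<epsilon> > 0" for \<epsilon>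
  proof -
    define \<delta> where "\<delta> = min e (\<epsilon> / (\<bar>l\<bar> + 2))"
    have \<delta>: "\<delta> > 0" "\<delta> \<le> e" "\<delta> \<le> \<epsilon> / (\<bar>l\<bar> + 2)"
      using e that by (auto simp: \<delta>_def)
    then have \<delta>': "(\<bar>l\<bar> + 2) * \<delta> \<le> \<epsilon>"
      by (simp add: pos_le_divide_eq mult.commute)
    have "{2 * v * l - \<delta> <..< 2 * v * l + \<delta>} \<subseteq> A"
      using e(2) \<delta>(2) unfolding tl[symmetric] by (auto simp: dist_real_def subset_eq)
    from Liminf_bounded[OF eventually_log_prob_lower[OF \<delta>(1) A this]]
    have "ereal (- l\<^sup>2 * v - \<epsilon>) \<le> ?L" using \<delta>' by (elim order_trans[rotated]) auto
    then have "ereal (- l\<^sup>2 * v - \<epsilon>) + ereal \<epsilon> \<le> ?L + ereal \<epsilon>" by (rule add_right_mono)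
    then show ?thesis by simp
  qed
  have "ereal (- l\<^sup>2 * v) \<le> ?L" by (rule ereal_le_epsilon2) (use * in auto)
  then show ?thesis by (simp add: I)
qed

end

theorem moderate_deviations_of_cgf_limit:
  assumes "gaussian_cgf_limit M (\<lambda>T \<omega>. sqrt (a T) * Z T \<omega>) a v"
    and Z: "\<And>T. T > 0 \<Longrightarrow> Z T \<in> borel_measurable M"
  shows "moderate_deviations M Z a (quadratic_rate v)"
proof -
  interpret gaussian_cgf_limit M "\<lambda>T \<omega>. sqrt (a T) * Z T \<omega>" a v by fact
  let ?P = "\<lambda>A T. ereal (a T) * log_prob (prob {\<omega> \<in> space M. sqrt (a T) * Z T \<omega> \<in> A})"
  have up: "Limsup at_top (?P A) \<le> - (INF t \<in> closure A. quadratic_rate v t)" if A: "A \<in> sets borel" for A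
  proof (rule ccontr)
    assume "\<not> ?thesis"
    then have "- Limsup at_top (?P A) < (INF t \<in> closure A. quadratic_rate v t)"
      by (simp add: not_le ereal_uminus_less_reorder)
    then obtain r where r: "- Limsup at_top (?P A) < ereal r" "ereal r < (INF t \<in> closure A. quadratic_rate v t)"
      using ereal_dense2 by blast
    have "Limsup at_top (?P A) \<le> ereal (- r)"
      by (rule Limsup_log_prob_upper[OF A]) (use r(2) in \<open>auto simp: less_INF_D\<close>)
    moreover have "ereal (- r) < Limsup at_top (?P A)"
      using r(1) by (simp add: ereal_uminus_less_reorder)
    ultimately show False by simp
  qed
  have lo: "- (INF t \<in> interior A. quadratic_rate v t) \<le> Liminf at_top (?P A)" if A: "A \<in> sets borel" for A
  proof -
    have "- Liminf at_top (?P A) \<le> (INF t \<in> interior A. quadratic_rate v t)"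
      using Liminf_log_prob_lower[OF A] by (intro INF_greatest) (simp add: ereal_uminus_le_reorder)
    then show ?thesis by (simp add: ereal_uminus_le_reorder)
  qed
  show ?thesis unfolding moderate_deviations_def
    using up lo Z a_lim by (auto intro!: Liminf_le_Limsup)
qed

section \<open>Log-Laplace transforms of block sums under strong mixing\<close>

lemma exp_taylor2_bound:
  fixes x :: real
  assumes "\<bar>x\<bar> \<le> 1 / 2"
  shows "\<bar>exp x - (1 + x + x\<^sup>2 / 2)\<bar> \<le> \<bar>x\<bar> ^ 3"
proof -
  have "\<bar>exp x - (\<Sum>k\<le>2. x ^ k / fact k)\<bar> \<le> exp \<bar>x\<bar> * \<bar>x\<bar> ^ Suc 2 / fact 2"
    using Taylor_exp_field[of "x" 2] by simp
  also have "\<dots> \<le> 2 * \<bar>x\<bar> ^ Suc 2 / fact 2"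
  proof -
    have "exp \<bar>x\<bar> \<le> exp (1 / 2)" using assms by simp
    also have "\<dots> \<le> 2" by (rule exp_half_le2)
    finally show ?thesis by (intro divide_right_mono mult_right_mono) auto
  qed
  also have "\<dots> = \<bar>x\<bar> ^ 3" by (simp add: numeral_3_eq_3)
  also have "(\<Sum>k\<le>2. x ^ k / fact k) = 1 + x + x\<^sup>2 / 2" by (simp add: numeral_2_eq_2)
  finally show ?thesis .
qed

text \<open>General Borel sets instead of intervals: kept parts and remainders of the Cantor
  construction are scattered over many pieces, and remainders are subdivided again.\<close>

definition time_set :: "real set \<Rightarrow> bool" where
  "time_set A \<longleftrightarrow> A \<in> sets borel \<and> bounded A \<and> A \<subseteq> {0..}"

abbreviation len :: "real set \<Rightarrow> real" where "len A \<equiv> measure lborel A"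

section \<open>Length and subdivision of time sets\<close>

lemma time_set_fmeasurable: "time_set A \<Longrightarrow> A \<in> fmeasurable lborel"
  by (auto simp: time_set_def intro!: fmeasurableI emeasure_bounded_finite)

lemma time_set_subset: "time_set A \<Longrightarrow> B \<in> sets borel \<Longrightarrow> B \<subseteq> A \<Longrightarrow> time_set B"
  by (auto simp: time_set_def intro: bounded_subset)

lemma time_set_Un: "time_set A \<Longrightarrow> time_set B \<Longrightarrow> time_set (A \<union> B)"
  by (auto simp: time_set_def)

lemma time_set_Diff: "time_set A \<Longrightarrow> time_set B \<Longrightarrow> time_set (A - B)"
  by (rule time_set_subset[of A]) (auto simp: time_set_def)

lemma time_set_Int: "time_set A \<Longrightarrow> B \<in> sets borel \<Longrightarrow> time_set (A \<inter> B)"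
  by (rule time_set_subset[of A]) (auto simp: time_set_def)

lemma len_mono: "time_set A \<Longrightarrow> time_set B \<Longrightarrow> A \<subseteq> B \<Longrightarrow> len A \<le> len B"
  by (auto intro!: measure_mono_fmeasurable dest: time_set_fmeasurable)

lemma len_Un: "time_set A \<Longrightarrow> time_set B \<Longrightarrow> A \<inter> B = {} \<Longrightarrow> len (A \<union> B) = len A + len B"
  using measure_Un3[of A lborel B] by (simp add: time_set_fmeasurable)

lemma len_Diff: "time_set A \<Longrightarrow> time_set B \<Longrightarrow> B \<subseteq> A \<Longrightarrow> len (A - B) = len A - len B"
  using len_Un[of B "A - B"] time_set_Diff[of A B] by (simp add: Un_absorb1)

lemma len_atMost_diff_le:
  assumes A: "time_set A" and "r \<le> s"
  shows "len (A \<inter> {..r}) \<le> len (A \<inter> {..s})" "len (A \<inter> {..s}) - len (A \<inter> {..r}) \<le> s - r"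
proof -
  note [simp] = time_set_Int[OF A]
  show "len (A \<inter> {..r}) \<le> len (A \<inter> {..s})" using assms(2) by (intro len_mono) auto
  have "A \<inter> {..s} = A \<inter> {..r} \<union> A \<inter> {r<..s}" using assms(2) by auto
  then have "len (A \<inter> {..s}) = len (A \<inter> {..r}) + len (A \<inter> {r<..s})"
    by (simp add: len_Un[symmetric] disjoint_iff)
  moreover have "len (A \<inter> {r<..s}) \<le> len {r<..s}"
    using A assms(2) by (intro measure_mono_fmeasurable) (auto simp: time_set_def intro!: fmeasurableI)
  ultimately show "len (A \<inter> {..s}) - len (A \<inter> {..r}) \<le> s - r" using assms(2) by simp
qed

text \<open>The length to the left of \<open>r\<close> is a 1-Lipschitz function of
  \<open>r\<close>, so the intermediate value theorem applies. Scattered sets can thus be cut at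
  prescribed measure rather than at prescribed position.\<close>

lemma len_cut_exists:
  assumes A: "time_set A" and s: "0 \<le> s" "s \<le> len A"
  obtains r where "len (A \<inter> {..r}) = s"
proof -
  obtain b where b: "b > 0" "A \<subseteq> {..b}"
    using A unfolding time_set_def bounded_pos by (auto simp: subset_eq)
  have lip: "1-lipschitz_on UNIV (\<lambda>r. len (A \<inter> {..r}))"
  proof (rule lipschitz_onI)
    fix x y :: real
    show "dist (len (A \<inter> {..x})) (len (A \<inter> {..y})) \<le> 1 * dist x y"
      using len_atMost_diff_le[OF A, of x y] len_atMost_diff_le[OF A, of y x]
      by (cases "x \<le> y") (auto simp: dist_real_def abs_if)
  qed simp
  have "A \<inter> {..b} = A" using b by auto
  moreover have "A \<inter> {..-1} = {}" using A by (force simp: time_set_def)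
  ultimately have "\<exists>r. -1 \<le> r \<and> r \<le> b \<and> len (A \<inter> {..r}) = s"
    using b s lipschitz_on_continuous_on[OF lip]
    by (intro IVT') (auto intro: continuous_on_subset)
  then show ?thesis using that by blast
qed

text \<open>A middle piece of measure \<open>q\<close> is taken out. Since a set between two points
  is no longer than their distance, the two outer halves are then at least \<open>q\<close> apart in
  time, which is what mixing needs.\<close>

lemma len_split:
  assumes A: "time_set A" and q: "0 < q" "q \<le> len A"
  obtains r where "len (A \<inter> {..r}) = (len A - q) / 2" "time_set (A \<inter> {..r})"
    and "\<exists>s. len (A \<inter> {s<..}) = (len A - q) / 2 \<and> r + q \<le> s \<and> time_set (A \<inter> {s<..})"
proof -
  obtain r where r: "len (A \<inter> {..r}) = (len A - q) / 2"
    by (rule len_cut_exists[OF A, of "(len A - q) / 2"]) (use q in auto)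
  obtain s where s: "len (A \<inter> {..s}) = (len A + q) / 2"
    by (rule len_cut_exists[OF A, of "(len A + q) / 2"]) (use q in auto)
  have "r \<le> s" using len_atMost_diff_le(1)[OF A, of s r] r s q by (force simp: field_simps)
  then have "r + q \<le> s" using len_atMost_diff_le(2)[OF A, of r s] r s by (simp add: field_simps)
  moreover have "len (A \<inter> {s<..}) = (len A - q) / 2"
  proof -
    have "A \<inter> {s<..} = A - A \<inter> {..s}" by auto
    then show ?thesis using len_Diff[OF A, of "A \<inter> {..s}"] time_set_Int[OF A] s by (simp add: field_simps)
  qed
  ultimately show ?thesis using that[OF r] time_set_Int[OF A] by auto
qed

text \<open>What the Cantor construction needs to know about the process. The bound in
  \<open>decouple\<close> is the mixing rate times the sup norms of the two exponentials. In the
  application \<open>m\<close> depends on \<open>T\<close> through the bandwidth, while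
  \<open>c\<close> and \<open>V\<close> do not.\<close>

locale block_process = prob_space M for M :: "'a measure" +
  fixes S :: "real set \<Rightarrow> 'a \<Rightarrow> real" and m c V :: real
  assumes S_meas: "\<And>A. time_set A \<Longrightarrow> S A \<in> borel_measurable M"
    and S_bound: "\<And>A \<omega>. time_set A \<Longrightarrow> \<omega> \<in> space M \<Longrightarrow> \<bar>S A \<omega>\<bar> \<le> m * len A"
    and S_Un: "\<And>A B \<omega>. time_set A \<Longrightarrow> time_set B \<Longrightarrow> A \<inter> B = {} \<Longrightarrow> \<omega> \<in> space M \<Longrightarrow>
                 S (A \<union> B) \<omega> = S A \<omega> + S B \<omega>"
    and S_mean: "\<And>A. time_set A \<Longrightarrow> expectation (S A) = 0"
    and S_var: "\<And>A. time_set A \<Longrightarrow> expectation (\<lambda>\<omega>. (S A \<omega>)\<^sup>2) \<le> V * len A"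
    and m_nonneg: "0 \<le> m" and c_pos: "0 < c" and V_nonneg: "0 \<le> V"
    and decouple: "\<And>A B r q \<tau>. time_set A \<Longrightarrow> time_set B \<Longrightarrow> A \<subseteq> {..r} \<Longrightarrow> B \<subseteq> {r + q..} \<Longrightarrow> 0 \<le> q \<Longrightarrow>
       \<bar>expectation (\<lambda>\<omega>. exp (\<tau> * S A \<omega>) * exp (\<tau> * S B \<omega>))
         - expectation (\<lambda>\<omega>. exp (\<tau> * S A \<omega>)) * expectation (\<lambda>\<omega>. exp (\<tau> * S B \<omega>))\<bar>
       \<le> exp (- c * q) * exp (\<bar>\<tau>\<bar> * m * (len A + len B))"
begin

definition cgf :: "real \<Rightarrow> real set \<Rightarrow> real" where
  "cgf \<tau> A = ln (expectation (\<lambda>\<omega>. exp (\<tau> * S A \<omega>)))"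

lemma scaled_bound:
  assumes "time_set A" "\<omega> \<in> space M"
  shows "\<bar>\<tau> * S A \<omega>\<bar> \<le> \<bar>\<tau>\<bar> * m * len A"
  using mult_left_mono[OF S_bound[OF assms], of "\<bar>\<tau>\<bar>"] by (simp add: abs_mult mult.assoc)

lemma exp_integrable:
  assumes "time_set A"
  shows "integrable M (\<lambda>\<omega>. exp (\<tau> * S A \<omega>))"
proof (rule integrable_const_bound[where B = "exp (\<bar>\<tau>\<bar> * m * len A)"])
  show "AE \<omega> in M. norm (exp (\<tau> * S A \<omega>)) \<le> exp (\<bar>\<tau>\<bar> * m * len A)"
    using scaled_bound[OF assms, of _ \<tau>] by (intro AE_I2) (simp add: abs_le_iff)
qed (use S_meas[OF assms] in measurable)

lemma S_integrable:
  assumes "time_set A"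
  shows "integrable M (S A)"
  by (rule integrable_const_bound[where B = "m * len A"])
     (use S_meas[OF assms] S_bound[OF assms] in auto)

text \<open>Jensen's inequality for a centred variable. It keeps all cumulants nonnegative and
  bounds the denominators when additive errors are turned into relative ones.\<close>

lemma mgf_ge_1:
  assumes "time_set A"
  shows "1 \<le> expectation (\<lambda>\<omega>. exp (\<tau> * S A \<omega>))"
proof -
  have "1 = expectation (\<lambda>\<omega>. 1 + \<tau> * S A \<omega>)"
    using S_integrable[OF assms] S_mean[OF assms] by (simp add: prob_space)
  also have "\<dots> \<le> expectation (\<lambda>\<omega>. exp (\<tau> * S A \<omega>))"
    using S_integrable[OF assms] by (intro integral_mono exp_integrable assms exp_ge_add_one_self) auto
  finally show ?thesis .
qed

lemma cgf_nonneg: "time_set A \<Longrightarrow> 0 \<le> cgf \<tau> A"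
  using mgf_ge_1[of A \<tau>] by (simp add: cgf_def)

lemma exp_cgf: "time_set A \<Longrightarrow> exp (cgf \<tau> A) = expectation (\<lambda>\<omega>. exp (\<tau> * S A \<omega>))"
  using mgf_ge_1[of A \<tau>] by (simp add: cgf_def)

text \<open>The cubic remainder is estimated by \<open>b\<close> times the second moment, not by a
  power of \<open>b\<close> alone. The error of a leaf is then proportional to its variance, and the
  errors of all leaves add up to a small multiple of the total length.\<close>

lemma cgf_taylor:
  assumes A: "time_set A" and b: "\<bar>\<tau>\<bar> * m * len A \<le> b" "b \<le> 1 / 2"
  shows "\<bar>cgf \<tau> A - \<tau>\<^sup>2 * expectation (\<lambda>\<omega>. (S A \<omega>)\<^sup>2) / 2\<bar> \<le> 3 / 2 * b * (\<tau>\<^sup>2 * expectation (\<lambda>\<omega>. (S A \<omega>)\<^sup>2))"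
proof -
  note [measurable] = S_meas[OF A]
  define E2 where "E2 = expectation (\<lambda>\<omega>. (S A \<omega>)\<^sup>2)"
  define w where "w = \<tau>\<^sup>2 * E2 / 2"
  define y where "y = expectation (\<lambda>\<omega>. exp (\<tau> * S A \<omega>)) - 1"
  have x: "\<bar>\<tau> * S A \<omega>\<bar> \<le> b" if "\<omega> \<in> space M" for \<omega>
    using scaled_bound[OF A that, of \<tau>] b by linarith
  obtain \<omega>0 where "\<omega>0 \<in> space M" using not_empty by blast
  then have b0: "0 \<le> b" using x by (meson abs_ge_zero order_trans)
  have int2: "integrable M (\<lambda>\<omega>. (\<tau> * S A \<omega>)\<^sup>2)"
  proof (rule integrable_const_bound[where B = "b\<^sup>2"])
    show "AE \<omega> in M. norm ((\<tau> * S A \<omega>)\<^sup>2) \<le> b\<^sup>2"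
      using x b0 by (intro AE_I2) (simp add: abs_le_square_iff[symmetric])
  qed measurable
  have int1: "integrable M (\<lambda>\<omega>. \<tau> * S A \<omega>)" using S_integrable[OF A] by simp
  have w_eq: "expectation (\<lambda>\<omega>. (\<tau> * S A \<omega>)\<^sup>2) = 2 * w"
    by (simp add: w_def E2_def power_mult_distrib)
  have w_le: "2 * w \<le> b\<^sup>2"
  proof -
    have "expectation (\<lambda>\<omega>. (\<tau> * S A \<omega>)\<^sup>2) \<le> expectation (\<lambda>\<omega>. b\<^sup>2)"
      using x b0 by (intro integral_mono int2) (simp_all add: abs_le_square_iff[symmetric])
    then show ?thesis by (simp add: w_eq prob_space)
  qed
  have w0: "0 \<le> w" by (simp add: w_def E2_def)
  have "y - w = expectation (\<lambda>\<omega>. exp (\<tau> * S A \<omega>) - (1 + \<tau> * S A \<omega> + (\<tau> * S A \<omega>)\<^sup>2 / 2))"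
    using exp_integrable[OF A, of \<tau>] int1 int2 w_eq S_mean[OF A]
    by (simp add: y_def prob_space)
  also have "\<bar>\<dots>\<bar> \<le> expectation (\<lambda>\<omega>. \<bar>exp (\<tau> * S A \<omega>) - (1 + \<tau> * S A \<omega> + (\<tau> * S A \<omega>)\<^sup>2 / 2)\<bar>)"
    by (rule integral_abs_bound)
  also have "\<dots> \<le> expectation (\<lambda>\<omega>. b * (\<tau> * S A \<omega>)\<^sup>2)"
  proof (rule integral_mono)
    show "\<bar>exp (\<tau> * S A \<omega>) - (1 + \<tau> * S A \<omega> + (\<tau> * S A \<omega>)\<^sup>2 / 2)\<bar> \<le> b * (\<tau> * S A \<omega>)\<^sup>2"
      if "\<omega> \<in> space M" for \<omega>
    proof -
      have "\<bar>exp (\<tau> * S A \<omega>) - (1 + \<tau> * S A \<omega> + (\<tau> * S A \<omega>)\<^sup>2 / 2)\<bar> \<le> \<bar>\<tau> * S A \<omega>\<bar> ^ 3"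
        using x[OF that] b by (intro exp_taylor2_bound) auto
      also have "\<dots> = \<bar>\<tau> * S A \<omega>\<bar> * (\<tau> * S A \<omega>)\<^sup>2"
        by (simp add: power3_eq_cube power2_eq_square abs_mult_self_eq flip: mult.assoc abs_mult)
      also have "\<dots> \<le> b * (\<tau> * S A \<omega>)\<^sup>2"
        using x[OF that] by (intro mult_right_mono) auto
      finally show ?thesis .
    qed
  qed (use exp_integrable[OF A, of \<tau>] int1 int2 in auto)
  finally have yw: "\<bar>y - w\<bar> \<le> 2 * b * w" by (simp add: w_eq)
  have y0: "0 \<le> y" using mgf_ge_1[OF A, of \<tau>] by (simp add: y_def)
  have "2 * b * w \<le> w" using mult_right_mono[OF b(2) w0] by simp
  then have y2: "y \<le> 2 * w" using yw by linarith
  then have yb: "y \<le> b\<^sup>2" using w_le by linarith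
  have b1: "b\<^sup>2 \<le> b / 2" using mult_left_mono[OF b(2) b0] by (simp add: power2_eq_square)
  have "y\<^sup>2 \<le> b\<^sup>2 * (2 * w)"
    unfolding power2_eq_square[of y] using y2 yb y0 by (intro mult_mono) auto
  also have "\<dots> \<le> b * w" using mult_right_mono[OF b1 w0] by simp
  finally have ysq: "y\<^sup>2 \<le> b * w" .
  have cgf: "cgf \<tau> A = ln (1 + y)" by (simp add: cgf_def y_def)
  have "cgf \<tau> A \<le> y" using ln_add_one_self_le_self[OF y0] cgf by simp
  moreover have "y - y\<^sup>2 \<le> cgf \<tau> A"
    using ln_one_plus_pos_lower_bound[OF y0] yb b1 b cgf by simp
  ultimately have "\<bar>cgf \<tau> A - w\<bar> \<le> 3 * b * w" using yw ysq by linarith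
  then show ?thesis by (simp add: w_def E2_def)
qed

lemma cgf_small_le:
  assumes A: "time_set A" and "\<bar>\<tau>\<bar> * m * len A \<le> 1 / 2"
  shows "cgf \<tau> A \<le> 2 * \<tau>\<^sup>2 * V * len A"
proof -
  define E where "E = \<tau>\<^sup>2 * expectation (\<lambda>\<omega>. (S A \<omega>)\<^sup>2)"
  have "0 \<le> E" by (simp add: E_def)
  moreover have "\<bar>cgf \<tau> A - E / 2\<bar> \<le> 3 / 2 * (1 / 2) * E"
    using cgf_taylor[OF A assms(2)] by (simp add: E_def)
  ultimately have "cgf \<tau> A \<le> 2 * E" by linarith
  also have "\<dots> \<le> 2 * (\<tau>\<^sup>2 * (V * len A))"
    unfolding E_def using S_var[OF A] by (intro mult_left_mono) auto
  finally show ?thesis by (simp add: mult.assoc)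
qed

text \<open>Convexity of the exponential function replaces independence, so no gap between the sets
  is required. Only a pathwise identity links the three sums; hence a part can also be expressed
  through the whole and its complement, which gives lower bounds.\<close>

lemma cgf_convex:
  assumes A: "time_set A" and B: "time_set B" and D: "time_set D" and w: "0 \<le> w" "w \<le> 1"
    and eq: "\<And>\<omega>. \<omega> \<in> space M \<Longrightarrow> \<tau> * S D \<omega> = w * (\<sigma> * S A \<omega>) + (1 - w) * (\<kappa> * S B \<omega>)"
  shows "cgf \<tau> D \<le> max (cgf \<sigma> A) (cgf \<kappa> B)"
proof -
  have "expectation (\<lambda>\<omega>. exp (\<tau> * S D \<omega>))
     \<le> expectation (\<lambda>\<omega>. w * exp (\<sigma> * S A \<omega>) + (1 - w) * exp (\<kappa> * S B \<omega>))"
  proof (rule integral_mono)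
    fix \<omega> assume "\<omega> \<in> space M"
    then show "exp (\<tau> * S D \<omega>) \<le> w * exp (\<sigma> * S A \<omega>) + (1 - w) * exp (\<kappa> * S B \<omega>)"
      using convex_onD[OF exp_convex, of "1 - w" "\<sigma> * S A \<omega>" "\<kappa> * S B \<omega>"] w eq by simp
  qed (intro Bochner_Integration.integrable_add integrable_mult_right exp_integrable A B D)+
  also have "\<dots> = w * exp (cgf \<sigma> A) + (1 - w) * exp (cgf \<kappa> B)"
    using exp_integrable[OF A, of \<sigma>] exp_integrable[OF B, of \<kappa>] by (simp add: exp_cgf A B)
  also have "\<dots> \<le> w * exp (max (cgf \<sigma> A) (cgf \<kappa> B)) + (1 - w) * exp (max (cgf \<sigma> A) (cgf \<kappa> B))"
    using w by (intro add_mono mult_left_mono) auto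
  also have "\<dots> = exp (max (cgf \<sigma> A) (cgf \<kappa> B))" by (simp add: algebra_simps)
  finally show ?thesis unfolding exp_cgf[OF D, of \<tau>, symmetric] exp_le_cancel_iff .
qed

lemma cgf_Un_convex:
  assumes A: "time_set A" and B: "time_set B" and AB: "A \<inter> B = {}" and w: "0 < w" "w < 1"
  shows "cgf \<tau> (A \<union> B) \<le> max (cgf (\<tau> / w) A) (cgf (\<tau> / (1 - w)) B)"
  using w by (intro cgf_convex[where w = w] time_set_Un A B) (auto simp: S_Un[OF A B AB] distrib_left)

text \<open>As both transforms are at least 1, the absolute error of \<open>decouple\<close> is also
  a relative error, and the logarithm at most doubles it.\<close>

lemma cgf_decouple:
  assumes A: "time_set A" and B: "time_set B" and AB: "A \<subseteq> {..r}" "B \<subseteq> {r + q..}" "0 < q"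
    and e: "exp (- c * q) * exp (\<bar>\<tau>\<bar> * m * (len A + len B)) \<le> e" "e \<le> 1 / 2"
  shows "\<bar>cgf \<tau> (A \<union> B) - cgf \<tau> A - cgf \<tau> B\<bar> \<le> 2 * e"
proof -
  define E1 E2 E where "E1 = exp (cgf \<tau> A)" and "E2 = exp (cgf \<tau> B)" and "E = exp (cgf \<tau> (A \<union> B))"
  have disj: "A \<inter> B = {}" using AB by (fastforce simp: disjoint_iff subset_eq)
  have E: "E = expectation (\<lambda>\<omega>. exp (\<tau> * S A \<omega>) * exp (\<tau> * S B \<omega>))"
    unfolding E_def exp_cgf[OF time_set_Un[OF A B]]
    by (intro Bochner_Integration.integral_cong refl) (simp add: S_Un[OF A B disj] distrib_left exp_add)
  have 1: "1 \<le> E1" "1 \<le> E2" using cgf_nonneg[OF A] cgf_nonneg[OF B] by (auto simp: E1_def E2_def)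
  then have P1: "1 \<le> E1 * E2" by (metis mult_mono' mult_1 zero_le_one)
  have EE: "\<bar>E - E1 * E2\<bar> \<le> e"
    using order_trans[OF decouple[OF A B AB(1,2), of \<tau>] e(1)] AB(3)
    by (simp add: E E1_def E2_def exp_cgf A B)
  define z where "z = E / (E1 * E2) - 1"
  have "\<bar>z\<bar> = \<bar>E - E1 * E2\<bar> / (E1 * E2)"
  proof -
    have "z = (E - E1 * E2) / (E1 * E2)" using 1 by (simp add: z_def diff_divide_distrib)
    then show ?thesis using P1 by simp
  qed
  also have "\<dots> \<le> \<bar>E - E1 * E2\<bar> / 1" using P1 by (intro divide_left_mono) auto
  finally have z: "\<bar>z\<bar> \<le> e" using EE by simp
  have "ln (1 + z) = cgf \<tau> (A \<union> B) - cgf \<tau> A - cgf \<tau> B"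
    by (simp add: z_def E_def E1_def E2_def exp_add[symmetric] exp_diff[symmetric])
  moreover have "\<bar>ln (1 + z) - z\<bar> \<le> 2 * z\<^sup>2"
    using z e by (intro abs_ln_one_plus_x_minus_x_bound) auto
  moreover have "2 * z\<^sup>2 \<le> \<bar>z\<bar>"
  proof -
    have "\<bar>z\<bar> * \<bar>z\<bar> \<le> (1 / 2) * \<bar>z\<bar>" using z e by (intro mult_right_mono) auto
    then show ?thesis by (simp add: power2_eq_square abs_mult_self_eq flip: abs_mult)
  qed
  ultimately show ?thesis using z by linarith
qed


text \<open>Gaps of length \<open>\<rho> * len A + \<beta>\<close> are cut out recursively, as in a Cantor set: since
  the gap is proportional to the block that is split, the mixing rate beats the sup norm of the
  exponential moments at every scale, while only a fraction \<open>\<rho>\<close> is lost on each dyadic level.\<close>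

lemma cantor_kept_set:
  assumes closed: "\<And>A r. \<C> A \<Longrightarrow> \<C> (A \<inter> {..r})" "\<And>A r. \<C> A \<Longrightarrow> \<C> (A \<inter> {r<..})"
    and leaf: "\<And>A. \<C> A \<Longrightarrow> time_set A \<Longrightarrow> p / 4 \<le> len A \<Longrightarrow> len A \<le> p \<Longrightarrow>
                  \<bar>cgf \<tau> A - \<mu> * len A\<bar> \<le> \<epsilon> * len A"
    and p: "0 < p" and \<rho>: "0 \<le> \<rho>" "\<bar>\<tau>\<bar> * m \<le> c * \<rho>" and \<beta>: "0 < \<beta>" "exp (- c * \<beta>) \<le> 1 / 2"
    and small: "\<rho> + \<beta> / p \<le> 1 / 2"
    and A: "\<C> A" "time_set A" "p / 4 \<le> len A" "len A \<le> 2 ^ j * p"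
  shows "\<exists>B. time_set B \<and> B \<subseteq> A \<and> len (A - B) \<le> \<rho> * j * len A + \<beta> * (4 * len A / p - 1) \<and>
           \<bar>cgf \<tau> B - \<mu> * len B\<bar> \<le> \<epsilon> * len B + 2 * exp (- c * \<beta>) * (4 * len A / p - 1)"
  using A
\<comment> \<open>The factor \<open>4 * len A / p - 1\<close> bounds the number of gaps: leaves have
  length at least \<open>p / 4\<close>, and a binary tree has one inner node fewer than
  leaves.\<close>
proof (induction j arbitrary: A)
  case 0
  then have "4 * len A / p - 1 \<ge> 0" using p by (simp add: field_simps)
  then show ?case using 0 leaf[of A] \<beta> by (intro exI[of _ A]) (auto intro: add_increasing2)
next
  case (Suc j)
  show ?case
  proof (cases "len A \<le> 2 ^ j * p")
    case True
    have "\<rho> * j * len A \<le> \<rho> * Suc j * len A"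
      using \<rho> by (intro mult_right_mono mult_left_mono) auto
    then show ?thesis using Suc.IH[OF Suc.prems(1-3) True] by (meson add_right_mono order_trans)
  next
    case False
    define q where "q = \<rho> * len A + \<beta>"
    have "p \<le> 2 ^ j * p" using p by simp
    then have pA: "p < len A" using False by linarith
    have "\<beta> = \<beta> / p * p" using p by simp
    also have "\<dots> \<le> \<beta> / p * len A" using pA \<beta> p by (intro mult_left_mono) auto
    finally have "q \<le> (\<rho> + \<beta> / p) * len A" by (simp add: q_def algebra_simps)
    also have "\<dots> \<le> 1 / 2 * len A" using small pA p by (intro mult_right_mono) auto
    finally have q2: "q \<le> len A / 2" by simp
    have q0: "0 < q" using \<rho> \<beta> pA p by (simp add: q_def add_nonneg_pos)
    obtain r s where r: "len (A \<inter> {..r}) = (len A - q) / 2" "time_set (A \<inter> {..r})"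
      and s: "len (A \<inter> {s<..}) = (len A - q) / 2" "r + q \<le> s" "time_set (A \<inter> {s<..})"
      by (rule len_split[OF Suc.prems(2) q0]) (use q2 q0 in auto)
    define A1 A2 where "A1 = A \<inter> {..r}" and "A2 = A \<inter> {s<..}"
    \<comment> \<open>A block longer than \<open>p\<close> that loses at most half of its length
      leaves two halves of length at least \<open>p / 4\<close>, as the leaves require.\<close>
    have bounds: "p / 4 \<le> (len A - q) / 2" "(len A - q) / 2 \<le> 2 ^ j * p"
      using pA q2 q0 Suc.prems(4) by auto
    obtain B1 where B1: "time_set B1" "B1 \<subseteq> A1"
        "len (A1 - B1) \<le> \<rho> * j * len A1 + \<beta> * (4 * len A1 / p - 1)"
        "\<bar>cgf \<tau> B1 - \<mu> * len B1\<bar> \<le> \<epsilon> * len B1 + 2 * exp (- c * \<beta>) * (4 * len A1 / p - 1)"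
      using Suc.IH[of A1] closed(1)[OF Suc.prems(1)] r bounds by (auto simp: A1_def)
    obtain B2 where B2: "time_set B2" "B2 \<subseteq> A2"
        "len (A2 - B2) \<le> \<rho> * j * len A2 + \<beta> * (4 * len A2 / p - 1)"
        "\<bar>cgf \<tau> B2 - \<mu> * len B2\<bar> \<le> \<epsilon> * len B2 + 2 * exp (- c * \<beta>) * (4 * len A2 / p - 1)"
      using Suc.IH[of A2] closed(2)[OF Suc.prems(1)] s bounds by (auto simp: A2_def)
    have t12: "time_set A1" "time_set A2" using r s by (auto simp: A1_def A2_def)
    have disj: "A1 \<inter> A2 = {}" using s q0 by (auto simp: A1_def A2_def)
    have lenA: "len A1 + len A2 = len A - q" using r s by (simp add: A1_def A2_def)
    have lenB: "len (B1 \<union> B2) = len B1 + len B2" using B1 B2 disj by (intro len_Un) auto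
    have sub: "B1 \<union> B2 \<subseteq> A" using B1 B2 by (auto simp: A1_def A2_def)
    have tB: "time_set (B1 \<union> B2)" using B1 B2 by (intro time_set_Un)
    have "len (A - (B1 \<union> B2)) = len A - len B1 - len B2"
      using len_Diff[OF Suc.prems(2) tB sub] lenB by simp
    also have "\<dots> = q + len (A1 - B1) + len (A2 - B2)"
      using len_Diff[OF t12(1) B1(1,2)] len_Diff[OF t12(2) B2(1,2)] lenA by simp
    also have "\<dots> \<le> q + \<rho> * j * (len A1 + len A2) + \<beta> * (4 * (len A1 + len A2) / p - 2)"
      using B1(3) B2(3) by (simp add: algebra_simps add_divide_distrib)
    also have "\<dots> \<le> q + \<rho> * j * len A + \<beta> * (4 * len A / p - 2)"
      using lenA q0 \<rho> \<beta> p by (intro add_mono mult_left_mono diff_right_mono divide_right_mono) auto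
    \<comment> \<open>The new gap contributes \<open>\<rho> * len A\<close> for one more level and
      the single \<open>\<beta>\<close> that turns \<open>- 2\<close> into
      \<open>- 1\<close>.\<close>
    also have "\<dots> = \<rho> * Suc j * len A + \<beta> * (4 * len A / p - 1)"
      by (simp add: q_def algebra_simps)
    finally have removed: "len (A - (B1 \<union> B2)) \<le> \<rho> * Suc j * len A + \<beta> * (4 * len A / p - 1)" .
    \<comment> \<open>The two summands of the gap act separately: \<open>\<rho> * len A\<close>
      cancels the exponential moments, and \<open>\<beta>\<close> leaves the error
      \<open>exp (- c * \<beta>)\<close>.\<close>
    have "exp (- c * q) * exp (\<bar>\<tau>\<bar> * m * (len B1 + len B2)) \<le> exp (- c * \<beta>)"
    proof -
      have "\<bar>\<tau>\<bar> * m * (len B1 + len B2) \<le> c * \<rho> * len A"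
        using \<rho> m_nonneg len_mono[OF tB Suc.prems(2) sub] lenB c_pos by (intro mult_mono[OF \<rho>(2)]) auto
      then show ?thesis by (simp add: q_def algebra_simps flip: exp_add)
    qed
    then have "\<bar>cgf \<tau> (B1 \<union> B2) - cgf \<tau> B1 - cgf \<tau> B2\<bar> \<le> 2 * exp (- c * \<beta>)"
      using B1 B2 s q0 \<beta> by (intro cgf_decouple[where r = r and q = q]) (auto simp: A1_def A2_def)
    then have "\<bar>cgf \<tau> (B1 \<union> B2) - \<mu> * len (B1 \<union> B2)\<bar> \<le> 2 * exp (- c * \<beta>)
        + (\<epsilon> * len B1 + 2 * exp (- c * \<beta>) * (4 * len A1 / p - 1))
        + (\<epsilon> * len B2 + 2 * exp (- c * \<beta>) * (4 * len A2 / p - 1))"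
      using B1(4) B2(4) unfolding lenB distrib_left by linarith
    also have "\<dots> = \<epsilon> * len (B1 \<union> B2) + 2 * exp (- c * \<beta>) * (4 * (len A1 + len A2) / p - 1)"
      by (simp add: lenB algebra_simps add_divide_distrib)
    also have "\<dots> \<le> \<epsilon> * len (B1 \<union> B2) + 2 * exp (- c * \<beta>) * (4 * len A / p - 1)"
      using lenA q0 p by (intro add_left_mono mult_left_mono diff_right_mono divide_right_mono) auto
    finally show ?thesis using removed tB sub by blast
  qed
qed

text \<open>A bound for arbitrary sets, obtained by peeling off kept sets until nothing is left. The
  weights \<open>W i\<close> in the convexity argument decrease at most geometrically, so that they are
  absorbed by the fourfold decrease of the remaining length, but stay above \<open>1 / (2 * (J + 1))\<close>.\<close>

lemma cgf_crude_bound: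
  fixes J :: nat and t :: real
  defines "\<theta> \<equiv> 2 * (real J + 1) * \<bar>t\<bar> * m"
  assumes p: "0 < p" and \<rho>: "\<theta> \<le> c * \<rho>" "0 \<le> \<rho>" and \<beta>: "0 < \<beta>" "exp (- c * \<beta>) \<le> 1 / 2"
    and small: "\<rho> * J + 4 * \<beta> / p \<le> 1 / 4" "\<rho> \<le> 1 / 4" "\<theta> * p \<le> 1 / 2"
    and A: "time_set A" "len A \<le> 2 ^ J * p"
  shows "cgf t A \<le> 32 * t\<^sup>2 * V * len A + 8 * exp (- c * \<beta>) * len A / p"
proof -
  define l where "l = len A"
  have l0: "0 \<le> l" by (simp add: l_def)
  \<comment> \<open>Two demands on the increments \<open>W i - W (Suc i)\<close> are averaged. The
    linear half keeps them at least \<open>1 / (2 * (J + 1))\<close>, so the parameters stay below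
    \<open>\<theta>\<close>. The geometric half keeps them at least
    \<open>(1 / 2) ^ (i + 2)\<close>, whose square compensates for the length
    \<open>(1 / 4) ^ i * l\<close>. At the start \<open>W 0 = 1\<close>.\<close>
  define W where "W i = ((real J + 1 - real i) / (real J + 1) + (1 / 2) ^ i) / 2" for i :: nat
  define bd where "bd = 32 * t\<^sup>2 * V * l + 8 * exp (- c * \<beta>) * l / p"
  have scale: "\<bar>t / w\<bar> * m \<le> \<theta>" if "1 / (2 * (real J + 1)) \<le> w" for w
  proof -
    have w0: "0 < w" using that by (rule order.strict_trans2[rotated]) simp
    then have "\<bar>t / w\<bar> = \<bar>t\<bar> / w" by simp
    also have "\<dots> \<le> \<bar>t\<bar> / (1 / (2 * (real J + 1)))" using that w0
      by (intro divide_left_mono mult_pos_pos) auto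
    finally show ?thesis using m_nonneg mult_right_mono[of "\<bar>t / w\<bar>" "2 * (real J + 1) * \<bar>t\<bar>" m]
      by (simp add: \<theta>_def mult.commute mult.left_commute)
  qed
  have sq: "(t / w)\<^sup>2 * V * x \<le> 16 * t\<^sup>2 * V * l" if w: "(1 / 2) ^ (i + 2) \<le> w" and x: "0 \<le> x" "x \<le> (1 / 4) ^ i * l" for w x i
  proof -
    have "((1 / 2) ^ (i + 2))\<^sup>2 \<le> w\<^sup>2" using w by (intro power_mono) auto
    moreover have "((1 / 2 :: real) ^ (i + 2))\<^sup>2 = (1 / 4) ^ i / 16"
      by (simp add: power_add power_mult_distrib power2_eq_square flip: power_mult_distrib)
    ultimately have w2: "(1 / 4) ^ i / 16 \<le> w\<^sup>2" by simp
    have "(t / w)\<^sup>2 \<le> t\<^sup>2 / ((1 / 4) ^ i / 16)"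
      unfolding power_divide[of t] using order.strict_trans2[OF _ w2, of 0]
      by (intro divide_left_mono[OF w2] mult_pos_pos) auto
    then have "(t / w)\<^sup>2 * V * x \<le> t\<^sup>2 / ((1 / 4) ^ i / 16) * V * ((1 / 4) ^ i * l)"
      using x V_nonneg by (intro mult_mono) auto
    then show ?thesis by simp
  qed
  have leaf: "cgf \<tau> D \<le> 2 * \<tau>\<^sup>2 * V * len D" if "time_set D" "len D \<le> p" "\<bar>\<tau>\<bar> * m \<le> \<theta>" for \<tau> D
  proof (rule cgf_small_le[OF that(1)])
    have "0 \<le> \<theta>" using m_nonneg by (simp add: \<theta>_def)
    then have "\<bar>\<tau>\<bar> * m * len D \<le> \<theta> * p" using that p m_nonneg by (intro mult_mono) auto
    then show "\<bar>\<tau>\<bar> * m * len D \<le> 1 / 2" using small by linarith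
  qed
  have err0: "0 \<le> 8 * exp (- c * \<beta>) * l / p" using l0 p by simp
  have "cgf (t / W i) D \<le> bd"
    if "i \<le> J" "time_set D" "len D \<le> (1 / 4) ^ i * l" for i D
    using that
  proof (induction "J - i" arbitrary: i D)
    case 0
    then have i: "i = J" by simp
    \<comment> \<open>After \<open>J\<close> rounds the remainder is short enough to be a leaf
      itself.\<close>
    have "len D \<le> (1 / 4) ^ J * (2 ^ J * p)"
      using 0(4) A(2) unfolding i l_def by (elim order_trans) (intro mult_left_mono, auto)
    also have "\<dots> = (1 / 2) ^ J * p" by (simp add: power_divide power_mult_distrib[symmetric] field_simps)
    also have "\<dots> \<le> 1 * p" using p by (intro mult_right_mono power_le_one) auto
    finally have "len D \<le> p" by simp
    moreover have "\<bar>t / W J\<bar> * m \<le> \<theta>"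
    proof (rule scale)
      have "1 / (2 * (real J + 1)) = 1 / (real J + 1) / 2" by simp
      also have "\<dots> \<le> W J" unfolding W_def by (intro divide_right_mono) auto
      finally show "1 / (2 * (real J + 1)) \<le> W J" .
    qed
    ultimately have "cgf (t / W J) D \<le> 2 * ((t / W J)\<^sup>2 * V * len D)"
      using leaf[OF 0(3)] by (simp add: mult.assoc)
    also have "\<dots> \<le> 2 * (16 * t\<^sup>2 * V * l)"
      using 0(4) by (intro mult_left_mono sq[OF _ _ 0(4)]) (auto simp: i W_def)
    finally show ?case using err0 by (simp add: i bd_def)
  next
    case (Suc n)
    then have iJ: "i < J" by simp
    have W0: "0 < W (Suc i)" "0 < W i" using iJ by (auto simp: W_def intro!: add_nonneg_pos divide_nonneg_pos)
    define w where "w = W i - W (Suc i)"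
    have w: "w = (1 / (real J + 1) + (1 / 2) ^ (i + 1)) / 2"
    proof -
      have half: "(a + b) / 2 - (a' + b') / 2 = (y + b') / 2" if "a = a' + y" "b = 2 * b'"
        for a a' b b' y :: real using that by (simp add: field_simps)
      have "w = (1 / (real J + 1) + (1 / 2) ^ Suc i) / 2"
        unfolding w_def W_def by (rule half) (simp_all flip: add_divide_distrib)
      then show ?thesis by simp
    qed
    have w1: "1 / (2 * (real J + 1)) \<le> w" "(1 / 2) ^ (i + 2) \<le> w"
    proof -
      have "1 / (2 * (real J + 1)) = 1 / (real J + 1) / 2" by simp
      also have "\<dots> \<le> w" unfolding w by (intro divide_right_mono) auto
      finally show "1 / (2 * (real J + 1)) \<le> w" .
    qed (simp add: w)
    have w0: "0 < w" using w1(2) by (smt (verit) zero_less_power half_gt_zero)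
    have Wge: "w \<le> W i" using W0 by (simp add: w_def)
    show ?case
    \<comment> \<open>A remainder this short does not enter the recursion, but the leaf bound
      applies to it directly.\<close>
    proof (cases "len D < p / 4")
      case True
      then have "cgf (t / W i) D \<le> 2 * ((t / W i)\<^sup>2 * V * len D)"
        using leaf[OF Suc(4), of "t / W i"] scale[of "W i"] w1 Wge p by (simp add: mult.assoc)
      also have "\<dots> \<le> 2 * (16 * t\<^sup>2 * V * l)"
        using w1 Wge by (intro mult_left_mono sq[OF _ _ Suc.prems(3)]) auto
      finally show ?thesis using err0 by (simp add: bd_def)
    next
      case False
      then have D: "p / 4 \<le> len D" by simp
      have Dl: "len D \<le> l"
        using Suc.prems(3) mult_right_mono[of "(1/4)^i" 1 l] l0 by (simp add: power_le_one)
      then have DJ: "len D \<le> 2 ^ J * p" using A(2) by (simp add: l_def)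
      have tw: "\<bar>t / w\<bar> * m \<le> \<theta>" using scale[OF w1(1)] .
      \<comment> \<open>Only an order of magnitude is wanted here, so the recursion runs with
        \<open>\<mu> = 0\<close> and with no restriction on the class of sets.\<close>
      have "\<exists>B. time_set B \<and> B \<subseteq> D \<and> len (D - B) \<le> \<rho> * J * len D + \<beta> * (4 * len D / p - 1) \<and>
           \<bar>cgf (t / w) B - 0 * len B\<bar>
             \<le> (2 * (t / w)\<^sup>2 * V) * len B + 2 * exp (- c * \<beta>) * (4 * len D / p - 1)"
      proof (rule cantor_kept_set[where \<C> = "\<lambda>_. True"])
        show "\<bar>cgf (t / w) A - 0 * len A\<bar> \<le> 2 * (t / w)\<^sup>2 * V * len A"
          if "time_set A" "len A \<le> p" for A
          using leaf[OF that tw] cgf_nonneg[OF that(1), of "t / w"] by simp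
        show "\<rho> + \<beta> / p \<le> 1 / 2"
        proof -
          have "\<beta> / p \<le> 4 * \<beta> / p" using \<beta> p by (simp add: divide_right_mono)
          also have "\<dots> \<le> 1 / 4" using small(1) \<rho>(2) by (smt (verit) mult_nonneg_nonneg of_nat_0_le_iff)
          finally show ?thesis using small(2) by linarith
        qed
      qed (use p \<rho> \<beta> tw D DJ Suc.prems in auto)
      then obtain B where B: "time_set B" "B \<subseteq> D" "len (D - B) \<le> \<rho> * J * len D + \<beta> * (4 * len D / p - 1)"
        "cgf (t / w) B \<le> (2 * (t / w)\<^sup>2 * V) * len B + 2 * exp (- c * \<beta>) * (4 * len D / p - 1)"
        by auto
      have "len (D - B) \<le> (\<rho> * J + 4 * \<beta> / p) * len D"
        using B(3) \<beta> by (simp add: algebra_simps)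
      also have "\<dots> \<le> 1 / 4 * len D" using small by (intro mult_right_mono) auto
      also have "\<dots> \<le> (1 / 4) ^ Suc i * l" using Suc.prems by simp
      finally have rest: "cgf (t / W (Suc i)) (D - B) \<le> bd"
        using Suc iJ time_set_Diff[OF Suc.prems(2) B(1)] by (intro Suc(1)) auto
      have "len B \<le> (1 / 4) ^ i * l" using len_mono[OF B(1) Suc.prems(2) B(2)] Suc.prems(3) by simp
      from sq[OF w1(2) _ this] have "(t / w)\<^sup>2 * V * len B \<le> 16 * t\<^sup>2 * V * l" by simp
      moreover have "2 * exp (- c * \<beta>) * (4 * len D / p - 1) \<le> 8 * exp (- c * \<beta>) * l / p"
      proof -
        have "4 * len D / p - 1 \<le> 4 * l / p" using Dl p by (smt (verit) divide_right_mono)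
        then have "2 * exp (- c * \<beta>) * (4 * len D / p - 1) \<le> 2 * exp (- c * \<beta>) * (4 * l / p)"
          by (intro mult_left_mono) auto
        then show ?thesis by simp
      qed
      ultimately have kept: "cgf (t / w) B \<le> bd" using B(4) by (simp add: bd_def)
      \<comment> \<open>The relative weights \<open>w / W i\<close> and
        \<open>W (Suc i) / W i\<close> telescope: the kept part gets the parameter
        \<open>t / w\<close>, and the rest gets \<open>t / W (Suc i)\<close>, ready for the next
        round.\<close>
      have "cgf (t / W i) (B \<union> (D - B)) \<le> max (cgf (t / W i / (w / W i)) B) (cgf (t / W i / (1 - w / W i)) (D - B))"
        using B Suc.prems time_set_Diff w0 W0
        by (intro cgf_Un_convex) (auto simp: w_def field_simps)
      moreover have "t / W i / (w / W i) = t / w" using W0 by simp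
      moreover have "t / W i / (1 - w / W i) = t / W (Suc i)"
      proof -
        have "1 - w / W i = W (Suc i) / W i" using W0 by (simp add: w_def field_simps)
        then show ?thesis using W0 by simp
      qed
      moreover have "B \<union> (D - B) = D" using B by auto
      ultimately show ?thesis using kept rest by auto
    qed
  qed
  from this[of 0 A] A(1) show ?thesis by (simp add: W_def bd_def l_def)
qed

end

section \<open>The scales of the construction as functions of \<open>T\<close>\<close>

lemma dyadic_exponent_exists:
  fixes T :: real
  assumes "1 \<le> ln T" "0 < T"
  shows "\<exists>J::nat. T \<le> 2 ^ J \<and> real J \<le> 3 * ln T"
proof -
  define J where "J = nat \<lceil>ln T / ln 2\<rceil>"
  have ln2: "1 / 2 \<le> ln (2 :: real)"
    using ln_le_minus_one[of "1 / 2 :: real"] by (simp add: ln_div)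
  have "0 \<le> ln T / ln 2" using assms ln2 by (intro divide_nonneg_pos) linarith+
  then have J: "ln T / ln 2 \<le> real J" "real J \<le> ln T / ln 2 + 1"
    using ceiling_correct[of "ln T / ln 2"] by (simp_all add: J_def of_nat_nat zero_le_ceiling)
  have "ln T \<le> real J * ln 2" using J(1) by (simp add: field_simps)
  then have "ln T \<le> ln (2 ^ J)" by (simp add: ln_realpow)
  then have "T \<le> 2 ^ J" by (metis assms(2) ln_le_cancel_iff zero_less_numeral zero_less_power)
  moreover have "ln T / ln 2 \<le> ln T / (1 / 2)"
    by (intro divide_left_mono mult_pos_pos) (use ln2 assms in linarith)+
  ultimately show ?thesis using J assms by (intro exI[of _ J]) auto
qed

lemma exp_neg_2_ln:
  fixes T :: real
  assumes "0 < T"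
  shows "exp (- (2 * ln T)) = 1 / T\<^sup>2"
proof -
  have "exp (2 * ln T) = T\<^sup>2" using assms by (simp only: mult_2 exp_add exp_ln power2_eq_square)
  then show ?thesis by (simp only: exp_minus inverse_eq_divide)
qed

lemma two_le_if_one_le_ln:
  fixes T :: real
  assumes "0 < T" "1 \<le> ln T"
  shows "2 \<le> T"
proof -
  have "ln (exp 1) \<le> ln T" using assms by simp
  then have "exp 1 \<le> T" using assms by (subst (asm) ln_le_cancel_iff) auto
  then show ?thesis using exp_ge_add_one_self[of 1] by linarith
qed

context block_process
begin

text \<open>The two logarithms in the smallness condition have separate sources: peeling through
  \<open>J\<close> rounds enlarges the parameter by a factor of order \<open>ln T\<close>, and the
  leaves must exceed the additive gap \<open>\<beta>\<close>, again of order
  \<open>ln T\<close>.\<close>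

lemma cgf_crude_at:
  assumes T: "0 < T" "1 \<le> ln T" "c \<le> 64 * ln T" and s: "\<bar>t\<bar> * m * (ln T)\<^sup>2 \<le> c / 1024"
    and A: "time_set A" "len A \<le> T"
  shows "cgf t A \<le> 32 * t\<^sup>2 * V * len A + 8 / T"
proof -
  define l where "l = ln T"
  have l1: "1 \<le> l" using T by (simp add: l_def)
  obtain J :: nat where J: "T \<le> 2 ^ J" "real J \<le> 3 * l"
    using dyadic_exponent_exists[OF T(2,1)] by (auto simp: l_def)
  define u where "u = \<bar>t\<bar> * m"
  have u0: "0 \<le> u" using m_nonneg by (simp add: u_def)
  have ul: "u * l\<^sup>2 \<le> c / 1024" using s by (simp add: u_def l_def)
  have "u * l \<le> u * l\<^sup>2" using u0 l1 by (intro mult_left_mono) (auto simp: power2_eq_square)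
  then have ul1: "u * l \<le> c / 1024" using ul by simp
  have J1: "real J + 1 \<le> 4 * l" using J l1 by simp
  \<comment> \<open>The choice of \<open>\<beta>\<close> makes the mixing error
    \<open>1 / T\<^sup>2\<close>, small enough to be summed over all gaps. The ratio 32 of
    \<open>p\<close> to \<open>\<beta>\<close> limits the loss by additive gaps to
    \<open>4 * \<beta> / p = 1 / 8\<close>. \<open>\<rho>\<close> is the least value allowed by the
    sup norm.\<close>
  define p \<beta> \<rho> where "p = 64 * l / c" and "\<beta> = 2 * l / c" and "\<rho> = 2 * (real J + 1) * u / c"
  have p1: "1 \<le> p" using T c_pos by (simp add: p_def l_def)
  have e: "exp (- c * \<beta>) = 1 / T\<^sup>2"
    using exp_neg_2_ln[OF T(1)] c_pos by (simp add: \<beta>_def l_def)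
  note T2 = two_le_if_one_le_ln[OF T(1,2)]
  have \<rho>4: "\<rho> * c \<le> 8 * (u * l)"
    using mult_left_mono[OF J1, of "2 * u"] u0 c_pos by (simp add: \<rho>_def mult_ac)
  have "cgf t A \<le> 32 * t\<^sup>2 * V * len A + 8 * exp (- c * \<beta>) * len A / p"
  proof (rule cgf_crude_bound[where J = J and \<rho> = \<rho>])
    show "0 < p" using p1 by simp
    show "2 * (real J + 1) * \<bar>t\<bar> * m \<le> c * \<rho>" using c_pos by (simp add: \<rho>_def u_def)
    show "0 \<le> \<rho>" using u0 c_pos by (simp add: \<rho>_def)
    show "0 < \<beta>" using l1 c_pos by (simp add: \<beta>_def)
    have "1 / T\<^sup>2 \<le> 1 / 2" using T2 power_mono[of 2 T 2] by (intro divide_left_mono) auto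
    then show "exp (- c * \<beta>) \<le> 1 / 2" unfolding e .
    have "\<rho> * c \<le> 1 / 4 * c" using \<rho>4 ul1 c_pos by linarith
    then show "\<rho> \<le> 1 / 4" using c_pos by (rule mult_right_le_imp_le)
    have "\<rho> * J * c = (\<rho> * c) * J" by simp
    also have "\<dots> \<le> (8 * (u * l)) * (3 * l)" using J u0 l1 by (intro mult_mono[OF \<rho>4]) auto
    also have "\<dots> = 24 * (u * l\<^sup>2)" by (simp add: power2_eq_square)
    also have "\<dots> \<le> 1 / 8 * c" using ul c_pos by linarith
    finally have "\<rho> * J \<le> 1 / 8" using c_pos by (rule mult_right_le_imp_le)
    moreover have "4 * \<beta> / p = 1 / 8" using c_pos l1 by (simp add: \<beta>_def p_def)
    ultimately show "\<rho> * J + 4 * \<beta> / p \<le> 1 / 4" by simp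
    have "2 * (real J + 1) * \<bar>t\<bar> * m * p = (\<rho> * c) * (64 * l / c)" using c_pos by (simp add: \<rho>_def u_def p_def)
    also have "\<dots> \<le> (8 * (u * l)) * (64 * l / c)" using \<rho>4 c_pos l1 by (intro mult_right_mono) auto
    also have "\<dots> = 512 * (u * l\<^sup>2) / c" by (simp add: power2_eq_square)
    also have "\<dots> \<le> 512 * (c / 1024) / c" using ul c_pos by (intro divide_right_mono mult_left_mono) auto
    also have "\<dots> = 1 / 2" using c_pos by simp
    finally show "2 * (real J + 1) * \<bar>t\<bar> * m * p \<le> 1 / 2" .
    have "len A \<le> 2 ^ J * 1" using A J by simp
    also have "\<dots> \<le> 2 ^ J * p" using p1 by (intro mult_left_mono) auto
    finally show "len A \<le> 2 ^ J * p" .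
  qed (fact A)
  also have "8 * exp (- c * \<beta>) * len A / p \<le> 8 / T"
  proof -
    have "8 * exp (- c * \<beta>) * len A / p \<le> 8 * exp (- c * \<beta>) * T / 1"
      using A p1 T by (intro frac_le mult_left_mono) auto
    also have "\<dots> = 8 / T" unfolding e using T by (simp add: power2_eq_square)
    finally show ?thesis .
  qed
  finally show ?thesis by simp
qed

text \<open>In contrast to the crude bound, the removed fraction has to vanish. The leaves are
  therefore longer than \<open>\<beta>\<close> by a factor of order \<open>ln T\<close>, which gives
  \<open>\<beta> / p = 2 / (c * ln T)\<close>, while \<open>s\<close> still bounds the exponent on
  each leaf.\<close>

lemma kept_set_at:
  assumes T: "0 < T" "1 \<le> ln T" "8 / c \<le> ln T"
    and s: "\<bar>t\<bar> * m * (ln T)\<^sup>2 \<le> s" "s \<le> 1 / 2" "s \<le> c / 4"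
    and var: "\<And>A. is_interval A \<Longrightarrow> time_set A \<Longrightarrow> (ln T)\<^sup>2 / 4 \<le> len A \<Longrightarrow>
         \<bar>expectation (\<lambda>\<omega>. (S A \<omega>)\<^sup>2) - 2 * v * len A\<bar> \<le> \<epsilon> * len A"
  shows "\<exists>B. time_set B \<and> B \<subseteq> {0..T} \<and> len ({0..T} - B) \<le> (3 * s / c + 8 / (c * ln T)) * T \<and>
     \<bar>cgf t B - t\<^sup>2 * v * len B\<bar> \<le> t\<^sup>2 * (\<epsilon> / 2 + 3 / 2 * s * V) * len B + 8 / T"
proof -
  define l where "l = ln T"
  have l1: "1 \<le> l" using T by (simp add: l_def)
  obtain J :: nat where J: "T \<le> 2 ^ J" "real J \<le> 3 * l"
    using dyadic_exponent_exists[OF T(2,1)] by (auto simp: l_def)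
  define u where "u = \<bar>t\<bar> * m"
  have u0: "0 \<le> u" using m_nonneg by (simp add: u_def)
  have ul: "u * l\<^sup>2 \<le> s" using s by (simp add: u_def l_def)
  have "u * l \<le> u * l\<^sup>2" "u \<le> u * l" using u0 l1 mult_left_mono[of 1 l u]
    by (auto simp: power2_eq_square mult_left_mono)
  then have ul1: "u * l \<le> s" "u \<le> s" using ul by linarith+
  define p \<beta> \<rho> where "p = l\<^sup>2" and "\<beta> = 2 * l / c" and "\<rho> = u / c"
  have p1: "1 \<le> p" using l1 by (simp add: p_def)
  have e: "exp (- c * \<beta>) = 1 / T\<^sup>2"
    using exp_neg_2_ln[OF T(1)] c_pos by (simp add: \<beta>_def l_def)
  note T2 = two_le_if_one_le_ln[OF T(1,2)]
  have lenT: "len {0..T} = T" "time_set {0..T}" using T by (auto simp: time_set_def)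
  have s0: "0 \<le> s" using ul1 u0 by linarith
  have \<beta>p: "\<beta> / p = 2 / (c * l)" using l1 c_pos by (simp add: \<beta>_def p_def power2_eq_square)
  have "\<exists>B. time_set B \<and> B \<subseteq> {0..T} \<and> len ({0..T} - B) \<le> \<rho> * J * len {0..T} + \<beta> * (4 * len {0..T} / p - 1) \<and>
     \<bar>cgf t B - t\<^sup>2 * v * len B\<bar> \<le> t\<^sup>2 * (\<epsilon> / 2 + 3 / 2 * s * V) * len B
       + 2 * exp (- c * \<beta>) * (4 * len {0..T} / p - 1)"
  \<comment> \<open>Cutting an interval by half-lines gives intervals again, so every leaf is an
    interval and the variance asymptotics apply to it.\<close>
  proof (rule cantor_kept_set[where \<C> = is_interval])
    show "0 < p" using p1 by simp
    show "0 \<le> \<rho>" using u0 c_pos by (simp add: \<rho>_def)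
    show "\<bar>t\<bar> * m \<le> c * \<rho>" using c_pos by (simp add: \<rho>_def u_def)
    show "0 < \<beta>" using l1 c_pos by (simp add: \<beta>_def)
    have "1 / T\<^sup>2 \<le> 1 / 2" using T2 power_mono[of 2 T 2] by (intro divide_left_mono) auto
    then show "exp (- c * \<beta>) \<le> 1 / 2" unfolding e .
    have "\<rho> \<le> (c / 4) / c" using ul1 s c_pos unfolding \<rho>_def by (intro divide_right_mono) auto
    then have "\<rho> \<le> 1 / 4" using c_pos by simp
    moreover have "\<beta> / p \<le> 1 / 4"
      using T(3) c_pos l1 unfolding \<beta>p l_def[symmetric] by (simp add: field_simps)
    ultimately show "\<rho> + \<beta> / p \<le> 1 / 2" by linarith
    \<comment> \<open>The logarithm is estimated at \<open>sqrt T\<close> to get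
      \<open>(ln T)\<^sup>2 \<le> 4 * T\<close>, so that the whole interval is an admissible
      block.\<close>
    have "l = 2 * ln (sqrt T)" using T by (simp add: l_def ln_sqrt)
    also have "\<dots> \<le> 2 * sqrt T" using T ln_le_minus_one[of "sqrt T"] by simp
    finally have "l\<^sup>2 \<le> (2 * sqrt T)\<^sup>2" using l1 by (intro power_mono) auto
    then show "p / 4 \<le> len {0..T}" using T lenT by (simp add: p_def power_mult_distrib)
    have "len {0..T} \<le> 2 ^ J * 1" using J lenT by simp
    also have "\<dots> \<le> 2 ^ J * p" using p1 by (intro mult_left_mono) auto
    finally show "len {0..T} \<le> 2 ^ J * p" .
    show "\<bar>cgf t A - t\<^sup>2 * v * len A\<bar> \<le> t\<^sup>2 * (\<epsilon> / 2 + 3 / 2 * s * V) * len A"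
      if A: "is_interval A" "time_set A" "p / 4 \<le> len A" "len A \<le> p" for A
    proof -
      define E where "E = expectation (\<lambda>\<omega>. (S A \<omega>)\<^sup>2)"
      have "\<bar>t\<bar> * m * len A \<le> s"
        using mult_left_mono[OF A(4) u0] ul by (simp add: u_def p_def)
      from cgf_taylor[OF A(2) this s(2)]
      have 1: "\<bar>cgf t A - t\<^sup>2 * E / 2\<bar> \<le> 3 / 2 * s * (t\<^sup>2 * E)" by (simp add: E_def)
      also have "\<dots> \<le> 3 / 2 * s * (t\<^sup>2 * (V * len A))"
        using S_var[OF A(2)] s0 unfolding E_def by (intro mult_left_mono) auto
      finally have 2: "\<bar>cgf t A - t\<^sup>2 * E / 2\<bar> \<le> t\<^sup>2 * (3 / 2 * s * V) * len A" by (simp add: mult_ac)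
      have "t\<^sup>2 * \<bar>E - 2 * v * len A\<bar> \<le> t\<^sup>2 * (\<epsilon> * len A)"
        using var[OF A(1,2)] A(3) by (intro mult_left_mono) (auto simp: E_def p_def l_def)
      then have "\<bar>t\<^sup>2 * E - t\<^sup>2 * (2 * v * len A)\<bar> \<le> t\<^sup>2 * (\<epsilon> * len A)"
        by (simp add: abs_mult flip: right_diff_distrib)
      moreover have "t\<^sup>2 * (2 * v * len A) = 2 * (t\<^sup>2 * v * len A)" by simp
      moreover have "t\<^sup>2 * (\<epsilon> / 2 + 3 / 2 * s * V) * len A
          = t\<^sup>2 * (\<epsilon> * len A) / 2 + t\<^sup>2 * (3 / 2 * s * V) * len A"
        by (simp add: distrib_left distrib_right)
      ultimately show ?thesis using 2 by linarith
    qed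
    show "is_interval (A \<inter> {..r})" if "is_interval A" for A and r :: real
      by (rule is_interval_Int[OF that is_interval_ic])
    show "is_interval (A \<inter> {r<..})" if "is_interval A" for A and r :: real
      by (rule is_interval_Int[OF that is_interval_oi])
  qed (rule is_interval_cc lenT)+
  then obtain B where B: "time_set B" "B \<subseteq> {0..T}"
    "len ({0..T} - B) \<le> \<rho> * J * T + \<beta> * (4 * T / p - 1)"
    "\<bar>cgf t B - t\<^sup>2 * v * len B\<bar> \<le> t\<^sup>2 * (\<epsilon> / 2 + 3 / 2 * s * V) * len B
       + 2 * exp (- c * \<beta>) * (4 * T / p - 1)"
    unfolding lenT(1) by (elim exE conjE) (rule that; assumption)
  have "\<rho> * J \<le> 3 * s / c"
  proof -
    have "\<rho> * J \<le> \<rho> * (3 * l)" using J u0 c_pos by (intro mult_left_mono) (auto simp: \<rho>_def)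
    also have "\<dots> = 3 * (u * l) / c" by (simp add: \<rho>_def)
    also have "\<dots> \<le> 3 * s / c" using ul1 c_pos by (intro divide_right_mono) auto
    finally show ?thesis .
  qed
  then have "\<rho> * J * T \<le> 3 * s / c * T" using T by (intro mult_right_mono) auto
  moreover have "\<beta> * (4 * T / p - 1) \<le> 4 * (\<beta> / p) * T" using l1 c_pos by (simp add: \<beta>_def algebra_simps)
  ultimately have "len ({0..T} - B) \<le> (3 * s / c + 8 / (c * l)) * T"
    using B(3) unfolding \<beta>p by (simp add: algebra_simps)
  moreover have "2 * exp (- c * \<beta>) * (4 * T / p - 1) \<le> 8 / T"
  proof -
    have "4 * T / p \<le> 4 * T / 1" using p1 T by (intro divide_left_mono) auto
    then have "2 * exp (- c * \<beta>) * (4 * T / p - 1) \<le> 2 * (1 / T\<^sup>2) * (4 * T)"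
      unfolding e by (intro mult_left_mono) auto
    also have "\<dots> = 8 / T" using T by (simp add: power2_eq_square)
    finally show ?thesis .
  qed
  ultimately show ?thesis using B(1,2,4) unfolding l_def by (intro exI[of _ B]) auto
qed

end

text \<open>The interval \<open>{0..T}\<close> and its kept part control each other through
  \<open>cgf_convex\<close> with weights \<open>1 - \<delta>\<close> and \<open>\<delta>\<close>.
  For the upper bound the interval is the sum of kept and removed part; for the lower bound the kept
  part is the interval minus the removed part. The removed part is paid for by the crude
  bound.\<close>

theorem block_process_cgf_limit:
  fixes S :: "real \<Rightarrow> real set \<Rightarrow> 'a \<Rightarrow> real" and a m :: "real \<Rightarrow> real"
  assumes blocks: "\<And>T. T > 0 \<Longrightarrow> block_process M (S T) (m T) c V"
    and a_pos: "\<And>T. T > 0 \<Longrightarrow> 0 < a T" and a_lim: "(a \<longlongrightarrow> 0) at_top" and v: "0 \<le> v"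
    and scale: "((\<lambda>T. m T * (ln T)\<^sup>2 / sqrt (a T * T)) \<longlongrightarrow> 0) at_top"
    and var: "\<And>\<epsilon>. \<epsilon> > 0 \<Longrightarrow> \<forall>\<^sub>F T in at_top. \<forall>A. is_interval A \<longrightarrow> time_set A \<longrightarrow> (ln T)\<^sup>2 / 4 \<le> len A \<longrightarrow>
         \<bar>(LINT \<omega>|M. (S T A \<omega>)\<^sup>2) - 2 * v * len A\<bar> \<le> \<epsilon> * len A"
  shows "((\<lambda>T. a T * ln (LINT \<omega>|M. exp (l * S T {0..T} \<omega> / sqrt (a T * T)))) \<longlongrightarrow> l\<^sup>2 * v) at_top"
proof -
  define t where "t T = l / sqrt (a T * T)" for T
  define L where "L T \<tau> A = ln (LINT \<omega>|M. exp (\<tau> * S T A \<omega>))" for T \<tau> A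
  interpret B1: block_process M "S 1" "m 1" c V using blocks by simp
  have c: "0 < c" and V: "0 \<le> V" using B1.c_pos B1.V_nonneg by auto
  have t2: "a T * ((t T)\<^sup>2 * T) = l\<^sup>2" if "T > 0" for T
    using a_pos[OF that] that by (simp add: t_def power_divide)
  have s_lim: "((\<lambda>T. \<bar>r * t T\<bar> * m T * (ln T)\<^sup>2) \<longlongrightarrow> 0) at_top" for r
  proof -
    have "((\<lambda>T. \<bar>r * l\<bar> * \<bar>m T * (ln T)\<^sup>2 / sqrt (a T * T)\<bar>) \<longlongrightarrow> 0) at_top"
      using tendsto_mult_right_zero[OF tendsto_rabs_zero[OF scale]] .
    then show ?thesis
    proof (rule Lim_transform_eventually)
      show "\<forall>\<^sub>F T in at_top. \<bar>r * l\<bar> * \<bar>m T * (ln T)\<^sup>2 / sqrt (a T * T)\<bar> = \<bar>r * t T\<bar> * m T * (ln T)\<^sup>2"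
        using eventually_gt_at_top[of 0]
      proof eventually_elim
        case (elim T)
        interpret B: block_process M "S T" "m T" c V using blocks elim .
        show ?case using B.m_nonneg a_pos[OF elim] elim by (simp add: t_def abs_mult abs_divide)
      qed
    qed
  qed
  have kept: "\<forall>\<^sub>F T in at_top. \<exists>B. time_set B \<and> B \<subseteq> {0..T} \<and> len ({0..T} - B) \<le> \<eta> * T \<and>
      \<bar>L T (r * t T) B - (r * t T)\<^sup>2 * v * len B\<bar> \<le> \<eta> * ((t T)\<^sup>2 * T) + \<eta>" if \<eta>: "\<eta> > 0" for r \<eta> :: real
  proof -
    define \<epsilon> where "\<epsilon> = \<eta> / (r\<^sup>2 + 1)"
    define s where "s T = \<bar>r * t T\<bar> * m T * (ln T)\<^sup>2" for T
    have s: "(s \<longlongrightarrow> 0) at_top" unfolding s_def by (rule s_lim)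
    have "r\<^sup>2 + 1 > 0" by (simp add: add_nonneg_pos)
    then have \<epsilon>: "\<epsilon> > 0" "r\<^sup>2 * \<epsilon> \<le> \<eta>" using \<eta> by (auto simp: \<epsilon>_def field_simps)
    have ln: "filterlim (ln :: real \<Rightarrow> real) at_top at_top" by (rule ln_at_top)
    have e1: "\<forall>\<^sub>F T in at_top. max 1 (8 / c) \<le> ln T"
      using ln unfolding filterlim_at_top by blast
    have "((\<lambda>T. 3 * s T / c + 8 / (c * ln T)) \<longlongrightarrow> 3 * 0 / c + 0) at_top"
      using c by (intro tendsto_intros s tendsto_divide_0[OF tendsto_const]
          filterlim_at_top_imp_at_infinity filterlim_tendsto_pos_mult_at_top[OF tendsto_const _ ln]) auto
    then have e2: "\<forall>\<^sub>F T in at_top. 3 * s T / c + 8 / (c * ln T) < \<eta>"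
      by (rule order_tendstoD) (use \<eta> in auto)
    have e3: "\<forall>\<^sub>F T in at_top. s T < min (1 / 2) (c / 4)"
      by (rule order_tendstoD[OF s]) (use c in auto)
    have "((\<lambda>T. r\<^sup>2 * (3 / 2 * s T * V)) \<longlongrightarrow> r\<^sup>2 * (3 / 2 * 0 * V)) at_top"
      by (intro tendsto_intros s)
    then have e4: "\<forall>\<^sub>F T in at_top. r\<^sup>2 * (3 / 2 * s T * V) < \<eta> / 2"
      by (rule order_tendstoD) (use \<eta> in auto)
    have "((\<lambda>T. 8 / T) \<longlongrightarrow> 0) (at_top :: real filter)"
      by (intro tendsto_divide_0[OF tendsto_const] filterlim_at_top_imp_at_infinity filterlim_ident)
    then have e5: "\<forall>\<^sub>F T in at_top. 8 / T < \<eta>"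
      by (rule order_tendstoD) (use \<eta> in auto)
    show ?thesis using e1 e2 e3 e4 e5 var[OF \<epsilon>(1)] eventually_gt_at_top[of 0]
    proof eventually_elim
      case (elim T)
      interpret B: block_process M "S T" "m T" c V using blocks elim(7) .
      obtain B where B: "time_set B" "B \<subseteq> {0..T}"
          "len ({0..T} - B) \<le> (3 * s T / c + 8 / (c * ln T)) * T"
          "\<bar>B.cgf (r * t T) B - (r * t T)\<^sup>2 * v * len B\<bar>
             \<le> (r * t T)\<^sup>2 * (\<epsilon> / 2 + 3 / 2 * s T * V) * len B + 8 / T"
        using B.kept_set_at[of T "r * t T" "s T" v \<epsilon>] elim by (auto simp: s_def)
      have lenB: "len B \<le> T" using len_mono[OF B(1) _ B(2)] elim(7) by (auto simp: time_set_def)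
      have "(r * t T)\<^sup>2 * (\<epsilon> / 2 + 3 / 2 * s T * V) * len B
          = (t T)\<^sup>2 * (r\<^sup>2 * \<epsilon> / 2 + r\<^sup>2 * (3 / 2 * s T * V)) * len B"
        by (simp add: power_mult_distrib algebra_simps)
      also have "\<dots> \<le> (t T)\<^sup>2 * \<eta> * len B"
      proof -
        have "r\<^sup>2 * \<epsilon> / 2 + r\<^sup>2 * (3 / 2 * s T * V) \<le> \<eta>" using \<epsilon>(2) elim(4) by linarith
        then show ?thesis by (intro mult_right_mono mult_left_mono) auto
      qed
      also have "\<dots> \<le> (t T)\<^sup>2 * \<eta> * T" using \<eta> lenB by (intro mult_left_mono) auto
      finally have "\<bar>B.cgf (r * t T) B - (r * t T)\<^sup>2 * v * len B\<bar> \<le> \<eta> * ((t T)\<^sup>2 * T) + \<eta>"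
        using B(4) elim(5) by (simp add: mult_ac)
      moreover have "len ({0..T} - B) \<le> \<eta> * T"
        using B(3) elim(2,7) by (elim order_trans) (intro mult_right_mono, auto)
      ultimately show ?case using B(1,2) by (auto simp: L_def B.cgf_def)
    qed
  qed
  have crude: "\<forall>\<^sub>F T in at_top. \<forall>A. time_set A \<longrightarrow> len A \<le> T \<longrightarrow>
      L T (r * t T) A \<le> 32 * (r * t T)\<^sup>2 * V * len A + \<eta>" if \<eta>: "\<eta> > 0" for r \<eta> :: real
  proof -
    have e1: "\<forall>\<^sub>F T in at_top. max 1 (c / 64) \<le> ln (T::real)"
      using ln_at_top unfolding filterlim_at_top by blast
    have e2: "\<forall>\<^sub>F T in at_top. \<bar>r * t T\<bar> * m T * (ln T)\<^sup>2 < c / 1024"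
      by (rule order_tendstoD[OF s_lim]) (use c in auto)
    have "((\<lambda>T. 8 / T) \<longlongrightarrow> 0) (at_top :: real filter)"
      by (intro tendsto_divide_0[OF tendsto_const] filterlim_at_top_imp_at_infinity filterlim_ident)
    then have e3: "\<forall>\<^sub>F T in at_top. 8 / T < \<eta>"
      by (rule order_tendstoD) (use \<eta> in auto)
    show ?thesis using e1 e2 e3 eventually_gt_at_top[of 0]
    proof eventually_elim
      case (elim T)
      interpret B: block_process M "S T" "m T" c V using blocks elim(4) .
      have "B.cgf (r * t T) A \<le> 32 * (r * t T)\<^sup>2 * V * len A + 8 / T" if "time_set A" "len A \<le> T" for A
        using elim that by (intro B.cgf_crude_at) auto
      then show ?case using elim(3) unfolding B.cgf_def L_def by (meson add_left_mono less_imp_le order_trans)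
    qed
  qed
  have a1: "\<forall>\<^sub>F T in at_top. a T < 1" by (rule order_tendstoD[OF a_lim]) auto
  \<comment> \<open>\<open>C \<delta>\<close> collects all errors of order \<open>\<eta>\<close>;
    its term with \<open>1 / \<delta>\<^sup>2\<close> stems from the parameter on the removed part,
    which is of order \<open>t T / \<delta>\<close>.\<close>
  define C where "C \<delta> = l\<^sup>2 * v + l\<^sup>2 + 2 + 32 * (l\<^sup>2 * V) / \<delta>\<^sup>2" for \<delta>
  have sandwich: "\<forall>\<^sub>F T in at_top. a T * L T (t T) {0..T} \<le> l\<^sup>2 * v / (1 - \<delta>)\<^sup>2 + \<eta> * C \<delta> \<and>
      l\<^sup>2 * v * (1 - \<delta>)\<^sup>2 - \<eta> * C \<delta> \<le> a T * L T (t T) {0..T}"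
    if \<delta>: "0 < \<delta>" "\<delta> < 1" and \<eta>: "0 < \<eta>" for \<delta> \<eta>
    \<comment> \<open>The factors \<open>1 / (1 - \<delta>)\<close> and \<open>1 / \<delta>\<close>
      serve the upper bound. The lower bound needs \<open>1 - \<delta>\<close> on the kept part and
      the negative factor \<open>- (1 - \<delta>) / \<delta>\<close> on the removed part, which is
      subtracted from the whole.\<close>
    using kept[OF \<eta>, of "1 / (1 - \<delta>)"] kept[OF \<eta>, of "1 - \<delta>"]
      crude[OF \<eta>, of "1 / \<delta>"] crude[OF \<eta>, of "- (1 - \<delta>) / \<delta>"] a1 eventually_gt_at_top[of 0]
  proof eventually_elim
    case (elim T)
    note T = elim(6)
    interpret B: block_process M "S T" "m T" c V using blocks T .
    have L: "L T \<tau> A = B.cgf \<tau> A" for \<tau> A by (simp add: L_def B.cgf_def)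
    have a: "0 < a T" "a T < 1" using a_pos T elim by auto
    have ts: "time_set {0..T}" by (auto simp: time_set_def)
    have lenT: "len {0..T} = T" using T by simp
    have rem: "a T * B.cgf (\<kappa> * t T) G \<le> 32 * (l\<^sup>2 * V) / \<delta>\<^sup>2 * \<eta> + \<eta>"
      if "\<forall>A. time_set A \<longrightarrow> len A \<le> T \<longrightarrow> L T (\<kappa> * t T) A \<le> 32 * (\<kappa> * t T)\<^sup>2 * V * len A + \<eta>"
        "time_set G" "G \<subseteq> {0..T}" "len G \<le> \<eta> * T" "\<kappa>\<^sup>2 \<le> 1 / \<delta>\<^sup>2" for G \<kappa>
    proof -
      have "B.cgf (\<kappa> * t T) G \<le> 32 * (\<kappa> * t T)\<^sup>2 * V * len G + \<eta>"
        using that len_mono[OF that(2) ts that(3)] lenT L by auto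
      also have "32 * (\<kappa> * t T)\<^sup>2 * V * len G = 32 * (V * (\<kappa>\<^sup>2 * (t T)\<^sup>2) * len G)"
        by (simp add: power_mult_distrib)
      also have "\<dots> \<le> 32 * (V * (1 / \<delta>\<^sup>2 * (t T)\<^sup>2) * (\<eta> * T))"
        using that V by (intro mult_left_mono mult_mono mult_right_mono) auto
      finally have "a T * B.cgf (\<kappa> * t T) G \<le> a T * (32 * (V * (1 / \<delta>\<^sup>2 * (t T)\<^sup>2) * (\<eta> * T)) + \<eta>)"
        using a by (intro mult_left_mono) auto
      also have "\<dots> = 32 * V / \<delta>\<^sup>2 * \<eta> * (a T * ((t T)\<^sup>2 * T)) + a T * \<eta>"
        by (simp add: algebra_simps)
      also have "\<dots> \<le> 32 * V / \<delta>\<^sup>2 * \<eta> * (a T * ((t T)\<^sup>2 * T)) + 1 * \<eta>"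
        using a \<eta> by (intro add_left_mono mult_right_mono) auto
      finally show ?thesis unfolding t2[OF T] by (simp add: mult_ac)
    qed
    obtain B where B: "time_set B" "B \<subseteq> {0..T}" "len ({0..T} - B) \<le> \<eta> * T"
      "\<bar>B.cgf (1 / (1 - \<delta>) * t T) B - (1 / (1 - \<delta>) * t T)\<^sup>2 * v * len B\<bar> \<le> \<eta> * ((t T)\<^sup>2 * T) + \<eta>"
      using elim(1) unfolding L by blast
    have SB: "S T {0..T} \<omega> = S T B \<omega> + S T ({0..T} - B) \<omega>" if "\<omega> \<in> space M" for \<omega>
      using B.S_Un[OF B(1) time_set_Diff[OF ts B(1)] _ that] B(2) by (simp add: Un_absorb1)
    have "B.cgf (t T) {0..T} \<le> max (B.cgf (1 / (1 - \<delta>) * t T) B) (B.cgf (1 / \<delta> * t T) ({0..T} - B))"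
      using \<delta> SB by (intro B.cgf_convex[where w = "1 - \<delta>"] ts B time_set_Diff) (auto simp: field_simps)
    then have "a T * B.cgf (t T) {0..T} \<le> a T * max (B.cgf (1 / (1 - \<delta>) * t T) B) (B.cgf (1 / \<delta> * t T) ({0..T} - B))"
      using a by (intro mult_left_mono) auto
    \<comment> \<open>A maximum of nonnegative cumulants is at most their sum, so the two parts can
      be estimated separately.\<close>
    also have "\<dots> \<le> a T * B.cgf (1 / (1 - \<delta>) * t T) B + a T * B.cgf (1 / \<delta> * t T) ({0..T} - B)"
      using a B.cgf_nonneg[OF B(1)] B.cgf_nonneg[OF time_set_Diff[OF ts B(1)]]
      by (simp add: max_def flip: distrib_left)
    also have "a T * B.cgf (1 / \<delta> * t T) ({0..T} - B) \<le> 32 * (l\<^sup>2 * V) / \<delta>\<^sup>2 * \<eta> + \<eta>"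
      using elim(3) B \<delta> by (intro rem time_set_Diff ts) (auto simp: power_divide)
    also have "a T * B.cgf (1 / (1 - \<delta>) * t T) B \<le> l\<^sup>2 * v / (1 - \<delta>)\<^sup>2 + \<eta> * l\<^sup>2 + \<eta>"
    proof -
      have "(1 / (1 - \<delta>) * t T)\<^sup>2 * v * len B \<le> (1 / (1 - \<delta>) * t T)\<^sup>2 * v * T"
        using v len_mono[OF B(1) ts B(2)] lenT by (intro mult_left_mono) auto
      then have "B.cgf (1 / (1 - \<delta>) * t T) B \<le> (1 / (1 - \<delta>) * t T)\<^sup>2 * v * T + \<eta> * ((t T)\<^sup>2 * T) + \<eta>"
        using B(4) by linarith
      then have "a T * B.cgf (1 / (1 - \<delta>) * t T) B
          \<le> a T * ((1 / (1 - \<delta>) * t T)\<^sup>2 * v * T + \<eta> * ((t T)\<^sup>2 * T) + \<eta>)"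
        using a by (intro mult_left_mono) auto
      also have "\<dots> = v / (1 - \<delta>)\<^sup>2 * (a T * ((t T)\<^sup>2 * T)) + \<eta> * (a T * ((t T)\<^sup>2 * T)) + a T * \<eta>"
        by (simp add: power_divide distrib_left mult_ac)
      also have "\<dots> \<le> v / (1 - \<delta>)\<^sup>2 * (a T * ((t T)\<^sup>2 * T)) + \<eta> * (a T * ((t T)\<^sup>2 * T)) + 1 * \<eta>"
        using a \<eta> by (intro add_left_mono mult_right_mono) auto
      finally show ?thesis unfolding t2[OF T] by (simp add: mult_ac)
    qed
    finally have "a T * B.cgf (t T) {0..T} \<le> l\<^sup>2 * v / (1 - \<delta>)\<^sup>2 + \<eta> * (l\<^sup>2 + 2 + 32 * (l\<^sup>2 * V) / \<delta>\<^sup>2)"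
      by (simp add: algebra_simps)
    moreover have "\<eta> * (l\<^sup>2 + 2 + 32 * (l\<^sup>2 * V) / \<delta>\<^sup>2) \<le> \<eta> * C \<delta>"
      using \<eta> v by (intro mult_left_mono) (auto simp: C_def)
    ultimately have upper: "a T * B.cgf (t T) {0..T} \<le> l\<^sup>2 * v / (1 - \<delta>)\<^sup>2 + \<eta> * C \<delta>" by linarith
    obtain D where D: "time_set D" "D \<subseteq> {0..T}" "len ({0..T} - D) \<le> \<eta> * T"
      "\<bar>B.cgf ((1 - \<delta>) * t T) D - ((1 - \<delta>) * t T)\<^sup>2 * v * len D\<bar> \<le> \<eta> * ((t T)\<^sup>2 * T) + \<eta>"
      using elim(2) unfolding L by blast
    have SD: "S T {0..T} \<omega> = S T D \<omega> + S T ({0..T} - D) \<omega>" if "\<omega> \<in> space M" for \<omega>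
      using B.S_Un[OF D(1) time_set_Diff[OF ts D(1)] _ that] D(2) by (simp add: Un_absorb1)
    let ?G = "{0..T} - D"
    have "B.cgf ((1 - \<delta>) * t T) D \<le> max (B.cgf (t T) {0..T}) (B.cgf (- (1 - \<delta>) / \<delta> * t T) ?G)"
      using \<delta> SD by (intro B.cgf_convex[where w = "1 - \<delta>"] ts D time_set_Diff) (auto simp: field_simps)
    also have "\<dots> \<le> B.cgf (t T) {0..T} + B.cgf (- (1 - \<delta>) / \<delta> * t T) ?G"
      using B.cgf_nonneg[OF ts] B.cgf_nonneg[OF time_set_Diff[OF ts D(1)]] by (simp add: max_def)
    finally have "a T * B.cgf ((1 - \<delta>) * t T) D
        \<le> a T * (B.cgf (t T) {0..T} + B.cgf (- (1 - \<delta>) / \<delta> * t T) ?G)"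
      using a by (intro mult_left_mono) auto
    then have "a T * B.cgf ((1 - \<delta>) * t T) D - a T * B.cgf (- (1 - \<delta>) / \<delta> * t T) ?G \<le> a T * B.cgf (t T) {0..T}"
      by (simp add: distrib_left)
    moreover have "a T * B.cgf (- (1 - \<delta>) / \<delta> * t T) ?G \<le> 32 * (l\<^sup>2 * V) / \<delta>\<^sup>2 * \<eta> + \<eta>"
    proof (intro rem time_set_Diff ts D)
      have "(1 - \<delta>)\<^sup>2 \<le> 1" using \<delta> by (intro power_le_one) auto
      then show "(- (1 - \<delta>) / \<delta>)\<^sup>2 \<le> 1 / \<delta>\<^sup>2"
        unfolding power_divide power2_minus by (intro divide_right_mono) auto
    qed (use elim(4) in auto)
    moreover have "l\<^sup>2 * v * (1 - \<delta>)\<^sup>2 - \<eta> * (l\<^sup>2 * v + l\<^sup>2) - \<eta> \<le> a T * B.cgf ((1 - \<delta>) * t T) D"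
    proof -
      have lenD: "(1 - \<eta>) * T \<le> len D" using len_Diff[OF ts D(1,2)] D(3) lenT by (simp add: algebra_simps)
      have "((1 - \<delta>) * t T)\<^sup>2 * v * ((1 - \<eta>) * T) \<le> ((1 - \<delta>) * t T)\<^sup>2 * v * len D"
        using v lenD by (intro mult_left_mono) auto
      then have "((1 - \<delta>) * t T)\<^sup>2 * v * ((1 - \<eta>) * T) - \<eta> * ((t T)\<^sup>2 * T) - \<eta> \<le> B.cgf ((1 - \<delta>) * t T) D"
        using D(4) by linarith
      then have "a T * (((1 - \<delta>) * t T)\<^sup>2 * v * ((1 - \<eta>) * T) - \<eta> * ((t T)\<^sup>2 * T) - \<eta>)
          \<le> a T * B.cgf ((1 - \<delta>) * t T) D"
        using a by (intro mult_left_mono) auto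
      moreover have "a T * (((1 - \<delta>) * t T)\<^sup>2 * v * ((1 - \<eta>) * T) - \<eta> * ((t T)\<^sup>2 * T) - \<eta>)
        = (1 - \<delta>)\<^sup>2 * v * (1 - \<eta>) * (a T * ((t T)\<^sup>2 * T)) - \<eta> * (a T * ((t T)\<^sup>2 * T)) - a T * \<eta>"
        unfolding power_mult_distrib by (simp add: algebra_simps)
      moreover have "a T * \<eta> \<le> 1 * \<eta>" using a \<eta> by (intro mult_right_mono) auto
      moreover have "(1 - \<delta>)\<^sup>2 * (\<eta> * (v * l\<^sup>2)) \<le> 1 * (\<eta> * (v * l\<^sup>2))"
        using \<delta> \<eta> v by (intro mult_right_mono power_le_one) auto
      ultimately show ?thesis unfolding t2[OF T] by (simp add: algebra_simps)
    qed
    ultimately have "l\<^sup>2 * v * (1 - \<delta>)\<^sup>2 - \<eta> * C \<delta> \<le> a T * B.cgf (t T) {0..T}"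
      by (simp add: C_def algebra_simps)
    then show ?case using upper by (simp add: L)
  qed
  have "((\<lambda>T. a T * L T (t T) {0..T}) \<longlongrightarrow> l\<^sup>2 * v) at_top"
  proof (rule tendstoI)
    fix \<epsilon> :: real assume \<epsilon>: "0 < \<epsilon>"
    have "((\<lambda>\<delta>. l\<^sup>2 * v / (1 - \<delta>)\<^sup>2) \<longlongrightarrow> l\<^sup>2 * v / (1 - 0)\<^sup>2) (at_right 0)"
      by (intro tendsto_intros) auto
    then have 1: "\<forall>\<^sub>F \<delta> in at_right 0. l\<^sup>2 * v / (1 - \<delta>)\<^sup>2 < l\<^sup>2 * v + \<epsilon> / 2"
      by (rule order_tendstoD) (use \<epsilon> in auto)
    have "((\<lambda>\<delta>. l\<^sup>2 * v * (1 - \<delta>)\<^sup>2) \<longlongrightarrow> l\<^sup>2 * v * (1 - 0)\<^sup>2) (at_right 0)"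
      by (intro tendsto_intros)
    then have 2: "\<forall>\<^sub>F \<delta> in at_right 0. l\<^sup>2 * v - \<epsilon> / 2 < l\<^sup>2 * v * (1 - \<delta>)\<^sup>2"
      by (rule order_tendstoD) (use \<epsilon> in auto)
    have 3: "\<forall>\<^sub>F \<delta> in at_right (0::real). \<delta> \<in> {0<..<1}" by (rule eventually_at_right_real) simp
    obtain \<delta> where \<delta>: "l\<^sup>2 * v / (1 - \<delta>)\<^sup>2 < l\<^sup>2 * v + \<epsilon> / 2" "l\<^sup>2 * v - \<epsilon> / 2 < l\<^sup>2 * v * (1 - \<delta>)\<^sup>2"
        "0 < \<delta>" "\<delta> < 1"
      using eventually_happens[OF eventually_conj[OF 1 eventually_conj[OF 2 3]]] by auto
    have C: "0 < C \<delta>" unfolding C_def using v V by (intro add_nonneg_pos add_pos_nonneg) auto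
    \<comment> \<open>\<open>\<delta>\<close> is fixed first, since \<open>C \<delta>\<close>
      depends on it; only then is \<open>\<eta>\<close> made small.\<close>
    define \<eta> where "\<eta> = \<epsilon> / 2 / C \<delta>"
    have \<eta>: "0 < \<eta>" "\<eta> * C \<delta> = \<epsilon> / 2" using C \<epsilon> by (auto simp: \<eta>_def)
    show "\<forall>\<^sub>F T in at_top. dist (a T * L T (t T) {0..T}) (l\<^sup>2 * v) < \<epsilon>"
      using sandwich[OF \<delta>(3,4) \<eta>(1)]
    proof eventually_elim
      case (elim T)
      then show ?case using \<delta>(1,2) \<eta>(2) by (simp add: dist_real_def abs_less_iff)
    qed
  qed
  then show ?thesis by (simp add: L_def t_def)
qed

section \<open>Stationary strong mixing processes\<close>

context prob_space
begin

text \<open>\<open>V\<close> is the integral over the levels \<open>b\<close> in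
  \<open>{0..v}\<close> of the indicators of \<open>b < V\<close>, and Fubini moves this integral
  outside the expectation.\<close>

lemma layer_cake:
  fixes W V :: "'a \<Rightarrow> real" and k v :: real
  assumes W: "W \<in> borel_measurable M" "\<And>\<omega>. \<omega> \<in> space M \<Longrightarrow> \<bar>W \<omega>\<bar> \<le> k"
    and V: "V \<in> borel_measurable M" "\<And>\<omega>. \<omega> \<in> space M \<Longrightarrow> 0 \<le> V \<omega> \<and> V \<omega> \<le> v"
  shows "expectation (\<lambda>\<omega>. W \<omega> * V \<omega>)
      = (LINT b|lborel. indicator {0..v} b * expectation (\<lambda>\<omega>. W \<omega> * indicator {\<omega> \<in> space M. b < V \<omega>} \<omega>))"
    and "integrable lborel (\<lambda>b. indicator {0..v} b * expectation (\<lambda>\<omega>. W \<omega> * indicator {\<omega> \<in> space M. b < V \<omega>} \<omega>))"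
proof -
  interpret P: pair_sigma_finite lborel M ..
  note [measurable] = W(1) V(1)
  define F where "F b \<omega> = indicator {0..v} b * (W \<omega> * (if b < V \<omega> then 1 else 0))" for b \<omega>
  have int: "integrable (lborel \<Otimes>\<^sub>M M) (case_prod F)"
  proof (rule integrableI_bounded_set[where A = "{0..v} \<times> space M" and B = k])
    show "emeasure (lborel \<Otimes>\<^sub>M M) ({0..v} \<times> space M) < \<infinity>"
      using emeasure_bounded_finite[OF bounded_closed_interval[of 0 v]]
      by (subst emeasure_pair_measure_Times) (auto simp: emeasure_space_1 ennreal_mult_less_top)
    show "AE p\<in>{0..v} \<times> space M in lborel \<Otimes>\<^sub>M M. norm (case_prod F p) \<le> k"
    proof (intro AE_I2 impI)
      fix p assume p: "p \<in> {0..v} \<times> space M"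
      then have "norm (case_prod F p) \<le> \<bar>W (snd p)\<bar>" by (auto simp: F_def split_beta)
      then show "norm (case_prod F p) \<le> k" using W(2)[of "snd p"] p by auto
    qed
    show "AE p in lborel \<Otimes>\<^sub>M M. p \<notin> {0..v} \<times> space M \<longrightarrow> case_prod F p = 0"
      by (intro AE_I2) (auto simp: F_def space_pair_measure indicator_def split: if_splits)
    show "case_prod F \<in> borel_measurable (lborel \<Otimes>\<^sub>M M)"
      unfolding F_def split_beta by measurable
  qed measurable
  have eq: "expectation (F b) = indicator {0..v} b * expectation (\<lambda>\<omega>. W \<omega> * indicator {\<omega> \<in> space M. b < V \<omega>} \<omega>)" for b
    unfolding F_def integral_mult_right_zero
    by (intro arg_cong2[where f = "(*)"] refl Bochner_Integration.integral_cong) (auto simp: indicator_def)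
  have inner: "(LINT b|lborel. F b \<omega>) = W \<omega> * V \<omega>" if "\<omega> \<in> space M" for \<omega>
  proof -
    have "(LINT b|lborel. F b \<omega>) = (LINT b|lborel. W \<omega> * indicator {0..<V \<omega>} b)"
      using V(2)[OF that] by (intro Bochner_Integration.integral_cong) (auto simp: F_def indicator_def)
    then show ?thesis using V(2)[OF that] by simp
  qed
  have "expectation (\<lambda>\<omega>. W \<omega> * V \<omega>) = expectation (\<lambda>\<omega>. LINT b|lborel. F b \<omega>)"
    by (intro Bochner_Integration.integral_cong) (auto simp: inner)
  also have "\<dots> = (LINT b|lborel. expectation (F b))"
    using P.Fubini_integral[OF int] by simp
  finally show "expectation (\<lambda>\<omega>. W \<omega> * V \<omega>)
      = (LINT b|lborel. indicator {0..v} b * expectation (\<lambda>\<omega>. W \<omega> * indicator {\<omega> \<in> space M. b < V \<omega>} \<omega>))"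
    unfolding eq .
  show "integrable lborel (\<lambda>b. indicator {0..v} b * expectation (\<lambda>\<omega>. W \<omega> * indicator {\<omega> \<in> space M. b < V \<omega>} \<omega>))"
    using P.integrable_fst'[OF int] by (simp add: eq)
qed

text \<open>Integration over the levels of \<open>V\<close> transfers a covariance bound from events
  to \<open>V\<close>, at the price of its range. It is to be used once for each factor.\<close>

lemma covariance_layer_bound:
  assumes W: "W \<in> borel_measurable M" "\<And>\<omega>. \<omega> \<in> space M \<Longrightarrow> \<bar>W \<omega>\<bar> \<le> k"
    and V: "V \<in> borel_measurable M" "\<And>\<omega>. \<omega> \<in> space M \<Longrightarrow> 0 \<le> V \<omega> \<and> V \<omega> \<le> v"
    and v: "0 \<le> v"
    and bd: "\<And>b. \<bar>expectation (\<lambda>\<omega>. W \<omega> * indicator {\<omega> \<in> space M. b < V \<omega>} \<omega>)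
        - expectation W * prob {\<omega> \<in> space M. b < V \<omega>}\<bar> \<le> \<alpha>"
  shows "\<bar>expectation (\<lambda>\<omega>. W \<omega> * V \<omega>) - expectation W * expectation V\<bar> \<le> \<alpha> * v"
proof -
  note [measurable] = W(1) V(1)
  let ?I = "\<lambda>b \<omega>. indicator {\<omega> \<in> space M. b < V \<omega>} \<omega> :: real"
  have EI: "expectation (\<lambda>\<omega>. expectation W * ?I b \<omega>) = expectation W * prob {\<omega> \<in> space M. b < V \<omega>}" for b
    by (subst integral_mult_right_zero) simp
  have 1: "expectation (\<lambda>\<omega>. W \<omega> * V \<omega>) = (LINT b|lborel. indicator {0..v} b * expectation (\<lambda>\<omega>. W \<omega> * ?I b \<omega>))"
    and i1: "integrable lborel (\<lambda>b. indicator {0..v} b * expectation (\<lambda>\<omega>. W \<omega> * ?I b \<omega>))"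
    using layer_cake[OF W V] by auto
  have "expectation W * expectation V = expectation (\<lambda>\<omega>. expectation W * V \<omega>)" by simp
  also have "\<dots> = (LINT b|lborel. indicator {0..v} b * (expectation W * prob {\<omega> \<in> space M. b < V \<omega>}))"
    unfolding EI[symmetric] by (rule layer_cake(1)[OF _ _ V, of _ "\<bar>expectation W\<bar>"]) auto
  finally have 2: "expectation W * expectation V
      = (LINT b|lborel. indicator {0..v} b * (expectation W * prob {\<omega> \<in> space M. b < V \<omega>}))" .
  have i2: "integrable lborel (\<lambda>b. indicator {0..v} b * (expectation W * prob {\<omega> \<in> space M. b < V \<omega>}))"
    unfolding EI[symmetric] by (rule layer_cake(2)[OF _ _ V, of _ "\<bar>expectation W\<bar>"]) auto
  have "\<bar>expectation (\<lambda>\<omega>. W \<omega> * V \<omega>) - expectation W * expectation V\<bar>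
     = \<bar>LINT b|lborel. indicator {0..v} b * expectation (\<lambda>\<omega>. W \<omega> * ?I b \<omega>)
         - indicator {0..v} b * (expectation W * prob {\<omega> \<in> space M. b < V \<omega>})\<bar>"
    unfolding 1 2 using i1 i2 by simp
  also have "\<dots> \<le> (LINT b|lborel. \<alpha> * indicator {0..v} b)"
  proof (rule integral_abs_bound_integral)
    fix b :: real
    show "\<bar>indicator {0..v} b * expectation (\<lambda>\<omega>. W \<omega> * ?I b \<omega>)
         - indicator {0..v} b * (expectation W * prob {\<omega> \<in> space M. b < V \<omega>})\<bar> \<le> \<alpha> * indicator {0..v} b"
      using bd[of b] by (cases "b \<in> {0..v}") simp_all
  next
    show "integrable lborel (\<lambda>b. \<alpha> * indicator {0..v} b)"
      using emeasure_bounded_finite[OF bounded_closed_interval[of 0 v]]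
      by (intro integrable_mult_right integrable_real_indicator) auto
  qed (rule Bochner_Integration.integrable_diff[OF i1 i2])
  also have "\<dots> = \<alpha> * v" using v by simp
  finally show ?thesis .
qed

text \<open>Each factor is layered in turn, the other one being held fixed. Nonnegativity gives the
  constant 1, where the inequality for signed bounded variables has 4.\<close>

lemma covariance_mixing_bound:
  assumes U: "U \<in> borel_measurable M" "\<And>\<omega>. \<omega> \<in> space M \<Longrightarrow> 0 \<le> U \<omega> \<and> U \<omega> \<le> u" and u: "0 \<le> u"
    and V: "V \<in> borel_measurable M" "\<And>\<omega>. \<omega> \<in> space M \<Longrightarrow> 0 \<le> V \<omega> \<and> V \<omega> \<le> v" and v: "0 \<le> v"
    and bd: "\<And>a b. \<bar>prob ({\<omega> \<in> space M. a < U \<omega>} \<inter> {\<omega> \<in> space M. b < V \<omega>})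
        - prob {\<omega> \<in> space M. a < U \<omega>} * prob {\<omega> \<in> space M. b < V \<omega>}\<bar> \<le> \<alpha>"
  shows "\<bar>expectation (\<lambda>\<omega>. U \<omega> * V \<omega>) - expectation U * expectation V\<bar> \<le> \<alpha> * u * v"
proof (rule covariance_layer_bound[OF U(1) _ V v])
  fix b
  note [measurable] = U(1) V(1)
  let ?B = "{\<omega> \<in> space M. b < V \<omega>}"
  have "\<bar>expectation (\<lambda>\<omega>. indicator ?B \<omega> * U \<omega>) - expectation (indicator ?B) * expectation U\<bar> \<le> \<alpha> * u"
  proof (rule covariance_layer_bound[OF _ _ U u, where k = 1])
    fix a
    have "(\<lambda>\<omega>. indicator ?B \<omega> * indicator {\<omega> \<in> space M. a < U \<omega>} \<omega> :: real)
        = indicator ({\<omega> \<in> space M. a < U \<omega>} \<inter> ?B)"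
      by (auto simp: indicator_def)
    then show "\<bar>expectation (\<lambda>\<omega>. indicator ?B \<omega> * indicator {\<omega> \<in> space M. a < U \<omega>} \<omega>)
        - expectation (indicator ?B) * prob {\<omega> \<in> space M. a < U \<omega>}\<bar> \<le> \<alpha>"
      using bd[of a b] by (simp add: mult.commute)
  qed (auto simp: indicator_def)
  then show "\<bar>expectation (\<lambda>\<omega>. U \<omega> * indicator ?B \<omega>) - expectation U * prob ?B\<bar> \<le> \<alpha> * u"
    by (simp add: mult.commute)
qed (use U in auto)

end

section \<open>Additive functionals of a strong mixing process\<close>

locale mixing_density_process = prob_space M for M :: "'a measure" +
  fixes X :: "real \<Rightarrow> 'a \<Rightarrow> real" and f :: "real \<Rightarrow> real" and c :: real
  assumes X_meas: "measurable_process M X"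
    and f_nonneg: "\<And>y. 0 \<le> f y"
    and f_dens: "\<And>t. 0 \<le> t \<Longrightarrow> distributed M lborel (X t) (\<lambda>y. ennreal (f y))"
    and c_pos: "0 < c"
    and mixing: "\<And>u. 0 \<le> u \<Longrightarrow> alpha_mixing M X u \<le> exp (- c * u)"
begin

lemma X_rv: "0 \<le> t \<Longrightarrow> X t \<in> borel_measurable M"
  using distributed_measurable[OF f_dens] by simp

text \<open>Freezing the path at negative times by \<open>max 0\<close> gives joint measurability on
  the whole line, so Fubini can be used with \<open>lborel\<close> directly.\<close>

lemma X_joint [measurable]: "(\<lambda>p. X (max 0 (fst p)) (snd p)) \<in> borel_measurable (lborel \<Otimes>\<^sub>M M)"
proof -
  have "(\<lambda>p. (max 0 (fst p), snd p)) \<in> (lborel \<Otimes>\<^sub>M M) \<rightarrow>\<^sub>M (restrict_space borel {0::real..} \<Otimes>\<^sub>M M)"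
    by (intro measurable_Pair measurable_restrict_space2) auto
  from measurable_compose[OF this X_meas[unfolded measurable_process_def]] show ?thesis
    by (simp add: split_beta)
qed

text \<open>A supremum of reals dominates its members only if they are bounded above. Every
  covariance of two events is at most 1 in absolute value, and this settles both nested
  suprema.\<close>

lemma mixing_events:
  assumes "A \<in> sigma_process M X {0..r}" "B \<in> sigma_process M X {r + q..}" "0 \<le> r" "0 \<le> q"
  shows "\<bar>prob (A \<inter> B) - prob A * prob B\<bar> \<le> exp (- c * q)"
proof -
  have le1: "\<bar>prob (A \<inter> B) - prob A * prob B\<bar> \<le> 1" for A B
    using prob_le_1[of "A \<inter> B"] mult_le_one[of "prob A" "prob B"] prob_le_1[of A] prob_le_1[of B]
    by (smt (verit) measure_nonneg mult_nonneg_nonneg)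
  have coeff_le: "alpha_coeff M \<A> \<B> \<le> 1" if "\<A> \<times> \<B> \<noteq> {}" for \<A> \<B>
    unfolding alpha_coeff_def using that le1 by (intro cSUP_least) auto
  have nonempty: "sigma_process M X I \<noteq> {}" for I
    unfolding sigma_process_def using sigma_sets.Empty by blast
  have "\<bar>prob (A \<inter> B) - prob A * prob B\<bar> \<le> alpha_coeff M (sigma_process M X {0..r}) (sigma_process M X {q + r..})"
    unfolding alpha_coeff_def using assms(1,2) le1
    by (intro cSUP_upper2[where x = "(A, B)"] bdd_aboveI2[where M = 1]) (auto simp: add.commute)
  also have "\<dots> \<le> alpha_mixing M X q"
    unfolding alpha_mixing_def using assms(3) coeff_le nonempty
    by (intro cSUP_upper2[where x = r] bdd_aboveI2[where M = 1]) auto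
  also have "\<dots> \<le> exp (- c * q)" using mixing assms(4) .
  finally show ?thesis .
qed

definition mean :: "(real \<Rightarrow> real) \<Rightarrow> real" where
  "mean \<phi> = (LINT y|lborel. f y * \<phi> y)"

definition centered :: "(real \<Rightarrow> real) \<Rightarrow> real \<Rightarrow> 'a \<Rightarrow> real" where
  "centered \<phi> t \<omega> = \<phi> (X (max 0 t) \<omega>) - mean \<phi>"

definition block_sum :: "(real \<Rightarrow> real) \<Rightarrow> real set \<Rightarrow> 'a \<Rightarrow> real" where
  "block_sum \<phi> A \<omega> = (LINT t|lborel. indicator A t * centered \<phi> t \<omega>)"

context
  fixes \<phi> :: "real \<Rightarrow> real" and m :: real
  assumes \<phi>_meas [measurable]: "\<phi> \<in> borel_measurable borel" and \<phi>_bound: "\<And>y. 0 \<le> \<phi> y" "\<And>y. \<phi> y \<le> m"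
begin

lemma expectation_\<phi>: "0 \<le> t \<Longrightarrow> expectation (\<lambda>\<omega>. \<phi> (X t \<omega>)) = mean \<phi>"
  unfolding mean_def by (subst distributed_integral[OF f_dens]) (auto simp: f_nonneg)

lemma \<phi>_integrable: "0 \<le> t \<Longrightarrow> integrable M (\<lambda>\<omega>. \<phi> (X t \<omega>))"
  using X_rv[of t] \<phi>_bound by (intro integrable_const_bound[where B = m]) (auto simp: abs_of_nonneg)

lemma mean_bound: "0 \<le> mean \<phi>" "mean \<phi> \<le> m"
proof -
  show "0 \<le> mean \<phi>" using expectation_\<phi>[of 0] \<phi>_bound Bochner_Integration.integral_nonneg[of M "\<lambda>\<omega>. \<phi> (X 0 \<omega>)"] by simp
  have "expectation (\<lambda>\<omega>. \<phi> (X 0 \<omega>)) \<le> expectation (\<lambda>\<omega>. m)"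
    using \<phi>_bound by (intro integral_mono \<phi>_integrable) auto
  then show "mean \<phi> \<le> m" using expectation_\<phi>[of 0] by (simp add: prob_space)
qed

lemma centered_bound: "\<bar>centered \<phi> t \<omega>\<bar> \<le> m"
  using \<phi>_bound(1)[of "X (max 0 t) \<omega>"] \<phi>_bound(2)[of "X (max 0 t) \<omega>"] mean_bound by (auto simp: centered_def abs_le_iff)

lemma m_ge_0: "0 \<le> m" using mean_bound by linarith

lemma centered_joint [measurable]: "(\<lambda>p. centered \<phi> (fst p) (snd p)) \<in> borel_measurable (lborel \<Otimes>\<^sub>M M)"
  unfolding centered_def by measurable

lemma centered_rv [measurable]: "centered \<phi> t \<in> borel_measurable M"
  using X_rv[of "max 0 t"] unfolding centered_def by measurable

lemma centered_path: "\<omega> \<in> space M \<Longrightarrow> (\<lambda>t. centered \<phi> t \<omega>) \<in> borel_measurable lborel"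
  using measurable_compose[OF measurable_Pair2'[of \<omega> M lborel] centered_joint] by simp

lemma expectation_centered: "expectation (centered \<phi> t) = 0"
  using expectation_\<phi>[of "max 0 t"] \<phi>_integrable[of "max 0 t"] unfolding centered_def by (simp add: prob_space)

text \<open>The test variable \<open>W\<close> makes one exchange of integrals serve several ends:
  \<open>W = 1\<close> gives the mean, a block sum or \<open>centered \<phi> s\<close> gives second
  moments, and indicators of events give adaptedness.\<close>

lemma block_sum_fubini:
  assumes A: "time_set A" and W: "W \<in> borel_measurable M" "\<And>\<omega>. \<omega> \<in> space M \<Longrightarrow> \<bar>W \<omega>\<bar> \<le> k"
  shows "expectation (\<lambda>\<omega>. block_sum \<phi> A \<omega> * W \<omega>)
      = (LINT t|lborel. indicator A t * expectation (\<lambda>\<omega>. centered \<phi> t \<omega> * W \<omega>))"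
    and "integrable lborel (\<lambda>t. indicator A t * expectation (\<lambda>\<omega>. centered \<phi> t \<omega> * W \<omega>))"
proof -
  interpret P: pair_sigma_finite lborel M ..
  note [measurable] = W(1)
  have [measurable]: "A \<in> sets borel" using A by (simp add: time_set_def)
  define F where "F t \<omega> = indicator A t * (centered \<phi> t \<omega> * W \<omega>)" for t \<omega>
  have int: "integrable (lborel \<Otimes>\<^sub>M M) (case_prod F)"
  proof (rule integrableI_bounded_set[where A = "A \<times> space M" and B = "m * k"])
    have "emeasure lborel A < \<infinity>" using A unfolding time_set_def by (intro emeasure_bounded_finite) simp
    then show "emeasure (lborel \<Otimes>\<^sub>M M) (A \<times> space M) < \<infinity>"
      by (subst emeasure_pair_measure_Times) (auto simp: emeasure_space_1 ennreal_mult_less_top)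
    show "AE p\<in>A \<times> space M in lborel \<Otimes>\<^sub>M M. norm (case_prod F p) \<le> m * k"
    proof (intro AE_I2 impI)
      fix p assume p: "p \<in> A \<times> space M"
      then have "\<bar>centered \<phi> (fst p) (snd p)\<bar> * \<bar>W (snd p)\<bar> \<le> m * k"
        by (intro mult_mono centered_bound W(2) m_ge_0) auto
      then show "norm (case_prod F p) \<le> m * k" using p by (auto simp: F_def abs_mult split_beta)
    qed
    show "case_prod F \<in> borel_measurable (lborel \<Otimes>\<^sub>M M)"
      unfolding F_def split_beta by measurable
    show "AE p in lborel \<Otimes>\<^sub>M M. p \<notin> A \<times> space M \<longrightarrow> case_prod F p = 0"
      by (intro AE_I2) (auto simp: F_def space_pair_measure indicator_def split: if_splits)
  qed measurable
  have inner: "(LINT t|lborel. F t \<omega>) = block_sum \<phi> A \<omega> * W \<omega>" for \<omega>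
  proof -
    have "(LINT t|lborel. F t \<omega>) = (LINT t|lborel. indicator A t * centered \<phi> t \<omega> * W \<omega>)"
      by (simp add: F_def mult.assoc)
    then show ?thesis by (simp add: block_sum_def)
  qed
  have eq: "expectation (F t) = indicator A t * expectation (\<lambda>\<omega>. centered \<phi> t \<omega> * W \<omega>)" for t
    unfolding F_def by simp
  show "expectation (\<lambda>\<omega>. block_sum \<phi> A \<omega> * W \<omega>)
      = (LINT t|lborel. indicator A t * expectation (\<lambda>\<omega>. centered \<phi> t \<omega> * W \<omega>))"
    using P.Fubini_integral[OF int] unfolding inner eq .
  show "integrable lborel (\<lambda>t. indicator A t * expectation (\<lambda>\<omega>. centered \<phi> t \<omega> * W \<omega>))"
    using P.integrable_fst'[OF int] by (simp add: eq)
qed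

lemma block_sum_rv:
  assumes A: "time_set A"
  shows "block_sum \<phi> A \<in> borel_measurable M"
proof -
  have [measurable]: "A \<in> sets borel" using A by (simp add: time_set_def)
  have "(\<lambda>(\<omega>, t). indicator A t * centered \<phi> t \<omega>) \<in> borel_measurable (M \<Otimes>\<^sub>M lborel)"
  proof -
    have "(\<lambda>p. indicator A (fst p) * centered \<phi> (fst p) (snd p)) \<in> borel_measurable (lborel \<Otimes>\<^sub>M M)"
      by measurable
    from measurable_compose[OF measurable_pair_swap' this] show ?thesis by (simp add: split_beta)
  qed
  from lborel.borel_measurable_lebesgue_integral[OF this] show ?thesis
    by (simp add: block_sum_def[abs_def])
qed

lemma block_path_integrable:
  assumes A: "time_set A" and \<omega>: "\<omega> \<in> space M"
  shows "integrable lborel (\<lambda>t. indicator A t * centered \<phi> t \<omega>)"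
proof -
  have "emeasure lborel A < \<infinity>" using A unfolding time_set_def by (intro emeasure_bounded_finite) simp
  then show ?thesis
    using A integrableI_bounded_set_indicator[OF _ centered_path[OF \<omega>], of A m] centered_bound
    by (simp add: time_set_def)
qed

lemma block_sum_bound:
  assumes A: "time_set A" and \<omega>: "\<omega> \<in> space M"
  shows "\<bar>block_sum \<phi> A \<omega>\<bar> \<le> m * len A"
proof -
  have [measurable]: "A \<in> sets borel" using A by (simp add: time_set_def)
  have fin: "emeasure lborel A < \<infinity>" using A unfolding time_set_def by (intro emeasure_bounded_finite) simp
  have "\<bar>block_sum \<phi> A \<omega>\<bar> \<le> (LINT t|lborel. m * indicator A t)"
    unfolding block_sum_def
    using block_path_integrable[OF A \<omega>] fin centered_bound
    by (intro integral_abs_bound_integral integrable_mult_right integrable_real_indicator)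
       (auto simp: indicator_def abs_mult)
  then show ?thesis by simp
qed

lemma block_sum_Un:
  assumes "time_set A" "time_set B" "A \<inter> B = {}" "\<omega> \<in> space M"
  shows "block_sum \<phi> (A \<union> B) \<omega> = block_sum \<phi> A \<omega> + block_sum \<phi> B \<omega>"
proof -
  have "indicator (A \<union> B) t * centered \<phi> t \<omega> = indicator A t * centered \<phi> t \<omega> + indicator B t * centered \<phi> t \<omega>" for t
    using assms(3) by (auto simp: indicator_def)
  then show ?thesis unfolding block_sum_def
    using block_path_integrable[OF assms(1,4)] block_path_integrable[OF assms(2,4)] by simp
qed

lemma block_sum_mean: "time_set A \<Longrightarrow> expectation (block_sum \<phi> A) = 0"
  using block_sum_fubini(1)[of A "\<lambda>_. 1" 1] expectation_centered by simp

text \<open>\<open>sigma_process\<close> packaged as a measure space, the form in which conditional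
  expectations take a sub-sigma-algebra. The set \<open>I\<close> may equally consist of future
  times.\<close>

definition past :: "real set \<Rightarrow> 'a measure" where
  "past I = sigma (space M) {X s -` B \<inter> space M | s B. s \<in> I \<and> B \<in> sets borel}"

lemma sets_past: "sets (past I) = sigma_process M X I"
  unfolding past_def sigma_process_def by (rule sets_measure_of) auto

lemma space_past: "space (past I) = space M"
  unfolding past_def by (rule space_measure_of) auto

lemma subalgebra_past: "I \<subseteq> {0..} \<Longrightarrow> subalgebra M (past I)"
  unfolding subalgebra_def sets_past space_past sigma_process_def
  using X_rv by (auto intro!: sets.sigma_sets_subset intro: measurable_sets)

lemma X_past: "s \<in> I \<Longrightarrow> X s \<in> borel_measurable (past I)"
  by (rule measurableI) (auto simp: space_past sets_past sigma_process_def intro!: sigma_sets.Basic)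

text \<open>The process is jointly measurable but not assumed progressively measurable, so \<open>block_sum\<close>
  is adapted only up to a null set: by Fubini it has the same integral over every event as its
  conditional expectation.\<close>

lemma block_sum_adapted:
  assumes A: "time_set A" "A \<subseteq> I" and I: "I \<subseteq> {0..}"
  shows "AE \<omega> in M. real_cond_exp M (past I) (block_sum \<phi> A) \<omega> = block_sum \<phi> A \<omega>"
proof -
  interpret N: sigma_finite_subalgebra M "past I"
    by (rule finite_measure_subalgebra_is_sigma_finite, unfold_locales) (rule subalgebra_past[OF I])
  interpret MM: sigma_finite_subalgebra M M
    by (rule finite_measure_subalgebra_is_sigma_finite, unfold_locales) (simp add: subalgebra_def)
  note [measurable] = block_sum_rv[OF A(1)]
  let ?S = "block_sum \<phi> A" and ?E = "real_cond_exp M (past I)"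
  have intS: "integrable M ?S"
    using block_sum_bound[OF A(1)] by (intro integrable_const_bound[where B = "m * len A"]) auto
  have intE: "integrable M (?E ?S)" using N.real_cond_exp_int(1)[OF intS] .
  \<comment> \<open>Conditioning on \<open>M\<close> itself converts equality of the integrals over
    all events into almost sure equality.\<close>
  have "AE \<omega> in M. real_cond_exp M M ?S \<omega> = ?E ?S \<omega>"
  proof (rule MM.real_cond_exp_charact)
    fix C assume C [measurable]: "C \<in> sets M"
    have intC: "integrable M (indicator C :: 'a \<Rightarrow> real)" by (simp add: emeasure_eq_measure)
    \<comment> \<open>A version of the conditional probability of \<open>C\<close>, truncated to be
      bounded at every point, as \<open>block_sum_fubini\<close> requires of its test
      variable.\<close>
    define q where "q \<omega> = max 0 (min 1 (?E (indicator C) \<omega>))" for \<omega>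
    have [measurable]: "q \<in> borel_measurable (past I)" unfolding q_def by measurable
    have qM [measurable]: "q \<in> borel_measurable M"
      by (rule measurable_from_subalg[OF subalgebra_past[OF I]]) fact
    have "AE \<omega> in M. ?E (indicator C) \<omega> \<le> 1" by (rule N.real_cond_exp_le_c[OF intC]) (simp add: indicator_def)
    moreover have "AE \<omega> in M. ?E (indicator C) \<omega> \<ge> 0" by (rule N.real_cond_exp_ge_c[OF intC]) simp
    ultimately have q: "AE \<omega> in M. ?E (indicator C) \<omega> = q \<omega>" by eventually_elim (auto simp: q_def)
    have qb: "\<bar>q \<omega>\<bar> \<le> 1" for \<omega> by (auto simp: q_def)
    \<comment> \<open>Functions measurable with respect to \<open>past I\<close> do not distinguish
      the indicator of \<open>C\<close> from \<open>q\<close>. This is used for each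
      \<open>centered \<phi> t\<close> with \<open>t\<close> in \<open>A\<close>, and at the end for
      the conditional expectation.\<close>
    have rep: "expectation (\<lambda>\<omega>. g \<omega> * indicator C \<omega>) = expectation (\<lambda>\<omega>. g \<omega> * q \<omega>)"
      if g: "g \<in> borel_measurable (past I)" "integrable M g" for g
    proof -
      have "integrable M (\<lambda>\<omega>. g \<omega> * indicator C \<omega>)" using integrable_mult_indicator[OF C g(2)] by (simp add: mult.commute)
      then have "expectation (\<lambda>\<omega>. g \<omega> * indicator C \<omega>) = expectation (\<lambda>\<omega>. g \<omega> * ?E (indicator C) \<omega>)"
        using g by (intro N.real_cond_exp_intg(2)[symmetric]) auto
      also have "\<dots> = expectation (\<lambda>\<omega>. g \<omega> * q \<omega>)"
        using q borel_measurable_integrable[OF g(2)] by (intro integral_cong_AE) auto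
      finally show ?thesis .
    qed
    have "expectation (\<lambda>\<omega>. ?S \<omega> * indicator C \<omega>)
        = (LINT t|lborel. indicator A t * expectation (\<lambda>\<omega>. centered \<phi> t \<omega> * indicator C \<omega>))"
      by (rule block_sum_fubini(1)[OF A(1), of _ 1]) (auto simp: indicator_def)
    also have "\<dots> = (LINT t|lborel. indicator A t * expectation (\<lambda>\<omega>. centered \<phi> t \<omega> * q \<omega>))"
    proof (intro Bochner_Integration.integral_cong refl)
      fix t
      have "expectation (\<lambda>\<omega>. centered \<phi> t \<omega> * indicator C \<omega>) = expectation (\<lambda>\<omega>. centered \<phi> t \<omega> * q \<omega>)" if "t \<in> A"
      proof (rule rep)
        have "t \<in> I" "max 0 t = t" using that A I by auto
        then show "centered \<phi> t \<in> borel_measurable (past I)" using X_past[of t I] unfolding centered_def by simp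
        show "integrable M (centered \<phi> t)"
          using centered_bound by (intro integrable_const_bound[where B = m]) auto
      qed
      then show "indicator A t * expectation (\<lambda>\<omega>. centered \<phi> t \<omega> * indicator C \<omega>)
          = indicator A t * expectation (\<lambda>\<omega>. centered \<phi> t \<omega> * q \<omega>)"
        by (auto simp: indicator_def)
    qed
    also have "\<dots> = expectation (\<lambda>\<omega>. ?S \<omega> * q \<omega>)"
      using qb by (intro block_sum_fubini(1)[OF A(1), of _ 1, symmetric]) auto
    also have "\<dots> = expectation (\<lambda>\<omega>. q \<omega> * ?E ?S \<omega>)"
    proof -
      have "integrable M (\<lambda>\<omega>. q \<omega> * ?S \<omega>)"
      proof (rule integrable_const_bound[where B = "1 * (m * len A)"], intro AE_I2)
        fix \<omega> assume "\<omega> \<in> space M"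
        then show "norm (q \<omega> * ?S \<omega>) \<le> 1 * (m * len A)"
          unfolding real_norm_def abs_mult using qb block_sum_bound[OF A(1)] by (intro mult_mono) auto
      qed measurable
      then show ?thesis by (subst N.real_cond_exp_intg(2)) (auto simp: mult.commute)
    qed
    also have "\<dots> = expectation (\<lambda>\<omega>. ?E ?S \<omega> * indicator C \<omega>)"
      using rep[of "?E ?S"] intE by (simp add: mult.commute)
    finally show "(LINT \<omega>:C|M. ?S \<omega>) = (LINT \<omega>:C|M. ?E ?S \<omega>)"
      by (simp add: set_lebesgue_integral_def mult.commute)
  qed (use intS intE in auto)
  moreover have "AE \<omega> in M. real_cond_exp M M ?S \<omega> = ?S \<omega>"
    by (rule MM.real_cond_exp_F_meas[OF intS]) simp
  ultimately show ?thesis by eventually_elim simp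
qed

lemma block_sum_decouple:
  assumes A: "time_set A" and B: "time_set B" and AB: "A \<subseteq> {..r}" "B \<subseteq> {r + q..}" and q: "0 \<le> q"
  shows "\<bar>expectation (\<lambda>\<omega>. exp (\<tau> * block_sum \<phi> A \<omega>) * exp (\<tau> * block_sum \<phi> B \<omega>))
     - expectation (\<lambda>\<omega>. exp (\<tau> * block_sum \<phi> A \<omega>)) * expectation (\<lambda>\<omega>. exp (\<tau> * block_sum \<phi> B \<omega>))\<bar>
    \<le> exp (- c * q) * exp (\<bar>\<tau>\<bar> * m * (len A + len B))"
\<comment> \<open>For empty \<open>A\<close> the cut \<open>r\<close> may be negative, outside the
  range of the mixing condition; the covariance is then 0.\<close>
proof (cases "A = {}")
  case True
  then show ?thesis by (simp add: block_sum_def prob_space)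
next
  case False
  then have r: "0 \<le> r" using A AB(1) by (force simp: time_set_def)
  have A_r: "A \<subseteq> {0..r}" using A AB(1) by (fastforce simp: time_set_def)
  note [measurable] = block_sum_rv[OF A] block_sum_rv[OF B]
  have bound: "0 \<le> exp (\<tau> * block_sum \<phi> D \<omega>) \<and> exp (\<tau> * block_sum \<phi> D \<omega>) \<le> exp (\<bar>\<tau>\<bar> * (m * len D))"
    if "time_set D" "\<omega> \<in> space M" for D \<omega>
    using mult_left_mono[OF block_sum_bound[OF that], of "\<bar>\<tau>\<bar>"] by (simp flip: abs_mult)
  \<comment> \<open>Level sets of the conditional expectation lie in the sigma-algebra and differ
    from those of the block sum by a null set, so they may replace them in all
    probabilities.\<close>
  have adapted: "\<exists>E \<in> sigma_process M X I. AE \<omega> in M. (b < exp (\<tau> * block_sum \<phi> D \<omega>)) = (\<omega> \<in> E)"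
    if "time_set D" "D \<subseteq> I" "I \<subseteq> {0..}" for D I b
  proof
    let ?E = "{\<omega> \<in> space (past I). b < exp (\<tau> * real_cond_exp M (past I) (block_sum \<phi> D) \<omega>)}"
    show "?E \<in> sigma_process M X I" unfolding sets_past[symmetric] by measurable
    show "AE \<omega> in M. (b < exp (\<tau> * block_sum \<phi> D \<omega>)) = (\<omega> \<in> ?E)"
      using block_sum_adapted[OF that] AE_space by eventually_elim (simp add: space_past)
  qed
  have "\<bar>expectation (\<lambda>\<omega>. exp (\<tau> * block_sum \<phi> A \<omega>) * exp (\<tau> * block_sum \<phi> B \<omega>))
     - expectation (\<lambda>\<omega>. exp (\<tau> * block_sum \<phi> A \<omega>)) * expectation (\<lambda>\<omega>. exp (\<tau> * block_sum \<phi> B \<omega>))\<bar>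
    \<le> exp (- c * q) * exp (\<bar>\<tau>\<bar> * (m * len A)) * exp (\<bar>\<tau>\<bar> * (m * len B))"
  proof (rule covariance_mixing_bound)
    fix a b
    obtain E where E: "E \<in> sigma_process M X {0..r}" "AE \<omega> in M. (a < exp (\<tau> * block_sum \<phi> A \<omega>)) = (\<omega> \<in> E)"
      using adapted[OF A A_r, of a] by auto
    obtain F where F: "F \<in> sigma_process M X {r + q..}" "AE \<omega> in M. (b < exp (\<tau> * block_sum \<phi> B \<omega>)) = (\<omega> \<in> F)"
      using adapted[OF B, of "{r + q..}" b] AB r q by auto
    have EM: "E \<in> sets M"
      using E(1) subalgebra_past[of "{0..r}"] unfolding subalgebra_def sets_past by auto
    have FM: "F \<in> sets M"
      using F(1) subalgebra_past[of "{r + q..}"] r q unfolding subalgebra_def sets_past by auto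
    let ?A = "{\<omega> \<in> space M. a < exp (\<tau> * block_sum \<phi> A \<omega>)}" and ?B = "{\<omega> \<in> space M. b < exp (\<tau> * block_sum \<phi> B \<omega>)}"
    have "prob ?A = prob E" using E(2) EM by (intro finite_measure_eq_AE) auto
    moreover have "prob ?B = prob F" using F(2) FM by (intro finite_measure_eq_AE) auto
    moreover have "prob (?A \<inter> ?B) = prob (E \<inter> F)"
      using E(2) F(2) EM FM by (intro finite_measure_eq_AE) auto
    ultimately show "\<bar>prob (?A \<inter> ?B) - prob ?A * prob ?B\<bar> \<le> exp (- c * q)"
      using mixing_events[OF E(1) F(1) r q] by simp
  qed (use bound A B in auto)
  also have "\<dots> = exp (- c * q) * exp (\<bar>\<tau>\<bar> * m * (len A + len B))"
    by (simp add: algebra_simps flip: exp_add)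
  finally show ?thesis .
qed

lemma block_process_block_sum:
  assumes V: "0 \<le> V" "\<And>A. time_set A \<Longrightarrow> expectation (\<lambda>\<omega>. (block_sum \<phi> A \<omega>)\<^sup>2) \<le> V * len A"
  shows "block_process M (block_sum \<phi>) m c V"
  by unfold_locales
     (simp_all add: block_sum_rv block_sum_bound block_sum_Un block_sum_mean V m_ge_0 c_pos block_sum_decouple[simplified])

lemma block_sum_square:
  assumes A: "time_set A"
  shows "expectation (\<lambda>\<omega>. (block_sum \<phi> A \<omega>)\<^sup>2)
      = (LINT s|lborel. indicator A s * (LINT t|lborel. indicator A t * expectation (\<lambda>\<omega>. centered \<phi> s \<omega> * centered \<phi> t \<omega>)))"
    and "integrable lborel (\<lambda>s. indicator A s * (LINT t|lborel. indicator A t * expectation (\<lambda>\<omega>. centered \<phi> s \<omega> * centered \<phi> t \<omega>)))"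
    and "\<And>s. integrable lborel (\<lambda>t. indicator A t * expectation (\<lambda>\<omega>. centered \<phi> s \<omega> * centered \<phi> t \<omega>))"
proof -
  have inner: "expectation (\<lambda>\<omega>. centered \<phi> s \<omega> * block_sum \<phi> A \<omega>)
      = (LINT t|lborel. indicator A t * expectation (\<lambda>\<omega>. centered \<phi> s \<omega> * centered \<phi> t \<omega>))" for s
    using block_sum_fubini(1)[OF A centered_rv centered_bound] by (simp add: mult.commute)
  show "integrable lborel (\<lambda>t. indicator A t * expectation (\<lambda>\<omega>. centered \<phi> s \<omega> * centered \<phi> t \<omega>))" for s
    using block_sum_fubini(2)[OF A centered_rv[of s] centered_bound[of s]]
    by (simp only: mult.commute[of "centered \<phi> s w" for w])
  show "expectation (\<lambda>\<omega>. (block_sum \<phi> A \<omega>)\<^sup>2)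
      = (LINT s|lborel. indicator A s * (LINT t|lborel. indicator A t * expectation (\<lambda>\<omega>. centered \<phi> s \<omega> * centered \<phi> t \<omega>)))"
    using block_sum_fubini(1)[OF A block_sum_rv[OF A] block_sum_bound[OF A]] by (simp add: inner power2_eq_square)
  show "integrable lborel (\<lambda>s. indicator A s * (LINT t|lborel. indicator A t * expectation (\<lambda>\<omega>. centered \<phi> s \<omega> * centered \<phi> t \<omega>)))"
    using block_sum_fubini(2)[OF A block_sum_rv[OF A] block_sum_bound[OF A]] by (simp add: inner)
qed

end

end

section \<open>Covariances of rescaled kernels\<close>

text \<open>A shift by less than \<open>w\<close> can leave an interval only near one of its ends.
  The exceptional starting points therefore have measure at most \<open>2 * w\<close>, whatever the
  length of the interval.\<close>

lemma interval_boundary_layer: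
  fixes A :: "real set"
  assumes A: "is_interval A" "bounded A" and s: "s \<in> A" "s + u \<notin> A" "\<bar>u\<bar> < w"
  shows "s \<in> {Inf A..Inf A + w} \<union> {Sup A - w..Sup A}"
proof -
  have bd: "bdd_above A" "bdd_below A" using A(2) bounded_imp_bdd_above bounded_imp_bdd_below by auto
  have lo: "Inf A \<le> s" and hi: "s \<le> Sup A" using s bd by (auto intro: cInf_lower cSup_upper)
  have conv: "z \<in> A" if "x \<in> A" "y \<in> A" "x \<le> z" "z \<le> y" for x y z
    using A(1) that unfolding is_interval_1 by blast
  show ?thesis
  proof (cases "0 \<le> u")
    case True
    have "Sup A \<le> s + u"
    proof (rule cSup_least)
      fix y assume "y \<in> A"
      then show "y \<le> s + u" using s conv[of s y "s + u"] True by linarith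
    qed (use s in auto)
    then show ?thesis using s hi by auto
  next
    case False
    have "s + u \<le> Inf A"
    proof (rule cInf_greatest)
      fix y assume "y \<in> A"
      then show "s + u \<le> y" using s conv[of y s "s + u"] False by linarith
    qed (use s in auto)
    then show ?thesis using s lo by auto
  qed
qed

text \<open>Nothing is assumed about \<open>C\<close> at \<open>t = s\<close>, where no joint
  density exists; the single point is a null set and translation does the rest.\<close>

lemma double_integral_shift_kernel:
  fixes r :: "real \<Rightarrow> real"
  assumes A: "A \<in> sets borel" and r: "integrable lborel r"
    and C: "\<And>t. t \<in> A \<Longrightarrow> t \<noteq> s \<Longrightarrow> C t = r (t - s)"
    and int: "integrable lborel (\<lambda>t. indicator A t * C t)"
  shows "(LINT t|lborel. indicator A t * C t) = (LINT u|lborel. indicator A (s + u) * r u)"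
    and "integrable lborel (\<lambda>u. indicator A (s + u) * r u)"
proof -
  have [measurable]: "A \<in> sets borel" "r \<in> borel_measurable borel" using A r by auto
  have "(LINT t|lborel. indicator A t * C t) = (LINT t|lborel. indicator A t * r (t - s))"
  proof (rule integral_cong_AE)
    show "AE t in lborel. indicator A t * C t = indicator A t * r (t - s)"
      using AE_lborel_singleton[of s] by eventually_elim (auto simp: indicator_def C)
  qed (use int in \<open>auto dest: borel_measurable_integrable\<close>)
  also have "\<dots> = (LINT u|lborel. indicator A (s + u) * r u)"
    using lborel_integral_real_affine[of 1 "\<lambda>t. indicator A t * r (t - s)" s] by simp
  finally show "(LINT t|lborel. indicator A t * C t) = (LINT u|lborel. indicator A (s + u) * r u)" .
  show "integrable lborel (\<lambda>u. indicator A (s + u) * r u)"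
    by (rule Bochner_Integration.integrable_bound[OF r]) (auto simp: indicator_def)
qed

text \<open>Seen from a point of \<open>A\<close> that is at least \<open>w\<close> away from the
  ends, the inner integral covers almost the whole line. The three errors are the L1 distance of
  \<open>r\<close> to \<open>\<gamma>\<close>, the tail of \<open>\<gamma>\<close> beyond
  \<open>w\<close>, and the two boundary layers. Only the last is not proportional to
  \<open>len A\<close>, and it becomes negligible on long intervals.\<close>

lemma double_integral_interval:
  fixes r \<gamma> :: "real \<Rightarrow> real" and C :: "real \<Rightarrow> real \<Rightarrow> real"
  assumes A: "time_set A" "is_interval A" and w: "0 < w"
    and r: "integrable lborel r" and \<gamma>: "integrable lborel \<gamma>"
    and C: "\<And>s t. s \<in> A \<Longrightarrow> t \<in> A \<Longrightarrow> t \<noteq> s \<Longrightarrow> C s t = r (t - s)"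
    and int1: "\<And>s. integrable lborel (\<lambda>t. indicator A t * C s t)"
    and int2: "integrable lborel (\<lambda>s. indicator A s * (LINT t|lborel. indicator A t * C s t))"
  shows "\<bar>(LINT s|lborel. indicator A s * (LINT t|lborel. indicator A t * C s t)) - (LINT u|lborel. \<gamma> u) * len A\<bar>
     \<le> ((LINT u|lborel. \<bar>r u - \<gamma> u\<bar>) + (LINT u|lborel. indicator {u. w \<le> \<bar>u\<bar>} u * \<bar>\<gamma> u\<bar>)) * len A
        + 2 * w * (LINT u|lborel. \<bar>\<gamma> u\<bar>)"
proof -
  have [measurable]: "A \<in> sets borel" "r \<in> borel_measurable borel" "\<gamma> \<in> borel_measurable borel"
    using A r \<gamma> by (auto simp: time_set_def)
  have finA: "emeasure lborel A < \<infinity>" using A unfolding time_set_def by (intro emeasure_bounded_finite) simp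
  define J where "J s = (LINT t|lborel. indicator A t * C s t)" for s
  define D where "D = (LINT u|lborel. \<bar>r u - \<gamma> u\<bar>)"
  define \<tau> where "\<tau> = (LINT u|lborel. indicator {u. w \<le> \<bar>u\<bar>} u * \<bar>\<gamma> u\<bar>)"
  define N where "N = (LINT u|lborel. \<bar>\<gamma> u\<bar>)"
  have N0: "0 \<le> N" and \<tau>0: "0 \<le> \<tau>" by (auto simp: N_def \<tau>_def)
  define E where "E = {Inf A..Inf A + w} \<union> {Sup A - w..Sup A}"
  have [measurable]: "E \<in> sets borel" by (simp add: E_def)
  have finE: "emeasure lborel E < \<infinity>" unfolding E_def by (intro emeasure_bounded_finite) auto
  have lenE: "len E \<le> 2 * w"
  proof -
    have "len E \<le> len {Inf A..Inf A + w} + len {Sup A - w..Sup A}"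
      unfolding E_def by (intro measure_Un_le) auto
    then show ?thesis using w by simp
  qed
  have dom: "integrable lborel (\<lambda>u. indicator B u * \<bar>\<gamma> u\<bar>)" if [measurable]: "B \<in> sets borel" for B
    by (rule Bochner_Integration.integrable_bound[OF \<gamma>]) (auto simp: indicator_def)
  have bound: "\<bar>indicator A s * (J s - (LINT u|lborel. \<gamma> u))\<bar> \<le> (D + \<tau>) * indicator A s + N * indicator E s" for s
  proof (cases "s \<in> A")
    case True
    have J: "J s = (LINT u|lborel. indicator A (s + u) * r u)"
      and Jint: "integrable lborel (\<lambda>u. indicator A (s + u) * r u)"
      unfolding J_def using double_integral_shift_kernel[OF _ r, of A s "C s"] C[OF True] int1 by auto
    define B where "B = {u. s + u \<notin> A}"
    have [measurable]: "B \<in> sets borel" unfolding B_def by measurable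
    have "\<bar>J s - (LINT u|lborel. \<gamma> u)\<bar> = \<bar>LINT u|lborel. indicator A (s + u) * r u - \<gamma> u\<bar>"
      unfolding J using Jint \<gamma> by simp
    also have "\<dots> \<le> (LINT u|lborel. \<bar>r u - \<gamma> u\<bar> + indicator B u * \<bar>\<gamma> u\<bar>)"
      using Jint \<gamma> r dom[of B]
      by (intro integral_abs_bound_integral Bochner_Integration.integrable_add integrable_abs
            Bochner_Integration.integrable_diff) (auto simp: B_def indicator_def)
    also have "\<dots> = D + (LINT u|lborel. indicator B u * \<bar>\<gamma> u\<bar>)"
      unfolding D_def using r \<gamma> dom[of B] by (intro Bochner_Integration.integral_add) auto
    finally have 1: "\<bar>J s - (LINT u|lborel. \<gamma> u)\<bar> \<le> D + (LINT u|lborel. indicator B u * \<bar>\<gamma> u\<bar>)" .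
    \<comment> \<open>\<open>B\<close> holds the lags that lead out of \<open>A\<close>. Outside the
      boundary layer \<open>E\<close> they all exceed \<open>w\<close> in modulus; inside it the
      whole mass \<open>N\<close> is conceded.\<close>
    have "(LINT u|lborel. indicator B u * \<bar>\<gamma> u\<bar>) \<le> \<tau> + N * indicator E s"
    proof (cases "s \<in> E")
      case True
      have "(LINT u|lborel. indicator B u * \<bar>\<gamma> u\<bar>) \<le> N"
        unfolding N_def using dom[of B] \<gamma> by (intro integral_mono) (auto simp: indicator_def)
      then show ?thesis using True \<tau>0 by simp
    next
      case False
      have "w \<le> \<bar>u\<bar>" if "u \<in> B" for u
      proof (rule ccontr)
        assume "\<not> w \<le> \<bar>u\<bar>"
        then show False
          using interval_boundary_layer[OF A(2) _ True, of u w] that False A(1)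
          by (auto simp: B_def E_def time_set_def)
      qed
      then have "(LINT u|lborel. indicator B u * \<bar>\<gamma> u\<bar>) \<le> \<tau>"
        unfolding \<tau>_def using dom[of B] dom[of "{u. w \<le> \<bar>u\<bar>}"] by (intro integral_mono) (auto simp: indicator_def)
      then show ?thesis using N0 by (auto simp: indicator_def)
    qed
    then show ?thesis using 1 True by simp
  next
    case False
    then show ?thesis using N0 by (simp add: indicator_def)
  qed
  have intA: "integrable lborel (indicator A :: real \<Rightarrow> real)" "integrable lborel (indicator E :: real \<Rightarrow> real)"
    using finA finE by (auto intro: integrable_real_indicator)
  have int3: "integrable lborel (\<lambda>s. indicator A s * (J s - (LINT u|lborel. \<gamma> u)))"
    unfolding right_diff_distrib using int2 intA(1)
    by (intro Bochner_Integration.integrable_diff integrable_mult_left) (auto simp: J_def)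
  have "(LINT s|lborel. indicator A s * J s) - (LINT u|lborel. \<gamma> u) * len A
      = (LINT s|lborel. indicator A s * (J s - (LINT u|lborel. \<gamma> u)))"
    unfolding right_diff_distrib using int2 intA(1)
    by (subst Bochner_Integration.integral_diff) (auto simp: J_def mult.commute)
  also have "\<bar>\<dots>\<bar> \<le> (LINT s|lborel. (D + \<tau>) * indicator A s + N * indicator E s)"
    using bound int3 intA by (intro integral_abs_bound_integral) auto
  also have "\<dots> = (D + \<tau>) * len A + N * len E" using intA by simp
  also have "\<dots> \<le> (D + \<tau>) * len A + N * (2 * w)"
    using lenE N0 by (intro add_left_mono mult_left_mono) auto
  finally show ?thesis by (simp add: J_def D_def \<tau>_def N_def mult_ac)
qed

text \<open>For scattered sets there is no boundary layer argument, but the dominating function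
  still gives an upper bound. It supplies the constant \<open>V\<close> of
  \<open>block_process\<close>, the same for all \<open>T\<close>.\<close>

lemma double_integral_upper:
  fixes r H :: "real \<Rightarrow> real" and C :: "real \<Rightarrow> real \<Rightarrow> real"
  assumes A: "time_set A" and r: "integrable lborel r"
    and H: "integrable lborel H" "AE u in lborel. \<bar>r u\<bar> \<le> H u"
    and C: "\<And>s t. s \<in> A \<Longrightarrow> t \<in> A \<Longrightarrow> t \<noteq> s \<Longrightarrow> C s t = r (t - s)"
    and int1: "\<And>s. integrable lborel (\<lambda>t. indicator A t * C s t)"
    and int2: "integrable lborel (\<lambda>s. indicator A s * (LINT t|lborel. indicator A t * C s t))"
  shows "(LINT s|lborel. indicator A s * (LINT t|lborel. indicator A t * C s t)) \<le> (LINT u|lborel. H u) * len A"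
proof -
  have [measurable]: "A \<in> sets borel" using A by (auto simp: time_set_def)
  have finA: "emeasure lborel A < \<infinity>" using A unfolding time_set_def by (intro emeasure_bounded_finite) simp
  have intA: "integrable lborel (indicator A :: real \<Rightarrow> real)"
    using finA by (auto intro: integrable_real_indicator)
  have "indicator A s * (LINT t|lborel. indicator A t * C s t) \<le> (LINT u|lborel. H u) * indicator A s" for s
  proof (cases "s \<in> A")
    case True
    have J: "(LINT t|lborel. indicator A t * C s t) = (LINT u|lborel. indicator A (s + u) * r u)"
      and Jint: "integrable lborel (\<lambda>u. indicator A (s + u) * r u)"
      using double_integral_shift_kernel[OF _ r, of A s "C s"] C[OF True] int1 by auto
    have "(LINT u|lborel. indicator A (s + u) * r u) \<le> (LINT u|lborel. H u)"
    proof (rule integral_mono_AE[OF Jint H(1)])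
      show "AE u in lborel. indicator A (s + u) * r u \<le> H u"
        using H(2) by eventually_elim (auto simp: indicator_def)
    qed
    then show ?thesis using True J by simp
  qed simp
  then have "(LINT s|lborel. indicator A s * (LINT t|lborel. indicator A t * C s t))
      \<le> (LINT s|lborel. (LINT u|lborel. H u) * indicator A s)"
    using intA by (intro integral_mono int2) auto
  then show ?thesis by simp
qed

lemma product_kernel:
  fixes K :: "real \<Rightarrow> real"
  assumes K: "integrable lborel K"
  shows "integrable lborel (\<lambda>q. K (fst q) * K (snd q))"
    and "(LINT q|lborel. K (fst q) * K (snd q)) = (LINT u|lborel. K u) * (LINT u|lborel. K u)"
proof -
  have [measurable]: "K \<in> borel_measurable borel" using K by auto
  have int: "integrable (lborel \<Otimes>\<^sub>M lborel) (\<lambda>q. K (fst q) * K (snd q))"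
  proof (rule lborel_pair.Fubini_integrable)
    have "integrable lborel (\<lambda>x. \<bar>K x\<bar> * (LINT y|lborel. \<bar>K y\<bar>))" using K by simp
    then show "integrable lborel (\<lambda>x. LINT y|lborel. norm (K (fst (x, y)) * K (snd (x, y))))"
      by (simp add: abs_mult)
  qed (use K in auto)
  then show "integrable lborel (\<lambda>q. K (fst q) * K (snd q))" by (simp add: lborel_prod)
  show "(LINT q|lborel. K (fst q) * K (snd q)) = (LINT u|lborel. K u) * (LINT u|lborel. K u)"
    using lborel_pair.integral_fst'[OF int] by (simp add: lborel_prod)
qed

section \<open>Autocovariances of rescaled kernels at small bandwidth\<close>

lemma lborel_integral_affine:
  fixes F :: "'a::euclidean_space \<Rightarrow> real"
  assumes [measurable]: "F \<in> borel_measurable borel" and "c \<noteq> 0"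
  shows "(LINT p|lborel. F p) = \<bar>c\<bar> ^ DIM('a) * (LINT q|lborel. F (t + c *\<^sub>R q))"
  by (subst lborel_affine[OF assms(2), of t]) (simp add: integral_density integral_distr)

definition rescale :: "(real \<Rightarrow> real) \<Rightarrow> real \<Rightarrow> real \<Rightarrow> real \<Rightarrow> real" where
  "rescale K h x y = K ((x - y) / h) / h"

lemma rescale_meas:
  assumes [measurable]: "K \<in> borel_measurable borel"
  shows "rescale K h x \<in> borel_measurable borel"
  unfolding rescale_def[abs_def] by measurable

lemma rescale_bound:
  assumes "\<And>y. 0 \<le> K y" "\<And>y. K y \<le> \<kappa>" "0 < h"
  shows "0 \<le> rescale K h x y" "rescale K h x y \<le> \<kappa> / h"
  using assms by (auto simp: rescale_def divide_right_mono)

locale joint_density_process = mixing_density_process M X f c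
  for M :: "'a measure" and X :: "real \<Rightarrow> 'a \<Rightarrow> real" and f :: "real \<Rightarrow> real" and c :: real +
  fixes f2 :: "real \<Rightarrow> real \<Rightarrow> real \<times> real \<Rightarrow> real"
  assumes f2_nonneg: "\<And>s t p. 0 \<le> s \<Longrightarrow> 0 \<le> t \<Longrightarrow> s \<noteq> t \<Longrightarrow> 0 \<le> f2 s t p"
    and f2_dens: "\<And>s t. 0 \<le> s \<Longrightarrow> 0 \<le> t \<Longrightarrow> s \<noteq> t \<Longrightarrow>
           distributed M (lborel \<Otimes>\<^sub>M lborel) (\<lambda>\<omega>. (X s \<omega>, X t \<omega>)) (\<lambda>p. ennreal (f2 s t p))"
    and f2_stat: "\<And>s t. 0 \<le> s \<Longrightarrow> 0 \<le> t \<Longrightarrow> s \<noteq> t \<Longrightarrow> f2 s t = f2 0 \<bar>t - s\<bar>"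
begin

definition g :: "real \<Rightarrow> real \<times> real \<Rightarrow> real" where
  "g u p = f2 0 u p - f (fst p) * f (snd p)"

lemma f_meas [measurable]: "f \<in> borel_measurable borel"
  using distributed_real_measurable[OF _ f_dens[of 0]] f_nonneg by simp

lemma f2_meas: "0 < u \<Longrightarrow> f2 0 u \<in> borel_measurable borel"
  using distributed_real_measurable[OF _ f2_dens[of 0 u]] f2_nonneg[of 0 u] by (simp add: lborel_prod)

lemma g_meas: "0 < u \<Longrightarrow> g u \<in> borel_measurable borel"
  using f2_meas[of u] unfolding g_def[abs_def]
  by (intro borel_measurable_diff borel_measurable_times measurable_compose[OF _ f_meas])
     (auto simp: borel_prod[symmetric])

definition autocov :: "(real \<Rightarrow> real) \<Rightarrow> real \<Rightarrow> real" where
  "autocov \<phi> u = expectation (\<lambda>\<omega>. centered \<phi> 0 \<omega> * centered \<phi> \<bar>u\<bar> \<omega>)"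

context
  fixes \<phi> :: "real \<Rightarrow> real" and m :: real
  assumes \<phi>_meas [measurable]: "\<phi> \<in> borel_measurable borel" and \<phi>_bound: "\<And>y. 0 \<le> \<phi> y" "\<And>y. \<phi> y \<le> m"
begin

lemma autocov_meas: "autocov \<phi> \<in> borel_measurable borel"
proof -
  note [measurable] = centered_joint[OF \<phi>_meas \<phi>_bound] centered_rv[OF \<phi>_meas \<phi>_bound]
  have 1: "(\<lambda>p. (\<bar>fst p\<bar> :: real, snd p)) \<in> (lborel \<Otimes>\<^sub>M M) \<rightarrow>\<^sub>M (lborel \<Otimes>\<^sub>M M)" by measurable
  have "(\<lambda>p. centered \<phi> \<bar>fst p\<bar> (snd p)) \<in> borel_measurable (lborel \<Otimes>\<^sub>M M)"
    using measurable_compose[OF 1 centered_joint[OF \<phi>_meas \<phi>_bound]] by simp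
  then have "(\<lambda>(u, \<omega>). centered \<phi> 0 \<omega> * centered \<phi> \<bar>u\<bar> \<omega>) \<in> borel_measurable (lborel \<Otimes>\<^sub>M M)"
    unfolding split_beta by measurable
  from borel_measurable_lebesgue_integral[OF this] show ?thesis by (simp add: autocov_def[abs_def])
qed

lemma covariance_eq:
  assumes st: "0 \<le> s" "0 \<le> t" "s \<noteq> t"
  shows "expectation (\<lambda>\<omega>. centered \<phi> s \<omega> * centered \<phi> t \<omega>) = (LINT p|lborel. \<phi> (fst p) * \<phi> (snd p) * g \<bar>t - s\<bar> p)"
proof -
  note [measurable] = X_rv[OF st(1)] X_rv[OF st(2)]
  let ?Q = "\<lambda>p. \<phi> (fst p) * \<phi> (snd p)"
  have Qm: "?Q \<in> borel_measurable (lborel \<Otimes>\<^sub>M lborel)" by measurable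
  have Qb: "\<bar>?Q p\<bar> \<le> m * m" for p using \<phi>_bound by (auto simp: abs_mult intro!: mult_mono order_trans[OF \<phi>_bound(1) \<phi>_bound(2)])
  have intXX: "integrable M (\<lambda>\<omega>. ?Q (X s \<omega>, X t \<omega>))"
    using Qb[of "(X s w, X t w)" for w] by (intro integrable_const_bound[where B = "m * m"]) auto
  have f2int: "integrable (lborel \<Otimes>\<^sub>M lborel) (\<lambda>p. f2 s t p * ?Q p)"
    using distributed_integrable[OF f2_dens[OF st] Qm] f2_nonneg[OF st] intXX by simp
  have f2eq: "(LINT p|(lborel \<Otimes>\<^sub>M lborel). f2 s t p * ?Q p) = expectation (\<lambda>\<omega>. \<phi> (X s \<omega>) * \<phi> (X t \<omega>))"
    using distributed_integral[OF f2_dens[OF st] Qm] f2_nonneg[OF st] by simp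
  have fint: "integrable lborel (\<lambda>y. f y * \<phi> y)"
    using distributed_integrable[OF f_dens[of 0], of \<phi>] f_nonneg \<phi>_integrable[OF \<phi>_meas \<phi>_bound, of 0] by simp
  have ints: "integrable M (\<lambda>\<omega>. \<phi> (X s \<omega>))" "integrable M (\<lambda>\<omega>. \<phi> (X t \<omega>))"
    using \<phi>_integrable[OF \<phi>_meas \<phi>_bound] st by auto
  have means: "expectation (\<lambda>\<omega>. \<phi> (X s \<omega>)) = mean \<phi>" "expectation (\<lambda>\<omega>. \<phi> (X t \<omega>)) = mean \<phi>"
    using expectation_\<phi>[OF \<phi>_meas \<phi>_bound] st by auto
  have "expectation (\<lambda>\<omega>. centered \<phi> s \<omega> * centered \<phi> t \<omega>)
      = expectation (\<lambda>\<omega>. \<phi> (X s \<omega>) * \<phi> (X t \<omega>) - mean \<phi> * \<phi> (X s \<omega>) - mean \<phi> * \<phi> (X t \<omega>) + mean \<phi> * mean \<phi>)"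
    using st by (intro Bochner_Integration.integral_cong) (auto simp: centered_def algebra_simps max_def)
  also have "\<dots> = expectation (\<lambda>\<omega>. \<phi> (X s \<omega>) * \<phi> (X t \<omega>)) - mean \<phi> * mean \<phi>"
    using intXX ints means by (simp add: prob_space)
  also have "mean \<phi> * mean \<phi> = (LINT p|lborel. (f (fst p) * \<phi> (fst p)) * (f (snd p) * \<phi> (snd p)))"
    unfolding mean_def using product_kernel(2)[OF fint] by simp
  also have "expectation (\<lambda>\<omega>. \<phi> (X s \<omega>) * \<phi> (X t \<omega>)) = (LINT p|lborel. f2 s t p * ?Q p)"
    using f2eq by (simp add: lborel_prod)
  also have "(LINT p|lborel. f2 s t p * ?Q p) - (LINT p|lborel. (f (fst p) * \<phi> (fst p)) * (f (snd p) * \<phi> (snd p)))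
      = (LINT p|lborel. f2 s t p * ?Q p - (f (fst p) * \<phi> (fst p)) * (f (snd p) * \<phi> (snd p)))"
    using f2int product_kernel(1)[OF fint] by (simp add: lborel_prod)
  also have "\<dots> = (LINT p|lborel. \<phi> (fst p) * \<phi> (snd p) * g \<bar>t - s\<bar> p)"
    using f2_stat[OF st] by (intro Bochner_Integration.integral_cong) (auto simp: g_def algebra_simps)
  finally show ?thesis .
qed

lemma covariance_autocov:
  assumes "0 \<le> s" "0 \<le> t" "t \<noteq> s"
  shows "expectation (\<lambda>\<omega>. centered \<phi> s \<omega> * centered \<phi> t \<omega>) = autocov \<phi> (t - s)"
  using covariance_eq[of s t] covariance_eq[of 0 "\<bar>t - s\<bar>"] assms by (simp add: autocov_def)

end

context
  fixes K :: "real \<Rightarrow> real" and \<kappa> :: real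
  assumes K_meas [measurable]: "K \<in> borel_measurable borel" and K_bound: "\<And>y. 0 \<le> K y" "\<And>y. K y \<le> \<kappa>"
    and K_int: "integrable lborel K" and K_one: "(LINT u|lborel. K u) = 1"
begin

text \<open>The substitution \<open>p = (x, x) - h *\<^sub>R q\<close> has Jacobian
  \<open>h\<^sup>2\<close>, which cancels the two normalising factors \<open>1 / h\<close>.
  Covariances at nonzero lag thus stay bounded as the bandwidth shrinks, and this is why the
  estimator has the parametric rate \<open>sqrt T\<close>.\<close>

lemma autocov_rescale:
  assumes h: "0 < h" and u: "u \<noteq> 0"
  shows "autocov (rescale K h x) u = (LINT q|lborel. K (fst q) * K (snd q) * g \<bar>u\<bar> ((x, x) - h *\<^sub>R q))"
proof -
  have u': "0 < \<bar>u\<bar>" using u by simp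
  have "autocov (rescale K h x) u = (LINT p|lborel. rescale K h x (fst p) * rescale K h x (snd p) * g \<bar>u\<bar> p)"
    unfolding autocov_def using covariance_eq[OF rescale_meas[OF K_meas] rescale_bound[OF K_bound h], of 0 "\<bar>u\<bar>"] u by simp
  also have "\<dots> = \<bar>- h\<bar> ^ DIM(real \<times> real) * (LINT q|lborel. rescale K h x (fst ((x, x) + (- h) *\<^sub>R q))
      * rescale K h x (snd ((x, x) + (- h) *\<^sub>R q)) * g \<bar>u\<bar> ((x, x) + (- h) *\<^sub>R q))"
  proof (rule lborel_integral_affine)
    note [measurable] = g_meas[OF u'] rescale_meas[OF K_meas]
    show "(\<lambda>p. rescale K h x (fst p) * rescale K h x (snd p) * g \<bar>u\<bar> p) \<in> borel_measurable borel"
      by (intro borel_measurable_times measurable_compose[OF _ rescale_meas[OF K_meas]] g_meas[OF u'])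
         (auto simp: borel_prod[symmetric])
  qed (use h in simp)
  also have "\<dots> = (LINT q|lborel. h\<^sup>2 * (rescale K h x (fst ((x, x) + (- h) *\<^sub>R q))
      * rescale K h x (snd ((x, x) + (- h) *\<^sub>R q)) * g \<bar>u\<bar> ((x, x) + (- h) *\<^sub>R q)))"
    using h by (subst integral_mult_right_zero) (simp add: power2_eq_square)
  also have "\<dots> = (LINT q|lborel. K (fst q) * K (snd q) * g \<bar>u\<bar> ((x, x) - h *\<^sub>R q))"
    using h by (intro Bochner_Integration.integral_cong) (auto simp: rescale_def power2_eq_square)
  finally show ?thesis .
qed

lemma autocov_rescale_bound:
  assumes h: "0 < h" and u: "u \<noteq> 0" and H: "\<And>p. \<bar>g \<bar>u\<bar> p\<bar> \<le> B"
  shows "\<bar>autocov (rescale K h x) u\<bar> \<le> B"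
proof -
  let ?F = "\<lambda>q. K (fst q) * K (snd q) * g \<bar>u\<bar> ((x, x) - h *\<^sub>R q)"
  have KK: "integrable lborel (\<lambda>q. K (fst q) * K (snd q) * B)" using product_kernel(1)[OF K_int] by simp
  have B0: "0 \<le> B" using H[of "(x, x)"] by linarith
  have "\<bar>LINT q|lborel. ?F q\<bar> \<le> (LINT q|lborel. \<bar>?F q\<bar>)" by (rule integral_abs_bound)
  also have "\<dots> \<le> (LINT q|lborel. K (fst q) * K (snd q) * B)"
    using K_bound H B0 by (intro integral_mono' KK) (auto simp: abs_mult intro!: mult_left_mono)
  also have "\<dots> = B" using product_kernel(2)[OF K_int] K_one by simp
  finally show ?thesis unfolding autocov_rescale[OF h u] .
qed

text \<open>The products of kernel values form an approximate identity at \<open>(x, x)\<close>. The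
  bound \<open>B\<close> is requested only where both kernel factors are nonzero, so that for a
  compactly supported kernel a bound near \<open>(x, x)\<close> is enough.\<close>

lemma autocov_rescale_tendsto:
  fixes h :: "real \<Rightarrow> real"
  assumes h: "\<And>T. T > 0 \<Longrightarrow> 0 < h T" "(h \<longlongrightarrow> 0) at_top" and u: "u \<noteq> 0"
    and cont: "isCont (g \<bar>u\<bar>) (x, x)"
    and B: "\<forall>\<^sub>F T in at_top. \<forall>q. K (fst q) \<noteq> 0 \<longrightarrow> K (snd q) \<noteq> 0 \<longrightarrow> \<bar>g \<bar>u\<bar> ((x, x) - h T *\<^sub>R q)\<bar> \<le> B"
  shows "((\<lambda>T. autocov (rescale K (h T) x) u) \<longlongrightarrow> g \<bar>u\<bar> (x, x)) at_top"
proof -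
  have u': "0 < \<bar>u\<bar>" using u by simp
  have KKm: "(\<lambda>q. K (fst q) * K (snd q)) \<in> borel_measurable lborel"
    using borel_measurable_integrable[OF product_kernel(1)[OF K_int]] .
  have lim: "((\<lambda>T. LINT q|lborel. K (fst q) * K (snd q) * g \<bar>u\<bar> ((x, x) - h T *\<^sub>R q)) \<longlongrightarrow>
      (LINT q|lborel. K (fst q) * K (snd q) * g \<bar>u\<bar> (x, x))) at_top"
  proof (rule integral_dominated_convergence_at_top)
    show "integrable lborel (\<lambda>q. K (fst q) * K (snd q) * B)" using product_kernel(1)[OF K_int] by simp
    show "\<forall>\<^sub>F T in at_top. AE q in lborel. norm (K (fst q) * K (snd q) * g \<bar>u\<bar> ((x, x) - h T *\<^sub>R q)) \<le> K (fst q) * K (snd q) * B"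
      using B
    proof eventually_elim
      case (elim T)
      show ?case
      proof (intro AE_I2)
        fix q
        show "norm (K (fst q) * K (snd q) * g \<bar>u\<bar> ((x, x) - h T *\<^sub>R q)) \<le> K (fst q) * K (snd q) * B"
        proof (cases "K (fst q) = 0 \<or> K (snd q) = 0")
          case False
          then have "K (fst q) * K (snd q) * \<bar>g \<bar>u\<bar> ((x, x) - h T *\<^sub>R q)\<bar> \<le> K (fst q) * K (snd q) * B"
            using elim[rule_format, of q] K_bound(1) by (intro mult_left_mono) auto
          then show ?thesis using K_bound(1) by (simp add: abs_mult)
        qed auto
      qed
    qed
    show "AE q in lborel. ((\<lambda>T. K (fst q) * K (snd q) * g \<bar>u\<bar> ((x, x) - h T *\<^sub>R q)) \<longlongrightarrow> K (fst q) * K (snd q) * g \<bar>u\<bar> (x, x)) at_top"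
    proof (intro AE_I2 tendsto_intros)
      fix q
      have "((\<lambda>T. (x, x) - h T *\<^sub>R q) \<longlongrightarrow> (x, x) - 0 *\<^sub>R q) at_top"
        by (intro tendsto_intros h(2))
      then show "((\<lambda>T. g \<bar>u\<bar> ((x, x) - h T *\<^sub>R q)) \<longlongrightarrow> g \<bar>u\<bar> (x, x)) at_top"
        using isCont_tendsto_compose[OF cont] by simp
    qed
    show "(\<lambda>q. K (fst q) * K (snd q) * g \<bar>u\<bar> ((x, x) - h T *\<^sub>R q)) \<in> borel_measurable lborel" for T
      by (intro borel_measurable_times KKm measurable_compose[OF _ g_meas[OF u']]) measurable
  qed (use KKm in simp)
  have eq: "(LINT q|lborel. K (fst q) * K (snd q) * g \<bar>u\<bar> (x, x)) = g \<bar>u\<bar> (x, x)"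
    using product_kernel(2)[OF K_int] K_one by simp
  have "\<forall>\<^sub>F T in at_top. (LINT q|lborel. K (fst q) * K (snd q) * g \<bar>u\<bar> ((x, x) - h T *\<^sub>R q)) = autocov (rescale K (h T) x) u"
    using eventually_gt_at_top[of 0] by eventually_elim (simp add: autocov_rescale[OF h(1) u])
  from Lim_transform_eventually[OF lim this] show ?thesis unfolding eq .
qed

end

end

section \<open>The kernel density estimator\<close>

lemma AE_lborel_uminus:
  fixes P :: "real \<Rightarrow> bool"
  assumes "AE u in lborel. P u"
  shows "AE u in lborel. P (- u)"
proof -
  obtain N where "{u \<in> space lborel. \<not> P u} \<subseteq> N" "emeasure lborel N = 0" "N \<in> sets lborel"
    using AE_E[OF assms] .
  then have N: "N \<in> null_sets lborel" "{u \<in> space lborel. \<not> P u} \<subseteq> N"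
    by (auto intro: null_setsI)
  have [measurable]: "N \<in> sets borel" using N(1) by auto
  have "AE u in lborel. 0 + (- 1) * u \<notin> N"
    using AE_not_in[OF N(1)] by (intro AE_borel_affine[of "-1" "\<lambda>u. u \<notin> N" 0]) auto
  then show ?thesis by eventually_elim (use N(2) in auto)
qed

lemma integrable_uminus_lborel:
  fixes r :: "real \<Rightarrow> real"
  shows "integrable lborel r \<Longrightarrow> integrable lborel (\<lambda>u. r (- u))"
  using lborel_integrable_real_affine[of r "-1" 0] by simp

text \<open>A supremum over uncountably many points need only be Lebesgue measurable, so an almost
  everywhere equal Borel function takes its place. Adding the reflection covers negative
  lags.\<close>

lemma even_dominating_function:
  fixes g :: "real \<Rightarrow> 'b \<Rightarrow> real"
  assumes meas: "(\<lambda>u. SUP p. ennreal \<bar>g u p\<bar>) \<in> borel_measurable (lebesgue_on {0<..})"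
    and int: "(\<integral>\<^sup>+ u. (SUP p. ennreal \<bar>g u p\<bar>) \<partial>lebesgue_on {0<..}) < \<infinity>"
  obtains H where "integrable lborel H" "\<And>u. 0 \<le> H u"
    "AE u in lborel. u \<noteq> 0 \<longrightarrow> (\<forall>p. \<bar>g \<bar>u\<bar> p\<bar> \<le> H u)"
proof -
  define S where "S u = (SUP p. ennreal \<bar>g u p\<bar>) * indicator {0<..} u" for u
  have "S \<in> borel_measurable (completion lborel)"
    using meas unfolding S_def by (subst (asm) borel_measurable_restrict_space_iff_ennreal) auto
  then obtain G where G [measurable]: "G \<in> borel_measurable lborel" and SG: "AE u in lborel. S u = G u"
    using completion_ex_borel_measurable by blast
  have "(\<integral>\<^sup>+ u. G u \<partial>lborel) = (\<integral>\<^sup>+ u. S u \<partial>lborel)"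
    using SG by (intro nn_integral_cong_AE) auto
  also have "\<dots> = (\<integral>\<^sup>+ u. S u \<partial>lebesgue)" by (rule nn_integral_completion[symmetric])
  also have "\<dots> < \<infinity>"
    using int unfolding S_def by (subst (asm) nn_integral_restrict_space) auto
  finally have Gfin: "(\<integral>\<^sup>+ u. G u \<partial>lborel) < \<infinity>" .
  then have GAE: "AE u in lborel. G u \<noteq> \<infinity>" by (intro nn_integral_noteq_infinite) auto
  define H0 where "H0 u = enn2real (G u)" for u
  have "(\<integral>\<^sup>+ u. ennreal (H0 u) \<partial>lborel) = (\<integral>\<^sup>+ u. G u \<partial>lborel)"
  proof (rule nn_integral_cong_AE)
    show "AE u in lborel. ennreal (H0 u) = G u"
      using GAE by eventually_elim (simp add: H0_def less_top)
  qed
  then have H0: "integrable lborel H0"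
    using Gfin by (intro integrableI_nonneg) (auto simp: H0_def[abs_def])
  have pos: "AE u in lborel. 0 < u \<longrightarrow> (\<forall>p. \<bar>g u p\<bar> \<le> H0 u)"
    using SG GAE
  proof eventually_elim
    case (elim u)
    show ?case
    proof (intro impI allI)
      fix p assume "0 < u"
      have "ennreal \<bar>g u p\<bar> \<le> (SUP p. ennreal \<bar>g u p\<bar>)" by (rule SUP_upper) simp
      also have "\<dots> = G u" using elim(1) \<open>0 < u\<close> by (simp add: S_def)
      also have "G u = ennreal (H0 u)" using elim by (simp add: H0_def less_top)
      finally show "\<bar>g u p\<bar> \<le> H0 u" by (simp add: H0_def)
    qed
  qed
  show ?thesis
  proof (rule that[of "\<lambda>u. H0 u + H0 (- u)"])
    show "integrable lborel (\<lambda>u. H0 u + H0 (- u))"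
      using H0 integrable_uminus_lborel[OF H0] by simp
    show "0 \<le> H0 u + H0 (- u)" for u by (simp add: H0_def)
    show "AE u in lborel. u \<noteq> 0 \<longrightarrow> (\<forall>p. \<bar>g \<bar>u\<bar> p\<bar> \<le> H0 u + H0 (- u))"
      using pos AE_lborel_uminus[OF pos]
    proof eventually_elim
      case (elim u)
      have "0 \<le> H0 u" "0 \<le> H0 (- u)" by (auto simp: H0_def)
      then show ?case using elim by (cases "0 < u") (auto simp: add_increasing add_increasing2 abs_if)
    qed
  qed
qed

context joint_density_process
begin

text \<open>The diagonal extended evenly to negative lags, so that its integral over the line is
  twice the integral in the rate function. The value 0 at lag 0, where there is no joint density, is
  a convention.\<close>

definition g_diag :: "real \<Rightarrow> real \<Rightarrow> real" where
  "g_diag x u = (if u = 0 then 0 else g \<bar>u\<bar> (x, x))"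

text \<open>Only the supremum of \<open>\<bar>g u\<bar>\<close> is assumed to be measurable in \<open>u\<close>; the diagonal values
  inherit Borel measurability as limits of covariances of indicators of small intervals.\<close>

lemma g_diag_meas:
  assumes cont: "\<And>u. 0 < u \<Longrightarrow> isCont (g u) (x, x)"
  shows "g_diag x \<in> borel_measurable borel"
proof -
  \<comment> \<open>A box kernel: its compact support lets continuity at \<open>(x, x)\<close> alone
    provide the dominating constant, for one \<open>u\<close> at a time.\<close>
  define B :: "real \<Rightarrow> real" where "B u = indicator {-1..1} u / 2" for u
  have B_meas: "B \<in> borel_measurable borel" unfolding B_def[abs_def] by measurable
  have B_bound: "0 \<le> B y" "B y \<le> 1 / 2" for y by (auto simp: B_def indicator_def)
  have "emeasure lborel {-1..1::real} < \<infinity>" by (intro emeasure_bounded_finite) auto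
  then have B_int: "integrable lborel B" unfolding B_def[abs_def]
    by (intro integrable_divide integrable_real_indicator) auto
  have B_one: "(LINT u|lborel. B u) = 1" unfolding B_def by simp
  define h :: "real \<Rightarrow> real" where "h T = inverse T" for T
  have h: "0 < h T" if "0 < T" for T using that by (simp add: h_def)
  have h_lim: "(h \<longlongrightarrow> 0) at_top" unfolding h_def by (rule tendsto_inverse_0_at_top) (rule filterlim_ident)
  have lim: "((\<lambda>T. autocov (rescale B (h T) x) u) \<longlongrightarrow> g \<bar>u\<bar> (x, x)) at_top" if u: "u \<noteq> 0" for u
  proof (rule autocov_rescale_tendsto[OF B_meas B_bound B_int B_one h h_lim u])
    have c: "isCont (g \<bar>u\<bar>) (x, x)" using cont[of "\<bar>u\<bar>"] u by simp
    then show "isCont (g \<bar>u\<bar>) (x, x)" .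
    obtain d where d: "0 < d" "\<And>p. dist p (x, x) < d \<Longrightarrow> dist (g \<bar>u\<bar> p) (g \<bar>u\<bar> (x, x)) < 1"
      using c unfolding continuous_at_eps_delta by (elim allE[of _ 1]) auto
    have "\<forall>\<^sub>F T in at_top. h T < d / 2" by (rule order_tendstoD[OF h_lim]) (use d in auto)
    then show "\<forall>\<^sub>F T in at_top. \<forall>q. B (fst q) \<noteq> 0 \<longrightarrow> B (snd q) \<noteq> 0 \<longrightarrow>
        \<bar>g \<bar>u\<bar> ((x, x) - h T *\<^sub>R q)\<bar> \<le> \<bar>g \<bar>u\<bar> (x, x)\<bar> + 1"
      using eventually_gt_at_top[of 0]
    proof eventually_elim
      case (elim T)
      show ?case
      proof (intro allI impI)
        fix q :: "real \<times> real" assume "B (fst q) \<noteq> 0" "B (snd q) \<noteq> 0"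
        then have q: "\<bar>fst q\<bar> \<le> 1" "\<bar>snd q\<bar> \<le> 1" by (auto simp: B_def indicator_def split: if_splits)
        have "norm q \<le> norm (fst q) + norm (snd q)" using norm_Pair_le[of "fst q" "snd q"] by simp
        then have q2: "norm q \<le> 2" using q by simp
        have "dist ((x, x) - h T *\<^sub>R q) (x, x) = h T * norm q" using h[OF elim(2)] by (simp add: dist_norm)
        also have "\<dots> \<le> h T * 2" using h[OF elim(2)] q2 by (intro mult_left_mono) auto
        also have "\<dots> < d" using elim(1) by simp
        finally show "\<bar>g \<bar>u\<bar> ((x, x) - h T *\<^sub>R q)\<bar> \<le> \<bar>g \<bar>u\<bar> (x, x)\<bar> + 1"
          using d(2)[of "(x, x) - h T *\<^sub>R q"] by (simp add: dist_real_def)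
      qed
    qed
  qed
  show ?thesis
  proof (rule borel_measurable_LIMSEQ_real)
    show "(\<lambda>n. if u = 0 then 0 else autocov (rescale B (h (real (Suc n))) x) u) \<longlonglongrightarrow> g_diag x u" for u
    proof (cases "u = 0")
      case False
      have "filterlim (\<lambda>n. real (Suc n)) at_top sequentially"
        by (rule filterlim_compose[OF filterlim_real_sequentially filterlim_Suc])
      from filterlim_compose[OF lim[OF False] this] show ?thesis using False by (simp add: g_diag_def)
    qed (simp add: g_diag_def)
    fix n
    have "0 < h (real (Suc n))" by (intro h) simp
    note [measurable] = autocov_meas[OF rescale_meas[OF B_meas] rescale_bound[OF B_bound this]]
    show "(\<lambda>u. if u = 0 then 0 else autocov (rescale B (h (real (Suc n))) x) u) \<in> borel_measurable borel"
      by measurable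
  qed
qed

end

section \<open>Variance and bias of the estimator\<close>

locale kernel_estimation = joint_density_process M X f c f2
  for M :: "'a measure" and X :: "real \<Rightarrow> 'a \<Rightarrow> real" and f :: "real \<Rightarrow> real" and c :: real
    and f2 :: "real \<Rightarrow> real \<Rightarrow> real \<times> real \<Rightarrow> real" +
  fixes K h a H :: "real \<Rightarrow> real" and x :: real
  assumes K: "is_kernel K"
    and h_pos: "\<And>T. T > 0 \<Longrightarrow> h T > 0" and h_lim: "(h \<longlongrightarrow> 0) at_top"
    and H: "integrable lborel H" "\<And>u. 0 \<le> H u" "AE u in lborel. u \<noteq> 0 \<longrightarrow> (\<forall>p. \<bar>g \<bar>u\<bar> p\<bar> \<le> H u)"
    and cont: "\<And>u. 0 < u \<Longrightarrow> isCont (g u) (x, x)"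
    and a_pos: "\<And>T. T > 0 \<Longrightarrow> a T > 0" and a_lim: "(a \<longlongrightarrow> 0) at_top"
    and rate: "filterlim (\<lambda>T. a T * T * (h T)\<^sup>2 / (ln T) ^ 4) at_top at_top"
begin

lemma K_cont: "continuous_on UNIV K" and K_sym: "K (- u) = K u" and K_nonneg: "0 \<le> K u"
  and K_int: "integrable lborel K" and K_one: "(LINT u|lborel. K u) = 1"
  and K_square: "integrable lborel (\<lambda>u. u\<^sup>2 * K u)"
  using K by (auto simp: is_kernel_def)

lemma K_meas [measurable]: "K \<in> borel_measurable borel"
  using K_cont by (rule borel_measurable_continuous_onI)

definition \<kappa> :: real where "\<kappa> = (SUP u. K u)"

lemma K_bound: "K u \<le> \<kappa>"
  using K bounded_imp_bdd_above unfolding is_kernel_def \<kappa>_def by (intro cSUP_upper) auto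

abbreviation \<phi> :: "real \<Rightarrow> real \<Rightarrow> real" where "\<phi> T \<equiv> rescale K (h T) x"

lemma \<phi>_meas: "\<phi> T \<in> borel_measurable borel"
  by (rule rescale_meas[OF K_meas])

lemma \<phi>_bound: "0 < T \<Longrightarrow> 0 \<le> \<phi> T y" "0 < T \<Longrightarrow> \<phi> T y \<le> \<kappa> / h T"
  using rescale_bound[OF K_nonneg K_bound h_pos] by auto

lemma autocov_dominated:
  assumes "0 < T"
  shows "AE u in lborel. \<bar>autocov (\<phi> T) u\<bar> \<le> H u"
  using H(3) AE_lborel_singleton[of 0]
proof eventually_elim
  case (elim u)
  then show ?case
    by (intro autocov_rescale_bound[OF K_meas K_nonneg K_bound K_int K_one h_pos[OF assms]]) auto
qed

lemma autocov_integrable: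
  assumes "0 < T"
  shows "integrable lborel (autocov (\<phi> T))"
proof (rule Bochner_Integration.integrable_bound[OF H(1)])
  show "autocov (\<phi> T) \<in> borel_measurable lborel"
    using autocov_meas[OF \<phi>_meas \<phi>_bound[OF assms]] by simp
  show "AE u in lborel. norm (autocov (\<phi> T) u) \<le> norm (H u)"
    using autocov_dominated[OF assms] by eventually_elim (use H(2) in auto)
qed

lemma g_diag_dominated: "AE u in lborel. \<bar>g_diag x u\<bar> \<le> H u"
  using H(3) by eventually_elim (auto simp: g_diag_def H(2))

lemma g_diag_integrable: "integrable lborel (g_diag x)"
proof (rule Bochner_Integration.integrable_bound[OF H(1)])
  show "g_diag x \<in> borel_measurable lborel" using g_diag_meas[OF cont] by simp
  show "AE u in lborel. norm (g_diag x u) \<le> norm (H u)"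
    using g_diag_dominated by eventually_elim (use H(2) in auto)
qed

definition v :: real where "v = (LINT u:{0<..}|lborel. g u (x, x))"

lemma integral_g_diag: "(LINT u|lborel. g_diag x u) = 2 * v"
proof -
  note [measurable] = g_diag_meas[OF cont]
  have int: "integrable lborel (\<lambda>u. indicator A u * g_diag x u)" if [measurable]: "A \<in> sets borel" for A
    by (rule Bochner_Integration.integrable_bound[OF g_diag_integrable]) (auto simp: indicator_def)
  have "(LINT u|lborel. g_diag x u) = (LINT u|lborel. indicator {0<..} u * g_diag x u + indicator {..<0} u * g_diag x u)"
    by (intro Bochner_Integration.integral_cong) (auto simp: indicator_def g_diag_def)
  also have "\<dots> = (LINT u|lborel. indicator {0<..} u * g_diag x u) + (LINT u|lborel. indicator {..<0} u * g_diag x u)"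
    using int by (intro Bochner_Integration.integral_add) auto
  also have "(LINT u|lborel. indicator {..<0} u * g_diag x u) = (LINT u|lborel. indicator {0<..} u * g_diag x u)"
  proof -
    have "(LINT u|lborel. indicator {..<0} u * g_diag x u) = (LINT u|lborel. indicator {..<0} (- u) * g_diag x (- u))"
      using lborel_integral_real_affine[of "-1" "\<lambda>u. indicator {..<0} u * g_diag x u" 0] by simp
    also have "\<dots> = (LINT u|lborel. indicator {0<..} u * g_diag x u)"
      by (intro Bochner_Integration.integral_cong) (auto simp: indicator_def g_diag_def)
    finally show ?thesis .
  qed
  also have "(LINT u|lborel. indicator {0<..} u * g_diag x u) = v"
    unfolding v_def set_lebesgue_integral_def
    by (intro Bochner_Integration.integral_cong) (auto simp: indicator_def g_diag_def)
  finally show ?thesis by simp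
qed

text \<open>Dominated convergence with \<open>2 * H\<close>. Convergence in L1, rather than
  pointwise in the lag, is what makes the variance asymptotics uniform over all blocks.\<close>

lemma autocov_L1_limit: "((\<lambda>T. LINT u|lborel. \<bar>autocov (\<phi> T) u - g_diag x u\<bar>) \<longlongrightarrow> 0) at_top"
proof -
  \<comment> \<open>Set to 0 for nonpositive \<open>T\<close>, since dominated convergence asks for
    measurability at every index.\<close>
  define D where "D T u = (if 0 < T then \<bar>autocov (\<phi> T) u - g_diag x u\<bar> else 0)" for T u
  have "((\<lambda>T. LINT u|lborel. D T u) \<longlongrightarrow> (LINT u|(lborel :: real measure). 0)) at_top"
  proof (rule integral_dominated_convergence_at_top)
    show "integrable lborel (\<lambda>u. 2 * H u)" using H(1) by simp
    show "D T \<in> borel_measurable lborel" for T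
    proof (cases "0 < T")
      case True
      note [measurable] = autocov_meas[OF \<phi>_meas \<phi>_bound[OF True]] g_diag_meas[OF cont]
      show ?thesis using True unfolding D_def[abs_def] by simp
    qed (simp add: D_def[abs_def])
    show "\<forall>\<^sub>F T in at_top. AE u in lborel. norm (D T u) \<le> 2 * H u"
      using eventually_gt_at_top[of 0]
    proof eventually_elim
      case (elim T)
      show ?case using autocov_dominated[OF elim] g_diag_dominated
        by eventually_elim (auto simp: D_def elim)
    qed
    show "AE u in lborel. ((\<lambda>T. D T u) \<longlongrightarrow> 0) at_top"
      using H(3) AE_lborel_singleton[of 0]
    proof eventually_elim
      case (elim u)
      have "((\<lambda>T. autocov (\<phi> T) u) \<longlongrightarrow> g \<bar>u\<bar> (x, x)) at_top"
        using elim cont[of "\<bar>u\<bar>"]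
        by (intro autocov_rescale_tendsto[OF K_meas K_nonneg K_bound K_int K_one h_pos h_lim, where B = "H u"]) auto
      then have "((\<lambda>T. \<bar>autocov (\<phi> T) u - g_diag x u\<bar>) \<longlongrightarrow> \<bar>g \<bar>u\<bar> (x, x) - g_diag x u\<bar>) at_top"
        by (intro tendsto_intros)
      then have lim: "((\<lambda>T. \<bar>autocov (\<phi> T) u - g_diag x u\<bar>) \<longlongrightarrow> 0) at_top"
        using elim by (simp add: g_diag_def)
      have "\<forall>\<^sub>F T in at_top. \<bar>autocov (\<phi> T) u - g_diag x u\<bar> = D T u"
        using eventually_gt_at_top[of 0] by eventually_elim (simp add: D_def)
      from Lim_transform_eventually[OF lim this] show ?case .
    qed
  qed simp
  then have lim: "((\<lambda>T. LINT u|lborel. D T u) \<longlongrightarrow> 0) at_top" by simp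
  have "\<forall>\<^sub>F T in at_top. (LINT u|lborel. D T u) = (LINT u|lborel. \<bar>autocov (\<phi> T) u - g_diag x u\<bar>)"
    using eventually_gt_at_top[of 0] by eventually_elim (simp add: D_def)
  from Lim_transform_eventually[OF lim this] show ?thesis .
qed

lemma block_sum_variance_le:
  assumes T: "0 < T" and A: "time_set A"
  shows "expectation (\<lambda>\<omega>. (block_sum (\<phi> T) A \<omega>)\<^sup>2) \<le> (LINT u|lborel. H u) * len A"
  unfolding block_sum_square(1)[OF \<phi>_meas \<phi>_bound[OF T] A]
proof (rule double_integral_upper[OF A autocov_integrable[OF T] H(1) autocov_dominated[OF T]])
  show "expectation (\<lambda>\<omega>. centered (\<phi> T) s \<omega> * centered (\<phi> T) t \<omega>) = autocov (\<phi> T) (t - s)"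
    if "s \<in> A" "t \<in> A" "t \<noteq> s" for s t
    using that A by (intro covariance_autocov[OF \<phi>_meas \<phi>_bound[OF T]]) (auto simp: time_set_def)
qed (use block_sum_square(2,3)[OF \<phi>_meas \<phi>_bound[OF T] A] in auto)

lemma block_process_T:
  assumes T: "0 < T"
  shows "block_process M (block_sum (\<phi> T)) (\<kappa> / h T) c (LINT u|lborel. H u)"
  using H(2) block_sum_variance_le[OF T]
  by (intro block_process_block_sum[OF \<phi>_meas \<phi>_bound[OF T]] Bochner_Integration.integral_nonneg) auto

text \<open>The width \<open>w\<close> is fixed from the tail of \<open>g_diag\<close> alone.
  Admissible intervals grow at least like \<open>(ln T)\<^sup>2 / 4\<close>, so the boundary term
  \<open>2 * w * N\<close> is eventually small compared with their length.\<close>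

lemma variance_asymptotics:
  assumes \<epsilon>: "0 < \<epsilon>"
  shows "\<forall>\<^sub>F T in at_top. \<forall>A. is_interval A \<longrightarrow> time_set A \<longrightarrow> (ln T)\<^sup>2 / 4 \<le> len A \<longrightarrow>
     \<bar>expectation (\<lambda>\<omega>. (block_sum (\<phi> T) A \<omega>)\<^sup>2) - 2 * v * len A\<bar> \<le> \<epsilon> * len A"
proof -
  note [measurable] = g_diag_meas[OF cont]
  let ?\<tau> = "\<lambda>w. LINT u|lborel. indicator {u. w \<le> \<bar>u\<bar>} u * \<bar>g_diag x u\<bar>"
  have "(?\<tau> \<longlongrightarrow> (LINT u|(lborel :: real measure). 0)) at_top"
  proof (rule integral_dominated_convergence_at_top)
    show "integrable lborel (\<lambda>u. \<bar>g_diag x u\<bar>)" using g_diag_integrable by simp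
    show "AE u in lborel. ((\<lambda>w. indicator {u. w \<le> \<bar>u\<bar>} u * \<bar>g_diag x u\<bar>) \<longlongrightarrow> 0) at_top"
    proof (intro AE_I2 tendsto_eventually)
      fix u :: real
      show "\<forall>\<^sub>F w in at_top. indicator {u. w \<le> \<bar>u\<bar>} u * \<bar>g_diag x u\<bar> = 0"
        using eventually_gt_at_top[of "\<bar>u\<bar>"] by eventually_elim simp
    qed
  qed (auto intro!: always_eventually simp: indicator_def)
  then have "\<forall>\<^sub>F w in at_top. ?\<tau> w < \<epsilon> / 3"
    by (intro order_tendstoD(2)[where a = "\<epsilon> / 3"]) (use \<epsilon> in auto)
  then obtain w where w: "0 < w" "?\<tau> w < \<epsilon> / 3"
    using eventually_happens[OF eventually_conj[OF _ eventually_gt_at_top[of 0]]] by force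
  define N where "N = (LINT u|lborel. \<bar>g_diag x u\<bar>)"
  have "filterlim (\<lambda>T::real. (ln T)\<^sup>2) at_top at_top"
    by (intro filterlim_pow_at_top ln_at_top) simp
  \<comment> \<open>With \<open>len A\<close> at least a quarter of \<open>(ln T)\<^sup>2\<close>,
    the constant 24 gives \<open>2 * w * N \<le> \<epsilon> / 3 * len A\<close>.\<close>
  then have e1: "\<forall>\<^sub>F T::real in at_top. 24 * w * N / \<epsilon> \<le> (ln T)\<^sup>2" unfolding filterlim_at_top by blast
  have e2: "\<forall>\<^sub>F T in at_top. (LINT u|lborel. \<bar>autocov (\<phi> T) u - g_diag x u\<bar>) < \<epsilon> / 3"
    by (rule order_tendstoD[OF autocov_L1_limit]) (use \<epsilon> in auto)
  show ?thesis using e1 e2 eventually_gt_at_top[of 0]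
  proof eventually_elim
    case (elim T)
    show ?case
    proof (intro allI impI)
      fix A assume A: "is_interval A" "time_set A" "(ln T)\<^sup>2 / 4 \<le> len A"
      let ?D = "LINT u|lborel. \<bar>autocov (\<phi> T) u - g_diag x u\<bar>"
      have "\<bar>expectation (\<lambda>\<omega>. (block_sum (\<phi> T) A \<omega>)\<^sup>2) - (LINT u|lborel. g_diag x u) * len A\<bar>
          \<le> (?D + ?\<tau> w) * len A + 2 * w * N"
        unfolding block_sum_square(1)[OF \<phi>_meas \<phi>_bound[OF elim(3)] A(2)] N_def
      proof (rule double_integral_interval[OF A(2,1) w(1) autocov_integrable[OF elim(3)] g_diag_integrable])
        show "expectation (\<lambda>\<omega>. centered (\<phi> T) s \<omega> * centered (\<phi> T) t \<omega>) = autocov (\<phi> T) (t - s)"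
          if "s \<in> A" "t \<in> A" "t \<noteq> s" for s t
          using that A(2) by (intro covariance_autocov[OF \<phi>_meas \<phi>_bound[OF elim(3)]]) (auto simp: time_set_def)
      qed (use block_sum_square(2,3)[OF \<phi>_meas \<phi>_bound[OF elim(3)] A(2)] in auto)
      also have "\<dots> \<le> (\<epsilon> / 3 + \<epsilon> / 3) * len A + \<epsilon> / 3 * len A"
      proof (intro add_mono mult_right_mono)
        have "24 * w * N / \<epsilon> \<le> 4 * len A" using elim(1) A(3) by linarith
        then show "2 * w * N \<le> \<epsilon> / 3 * len A" using \<epsilon> by (simp add: field_simps)
      qed (use elim(2) w(2) in auto)
      finally show "\<bar>expectation (\<lambda>\<omega>. (block_sum (\<phi> T) A \<omega>)\<^sup>2) - 2 * v * len A\<bar> \<le> \<epsilon> * len A"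
        unfolding integral_g_diag by (simp add: algebra_simps)
    qed
  qed
qed

text \<open>\<open>2 * v\<close> is the limiting variance per unit of time. A negative
  \<open>v\<close>, with the error \<open>- v\<close> in the asymptotics, would make a second moment
  negative.\<close>

lemma v_nonneg: "0 \<le> v"
proof (rule ccontr)
  assume "\<not> 0 \<le> v"
  then have v: "0 < - v" by simp
  have "\<forall>\<^sub>F T::real in at_top. (ln T)\<^sup>2 / 4 \<le> T" by real_asymp
  then obtain T where T: "0 < T" "(ln T)\<^sup>2 / 4 \<le> T"
    "\<forall>A. is_interval A \<longrightarrow> time_set A \<longrightarrow> (ln T)\<^sup>2 / 4 \<le> len A \<longrightarrow>
     \<bar>expectation (\<lambda>\<omega>. (block_sum (\<phi> T) A \<omega>)\<^sup>2) - 2 * v * len A\<bar> \<le> - v * len A"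
    using eventually_happens[OF eventually_conj[OF eventually_conj[OF _ eventually_gt_at_top[of 0]] variance_asymptotics[OF v]]]
    by force
  have "\<bar>expectation (\<lambda>\<omega>. (block_sum (\<phi> T) {0..T} \<omega>)\<^sup>2) - 2 * v * T\<bar> \<le> - v * T"
    using T(3)[rule_format, of "{0..T}"] T(1,2) is_interval_cc by (simp add: time_set_def)
  moreover have "0 \<le> expectation (\<lambda>\<omega>. (block_sum (\<phi> T) {0..T} \<omega>)\<^sup>2)" by simp
  ultimately have "0 \<le> v * T" by linarith
  moreover have "v * T < 0" using v T(1) by (simp add: mult_less_0_iff)
  ultimately show False by linarith
qed

text \<open>The rate hypothesis enters here, through its reciprocal square root: the fourth power of
  the logarithm becomes the square demanded by the block construction.\<close>

lemma scale_limit: "((\<lambda>T. \<kappa> / h T * (ln T)\<^sup>2 / sqrt (a T * T)) \<longlongrightarrow> 0) at_top"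
proof -
  have "((\<lambda>T. \<kappa> * inverse (sqrt (a T * T * (h T)\<^sup>2 / (ln T) ^ 4))) \<longlongrightarrow> \<kappa> * 0) at_top"
    by (intro tendsto_mult tendsto_const tendsto_inverse_0_at_top filterlim_compose[OF sqrt_at_top rate])
  then have lim: "((\<lambda>T. \<kappa> * inverse (sqrt (a T * T * (h T)\<^sup>2 / (ln T) ^ 4))) \<longlongrightarrow> 0) at_top" by simp
  have "\<forall>\<^sub>F T in at_top. \<kappa> * inverse (sqrt (a T * T * (h T)\<^sup>2 / (ln T) ^ 4)) = \<kappa> / h T * (ln T)\<^sup>2 / sqrt (a T * T)"
    using eventually_gt_at_top[of 1]
  proof eventually_elim
    case (elim T)
    then have "0 < h T" using h_pos by simp
    moreover have "sqrt ((ln T) ^ 4) = (ln T)\<^sup>2"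
    proof -
      have "(ln T) ^ 4 = ((ln T)\<^sup>2)\<^sup>2" by (simp add: power_mult[symmetric])
      then show ?thesis by (simp only: real_sqrt_abs) simp
    qed
    ultimately have "sqrt (a T * T * (h T)\<^sup>2 / (ln T) ^ 4) = sqrt (a T * T) * h T / (ln T)\<^sup>2"
      by (simp add: real_sqrt_divide real_sqrt_mult)
    then show ?case by (simp add: field_simps)
  qed
  from Lim_transform_eventually[OF lim this] show ?thesis .
qed

lemma kernel_estimator_eq:
  assumes T: "0 < T" and \<omega>: "\<omega> \<in> space M"
  shows "kernel_estimator K h X x T \<omega> = block_sum (\<phi> T) {0..T} \<omega> / T + mean (\<phi> T)"
proof -
  have ts: "time_set {0..T}" by (auto simp: time_set_def)
  have hT: "0 < h T" using h_pos T .
  have int: "integrable lborel (\<lambda>t. indicator {0..T} t * centered (\<phi> T) t \<omega>)"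
    by (rule block_path_integrable[OF \<phi>_meas \<phi>_bound[OF T] ts \<omega>])
  have intI: "integrable lborel (\<lambda>t. mean (\<phi> T) * indicator {0..T} t :: real)"
    using emeasure_bounded_finite[OF bounded_closed_interval[of 0 T]]
    by (intro integrable_mult_right integrable_real_indicator) auto
  have "(LINT t:{0..T}|lborel. K ((x - X t \<omega>) / h T))
      = (LINT t|lborel. h T * (indicator {0..T} t * centered (\<phi> T) t \<omega> + mean (\<phi> T) * indicator {0..T} t))"
    unfolding set_lebesgue_integral_def using hT
    by (intro Bochner_Integration.integral_cong) (auto simp: indicator_def centered_def rescale_def max_def)
  also have "\<dots> = h T * (block_sum (\<phi> T) {0..T} \<omega> + mean (\<phi> T) * T)"
    using int intI T by (simp add: block_sum_def)
  finally show ?thesis using T hT unfolding kernel_estimator_def by (simp add: field_simps)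
qed

lemma kernel_estimator_rv:
  assumes T: "0 < T"
  shows "kernel_estimator K h X x T \<in> borel_measurable M"
proof -
  have "time_set {0..T}" by (auto simp: time_set_def)
  note [measurable] = block_sum_rv[OF \<phi>_meas \<phi>_bound[OF T] this]
  show ?thesis by (subst measurable_cong[OF kernel_estimator_eq[OF T]]) measurable
qed

lemma expectation_kernel_estimator:
  assumes T: "0 < T"
  shows "expectation (kernel_estimator K h X x T) = mean (\<phi> T)"
proof -
  have ts: "time_set {0..T}" by (auto simp: time_set_def)
  interpret B: block_process M "block_sum (\<phi> T)" "\<kappa> / h T" c "LINT u|lborel. H u"
    by (rule block_process_T[OF T])
  have "expectation (kernel_estimator K h X x T) = expectation (\<lambda>\<omega>. block_sum (\<phi> T) {0..T} \<omega> / T + mean (\<phi> T))"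
    by (intro Bochner_Integration.integral_cong) (auto simp: kernel_estimator_eq[OF T])
  then show ?thesis using B.S_integrable[OF ts] B.S_mean[OF ts] by (simp add: prob_space)
qed

text \<open>A deterministic shift multiplies the Laplace transform by a constant, so it adds to the
  scaled cumulant a term linear in \<open>l\<close>, which vanishes by hypothesis. Centring at the
  expectation and centring at \<open>f x\<close> are both instances.\<close>

lemma moderate_deviations_shifted:
  assumes b: "((\<lambda>T. sqrt (a T * T) * (mean (\<phi> T) - b T)) \<longlongrightarrow> 0) at_top"
  shows "moderate_deviations M (\<lambda>T \<omega>. sqrt T * (kernel_estimator K h X x T \<omega> - b T)) a (quadratic_rate v)"
proof (rule moderate_deviations_of_cgf_limit)
  define L where "L l T = (LINT \<omega>|M. exp (l * block_sum (\<phi> T) {0..T} \<omega> / sqrt (a T * T)))" for l T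
  have ts: "time_set {0..T}" for T by (auto simp: time_set_def)
  have L_lim: "((\<lambda>T. a T * ln (L l T)) \<longlongrightarrow> l\<^sup>2 * v) at_top" for l
    unfolding L_def
    by (rule block_process_cgf_limit[OF block_process_T a_pos a_lim v_nonneg scale_limit variance_asymptotics])
  have exponent: "l * (sqrt (a T) * (sqrt T * (kernel_estimator K h X x T \<omega> - b T))) / a T
      = l * block_sum (\<phi> T) {0..T} \<omega> / sqrt (a T * T) + l * (sqrt (a T * T) * (mean (\<phi> T) - b T)) / a T"
    if T: "0 < T" and \<omega>: "\<omega> \<in> space M" for l T \<omega>
  proof -
    have sT: "sqrt T / T = 1 / sqrt T" using T by (simp add: real_div_sqrt field_simps)
    have sa: "sqrt (a T) / a T = 1 / sqrt (a T)" using a_pos[OF T] by (simp add: field_simps)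
    have "l * (sqrt (a T) * (sqrt T * (kernel_estimator K h X x T \<omega> - b T))) / a T
        = l * block_sum (\<phi> T) {0..T} \<omega> * (sqrt T / T) * (sqrt (a T) / a T) + l * (sqrt (a T * T) * (mean (\<phi> T) - b T)) / a T"
      unfolding kernel_estimator_eq[OF T \<omega>] real_sqrt_mult
      by (simp add: algebra_simps add_divide_distrib diff_divide_distrib)
    then show ?thesis unfolding sT sa by (simp add: real_sqrt_mult)
  qed
  show meas: "(\<lambda>\<omega>. sqrt T * (kernel_estimator K h X x T \<omega> - b T)) \<in> borel_measurable M" if "T > 0" for T
    using kernel_estimator_rv[OF that] by simp
  show "gaussian_cgf_limit M (\<lambda>T \<omega>. sqrt (a T) * (sqrt T * (kernel_estimator K h X x T \<omega> - b T))) a v"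
  proof unfold_locales
    have intB: "integrable M (\<lambda>\<omega>. exp (l * block_sum (\<phi> T) {0..T} \<omega> / sqrt (a T * T)))" if "0 < T" for T l
      using block_process.exp_integrable[OF block_process_T[OF that] ts, of "l / sqrt (a T * T)" T] by simp
    have exp_eq: "exp (l * (sqrt (a T) * (sqrt T * (kernel_estimator K h X x T \<omega> - b T))) / a T)
        = exp (l * block_sum (\<phi> T) {0..T} \<omega> / sqrt (a T * T)) * exp (l * (sqrt (a T * T) * (mean (\<phi> T) - b T)) / a T)"
      if "0 < T" "\<omega> \<in> space M" for l T \<omega>
      unfolding exponent[OF that] exp_add ..
    show "integrable M (\<lambda>\<omega>. exp (l * (sqrt (a T) * (sqrt T * (kernel_estimator K h X x T \<omega> - b T))) / a T))"
      if "0 < T" for T l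
      using intB[OF that, of l] by (subst Bochner_Integration.integrable_cong[OF refl exp_eq[OF that]]) auto
    show "((\<lambda>T. a T * ln (LINT \<omega>|M. exp (l * (sqrt (a T) * (sqrt T * (kernel_estimator K h X x T \<omega> - b T))) / a T)))
        \<longlongrightarrow> l\<^sup>2 * v) at_top" for l
    proof -
      have "((\<lambda>T. a T * ln (L l T) + l * (sqrt (a T * T) * (mean (\<phi> T) - b T))) \<longlongrightarrow> l\<^sup>2 * v + l * 0) at_top"
        by (intro tendsto_intros L_lim b)
      then have lim: "((\<lambda>T. a T * ln (L l T) + l * (sqrt (a T * T) * (mean (\<phi> T) - b T))) \<longlongrightarrow> l\<^sup>2 * v) at_top"
        by simp
      have "\<forall>\<^sub>F T in at_top. a T * ln (L l T) + l * (sqrt (a T * T) * (mean (\<phi> T) - b T))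
          = a T * ln (LINT \<omega>|M. exp (l * (sqrt (a T) * (sqrt T * (kernel_estimator K h X x T \<omega> - b T))) / a T))"
        using eventually_gt_at_top[of 0]
      proof eventually_elim
        case (elim T)
        have L0: "0 < L l T"
          using block_process.mgf_ge_1[OF block_process_T[OF elim] ts, of "l / sqrt (a T * T)" T] by (simp add: L_def)
        have "(LINT \<omega>|M. exp (l * (sqrt (a T) * (sqrt T * (kernel_estimator K h X x T \<omega> - b T))) / a T))
            = L l T * exp (l * (sqrt (a T * T) * (mean (\<phi> T) - b T)) / a T)"
          unfolding L_def by (subst Bochner_Integration.integral_cong[OF refl exp_eq[OF elim]]) auto
        then show ?case using L0 a_pos[OF elim] by (simp add: ln_mult distrib_left)
      qed
      from Lim_transform_eventually[OF lim this] show ?thesis .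
    qed
  qed (use meas a_pos a_lim v_nonneg in auto)
qed

text \<open>Symmetry of \<open>K\<close> removes the first-order term. The remainder is estimated
  with the mean value theorem, which gives the constant \<open>l\<close> instead of
  \<open>l / 2\<close>; the order \<open>(h T)\<^sup>2\<close> is what counts.\<close>

lemma bias_bound:
  assumes T: "0 < T" and diff: "\<And>y. f differentiable (at y)" and lip: "l-lipschitz_on UNIV (deriv f)"
  shows "\<bar>mean (\<phi> T) - f x\<bar> \<le> l * (h T)\<^sup>2 * (LINT u|lborel. u\<^sup>2 * K u)"
proof -
  have hT: "0 < h T" using h_pos T .
  have taylor: "\<bar>f (x + d) - f x - d * deriv f x\<bar> \<le> l * d\<^sup>2" for d
  proof -
    have der: "(f has_real_derivative deriv f y) (at y)" for y
      using diff[of y] by (simp add: DERIV_deriv_iff_real_differentiable)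
    have "\<exists>\<xi>. \<bar>\<xi> - x\<bar> \<le> \<bar>d\<bar> \<and> f (x + d) - f x = d * deriv f \<xi>"
    proof (cases d "0 :: real" rule: linorder_cases)
      case less
      obtain z where "x + d < z" "z < x" "f x - f (x + d) = (x - (x + d)) * deriv f z"
        using MVT2[of "x + d" x f "deriv f"] less der by auto
      then show ?thesis by (intro exI[of _ z]) (auto simp: algebra_simps)
    next
      case greater
      obtain z where "x < z" "z < x + d" "f (x + d) - f x = (x + d - x) * deriv f z"
        using MVT2[of x "x + d" f "deriv f"] greater der by auto
      then show ?thesis by (intro exI[of _ z]) auto
    qed (auto intro: exI[of _ x])
    then obtain \<xi> where \<xi>: "\<bar>\<xi> - x\<bar> \<le> \<bar>d\<bar>" "f (x + d) - f x = d * deriv f \<xi>" by blast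
    have "\<bar>deriv f \<xi> - deriv f x\<bar> \<le> l * \<bar>\<xi> - x\<bar>"
      using lipschitz_onD[OF lip, of \<xi> x] by (simp add: dist_real_def)
    also have "\<dots> \<le> l * \<bar>d\<bar>" using \<xi>(1) lipschitz_on_nonneg[OF lip] by (intro mult_left_mono) auto
    finally have "\<bar>d\<bar> * \<bar>deriv f \<xi> - deriv f x\<bar> \<le> \<bar>d\<bar> * (l * \<bar>d\<bar>)" by (intro mult_left_mono) auto
    then show ?thesis using \<xi>(2)
      by (simp add: power2_eq_square abs_mult[symmetric] right_diff_distrib mult_ac)
  qed
  have fint: "integrable lborel (\<lambda>y. f y * \<phi> T y)"
    using distributed_integrable[OF f_dens[of 0], of "\<phi> T"] f_nonneg \<phi>_integrable[OF \<phi>_meas \<phi>_bound[OF T], of 0] \<phi>_meas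
    by simp
  have scaled: "h T * (f (x - h T * u) * \<phi> T (x - h T * u)) = f (x - h T * u) * K u" for u
    using hT by (simp add: rescale_def)
  have int1: "integrable lborel (\<lambda>u. f (x - h T * u) * K u)"
    using lborel_integrable_real_affine[OF fint, of "- h T" x] hT
      integrable_mult_right[of "h T" lborel "\<lambda>u. f (x - h T * u) * \<phi> T (x - h T * u)"] by (simp add: scaled)
  have "mean (\<phi> T) = \<bar>- h T\<bar> *\<^sub>R (LINT u|lborel. f (x + (- h T) * u) * \<phi> T (x + (- h T) * u))"
    unfolding mean_def using hT by (intro lborel_integral_real_affine) auto
  also have "\<dots> = (LINT u|lborel. h T * (f (x - h T * u) * \<phi> T (x - h T * u)))" using hT by simp
  finally have mean: "mean (\<phi> T) = (LINT u|lborel. f (x - h T * u) * K u)" unfolding scaled .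
  have intuK: "integrable lborel (\<lambda>u. u * K u)"
  proof (rule Bochner_Integration.integrable_bound)
    show "integrable lborel (\<lambda>u. K u + u\<^sup>2 * K u)" using K_int K_square by simp
    show "AE u in lborel. norm (u * K u) \<le> norm (K u + u\<^sup>2 * K u)"
    proof (intro AE_I2)
      fix u :: real
      have "\<bar>u\<bar> \<le> 1 + u\<^sup>2"
        using sum_squares_bound[of 1 "\<bar>u\<bar>"] by simp
      then have "\<bar>u\<bar> * K u \<le> (1 + u\<^sup>2) * K u" using K_nonneg by (intro mult_right_mono)
      then show "norm (u * K u) \<le> norm (K u + u\<^sup>2 * K u)"
        using K_nonneg[of u] by (simp add: abs_mult distrib_right)
    qed
  qed measurable
  have zero: "(LINT u|lborel. u * K u) = 0"
    using lborel_integral_real_affine[of "-1" "\<lambda>u. u * K u" 0] K_sym by simp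
  have "mean (\<phi> T) - f x = (LINT u|lborel. f (x - h T * u) * K u - f x * K u + (h T * deriv f x) * (u * K u))"
    unfolding mean using int1 K_int intuK zero K_one by simp
  then have "\<bar>mean (\<phi> T) - f x\<bar>
      = \<bar>LINT u|lborel. f (x - h T * u) * K u - f x * K u + (h T * deriv f x) * (u * K u)\<bar>" by (rule arg_cong)
  also have "\<dots> \<le> (LINT u|lborel. (l * (h T)\<^sup>2) * (u\<^sup>2 * K u))"
  proof (rule integral_abs_bound_integral)
    show "\<bar>f (x - h T * u) * K u - f x * K u + (h T * deriv f x) * (u * K u)\<bar> \<le> (l * (h T)\<^sup>2) * (u\<^sup>2 * K u)" for u
    proof -
      have "f (x - h T * u) * K u - f x * K u + (h T * deriv f x) * (u * K u)
          = (f (x + (- h T * u)) - f x - (- h T * u) * deriv f x) * K u" by (simp add: algebra_simps)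
      also have "\<bar>\<dots>\<bar> \<le> l * (- h T * u)\<^sup>2 * K u"
        using taylor[of "- h T * u"] K_nonneg[of u] by (simp add: abs_mult mult_right_mono)
      finally show ?thesis by (simp add: power_mult_distrib mult_ac)
    qed
  qed (use int1 K_int intuK K_square in auto)
  also have "\<dots> = l * (h T)\<^sup>2 * (LINT u|lborel. u\<^sup>2 * K u)" by (rule integral_mult_right_zero)
  finally show ?thesis .
qed

lemma scaled_bias_limit:
  assumes diff: "\<And>y. f differentiable (at y)" and lip: "l-lipschitz_on UNIV (deriv f)"
    and small: "((\<lambda>T. a T * T * (h T) ^ 4) \<longlongrightarrow> 0) at_top"
  shows "((\<lambda>T. sqrt (a T * T) * (mean (\<phi> T) - f x)) \<longlongrightarrow> 0) at_top"
proof (rule Lim_null_comparison)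
  let ?C = "l * (LINT u|lborel. u\<^sup>2 * K u)"
  show "((\<lambda>T. ?C * sqrt (a T * T * (h T) ^ 4)) \<longlongrightarrow> 0) at_top"
    using tendsto_mult[OF tendsto_const[of ?C] tendsto_real_sqrt[OF small]] by simp
  show "\<forall>\<^sub>F T in at_top. norm (sqrt (a T * T) * (mean (\<phi> T) - f x)) \<le> ?C * sqrt (a T * T * (h T) ^ 4)"
    using eventually_gt_at_top[of 0]
  proof eventually_elim
    case (elim T)
    have "sqrt ((h T) ^ 4) = (h T)\<^sup>2"
    proof -
      have "(h T) ^ 4 = ((h T)\<^sup>2)\<^sup>2" by (simp add: power_mult[symmetric])
      then show ?thesis by (simp only: real_sqrt_abs) simp
    qed
    then have "?C * sqrt (a T * T * (h T) ^ 4) = sqrt (a T * T) * (l * (h T)\<^sup>2 * (LINT u|lborel. u\<^sup>2 * K u))"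
      by (simp add: real_sqrt_mult)
    moreover have "\<bar>sqrt (a T * T)\<bar> * \<bar>mean (\<phi> T) - f x\<bar> \<le> \<bar>sqrt (a T * T)\<bar> * (l * (h T)\<^sup>2 * (LINT u|lborel. u\<^sup>2 * K u))"
      by (intro mult_left_mono bias_bound[OF elim diff lip]) auto
    moreover have "\<bar>sqrt (a T * T)\<bar> = sqrt (a T * T)" using a_pos[OF elim] elim by simp
    ultimately show ?case by (simp only: real_norm_def abs_mult)
  qed
qed

end

theorem corollary7:
  fixes M :: "'a measure"
    and X :: "real \<Rightarrow> 'a \<Rightarrow> real"
    and f :: "real \<Rightarrow> real"
    and f2 :: "real \<Rightarrow> real \<Rightarrow> real \<times> real \<Rightarrow> real"
    and g :: "real \<Rightarrow> real \<times> real \<Rightarrow> real"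
    and K h a :: "real \<Rightarrow> real"
    and c x :: real
    and I :: "real \<Rightarrow> ereal"
  defines "g \<equiv> (\<lambda>u (y, z). f2 0 u (y, z) - f y * f z)"
    and "I \<equiv> quadratic_rate (LINT u:{0<..}|lborel. g u (x, x))"
  assumes "prob_space M"
    and "measurable_process M X"
    and "\<And>y. 0 \<le> f y"
    and "\<And>t. 0 \<le> t \<Longrightarrow> distributed M lborel (X t) (\<lambda>y. ennreal (f y))"
    and "\<And>s t p. 0 \<le> s \<Longrightarrow> 0 \<le> t \<Longrightarrow> s \<noteq> t \<Longrightarrow> 0 \<le> f2 s t p"
    and "\<And>s t. 0 \<le> s \<Longrightarrow> 0 \<le> t \<Longrightarrow> s \<noteq> t \<Longrightarrow>
           distributed M (lborel \<Otimes>\<^sub>M lborel) (\<lambda>\<omega>. (X s \<omega>, X t \<omega>)) (\<lambda>p. ennreal (f2 s t p))"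
    and "\<And>s t. 0 \<le> s \<Longrightarrow> 0 \<le> t \<Longrightarrow> s \<noteq> t \<Longrightarrow> f2 s t = f2 0 \<bar>t - s\<bar>"
    and "c > 0"
    and "\<And>u. 0 \<le> u \<Longrightarrow> alpha_mixing M X u \<le> exp (- c * u)"
    and "is_kernel K"
    and "\<And>T. T > 0 \<Longrightarrow> h T > 0"
    and "(h \<longlongrightarrow> 0) at_top"
    and "(\<lambda>u. SUP p. ennreal \<bar>g u p\<bar>) \<in> borel_measurable (lebesgue_on {0<..})"
    and "(\<integral>\<^sup>+ u. (SUP p. ennreal \<bar>g u p\<bar>) \<partial>lebesgue_on {0<..}) < \<infinity>"
    and "\<And>u. 0 < u \<Longrightarrow> isCont (g u) (x, x)"
    and "\<And>T. T > 0 \<Longrightarrow> a T > 0"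
    and "(a \<longlongrightarrow> 0) at_top"
    and "((\<lambda>T. a (of_int \<lfloor>T\<rfloor>) / a T) \<longlongrightarrow> 1) at_top"
    and "filterlim (\<lambda>T. a T * T * (h T)\<^sup>2 / (ln T) ^ 4) at_top at_top"
  shows "good_rate_function I \<and>
    moderate_deviations M
      (\<lambda>T \<omega>. sqrt T * (kernel_estimator K h X x T \<omega> - (LINT \<omega>'|M. kernel_estimator K h X x T \<omega>')))
      a I \<and>
    ((\<forall>y. f differentiable (at y)) \<and> (\<exists>l>0. l-lipschitz_on UNIV (deriv f)) \<and>
       ((\<lambda>T. a T * T * (h T) ^ 4) \<longlongrightarrow> 0) at_top \<longrightarrow>
     moderate_deviations M (\<lambda>T \<omega>. sqrt T * (kernel_estimator K h X x T \<omega> - f x)) a I)"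
proof -
  interpret P: joint_density_process M X f c f2
    using assms(3-11) by (intro joint_density_process.intro mixing_density_process.intro
        mixing_density_process_axioms.intro joint_density_process_axioms.intro)
  have g: "g = P.g"
    by (intro ext) (simp add: g_def P.g_def split_beta)
  obtain H where H: "integrable lborel H" "\<And>u. 0 \<le> H u"
    "AE u in lborel. u \<noteq> 0 \<longrightarrow> (\<forall>p. \<bar>P.g \<bar>u\<bar> p\<bar> \<le> H u)"
    using even_dominating_function[OF assms(15,16)] unfolding g by blast
  interpret E: kernel_estimation M X f c f2 K h a H x
    using assms(12-14,18,19,21) assms(17)[unfolded g] H
    by (intro kernel_estimation.intro P.joint_density_process_axioms kernel_estimation_axioms.intro)
  have I: "I = quadratic_rate E.v" by (simp add: I_def E.v_def g)
  \<comment> \<open>Centring at the expectation leaves no bias at all for positive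
    \<open>T\<close>.\<close>
  have "((\<lambda>T. sqrt (a T * T) * (P.mean (E.\<phi> T) - (LINT \<omega>'|M. kernel_estimator K h X x T \<omega>'))) \<longlongrightarrow> 0) at_top"
    by (intro tendsto_eventually eventually_mono[OF eventually_gt_at_top[of 0]])
       (simp add: E.expectation_kernel_estimator)
  from E.moderate_deviations_shifted[OF this] E.moderate_deviations_shifted[OF E.scaled_bias_limit]
  show ?thesis
    unfolding I using good_rate_function_quadratic[OF E.v_nonneg] by blast
qed

end
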